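(* Let $m\in\mathbb{C}$ with $\mathrm{Re}(m)>1$. Then $\mathcal{D}(H_m)=\mathcal{H}_0^2(\mathbb{R}_+)$.
   Context: $\mathbb{R}_+=]0,\infty[$; all operators act in the complex Hilbert space $L^2(\mathbb{R}_+)$, and $\mathcal{D}(T)$ is the domain of $T$. For $\alpha\in\mathbb{C}$, $L_\alpha$ is the differential expression $L_\alpha=-\frac{d^2}{dx^2}+\left(\alpha-\frac14\right)\frac1{x^2}$ (in the distributional sense on $\mathbb{R}_+$). $L_\alpha^{\max}$ is the operator given by $L_\alpha$ on $\mathcal{D}(L_\alpha^{\max})=\{f\in L^2(\mathbb{R}_+) : L_\alpha f\in L^2(\mathbb{R}_+)\}$, and $L_\alpha^{\min}$ is the closure of the restriction of $L_\alpha^{\max}$ to $C_c^\infty(\mathbb{R}_+)$. For $\mathrm{Re}(m)>-1$, $H_m$ is the restriction of $L_{m^2}^{\max}$ to $\mathcal{D}(H_m):=\mathcal{D}(L_{m^2}^{\min})+\mathbb{C}\,x^{\frac12+m}\xi$, where $\xi$ is any $C_c^\infty[0,\infty[$ function with $\xi=1$ near $0$. It is known that for $\mathrm{Re}(m)\ge 1$ one has $L_{m^2}^{\min}=H_m=L_{m^2}^{\max}$. $\mathcal{H}^2(\mathbb{R}_+)=\{f\in L^2(\mathbb{R}_+) : f''\in L^2(\mathbb{R}_+)\}$ and $\mathcal{H}^2_0(\mathbb{R}_+)=\{f\in\mathcal{H}^2(\mathbb{R}_+) : f(0)=f'(0)=0\}$. *)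

theory Defs
  imports "HOL-Analysis.Analysis"
begin

text \<open>
  Elements of \<open>L\<^sup>2(]0,\<infinity>[)\<close> are represented by functions \<open>real \<Rightarrow> complex\<close>, of which only the
  values on \<open>]0,\<infinity>[\<close> matter. Every space of \<open>L\<^sup>2\<close>-classes below is the set of all
  representatives of its elements, so it is closed under equality almost everywhere on
  \<open>]0,\<infinity>[\<close>, and equality of such sets is equality of the spaces of classes.
\<close>

abbreviation Rplus :: "real measure" where
  "Rplus \<equiv> lebesgue_on {0<..}"

definition L2 :: "(real \<Rightarrow> complex) set" where
  "L2 = {f \<in> borel_measurable Rplus. integrable Rplus (\<lambda>x. (cmod (f x))\<^sup>2)}"

definition L2_norm :: "(real \<Rightarrow> complex) \<Rightarrow> real" where
  "L2_norm f = sqrt (\<integral>x. (cmod (f x))\<^sup>2 \<partial>Rplus)"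

text \<open>
  Derivatives are taken within \<open>S\<close>: for \<open>S = {0..}\<close> they are one-sided at \<open>0\<close>, i.e. smoothness
  is up to the boundary.
\<close>

definition smooth_on :: "real set \<Rightarrow> (real \<Rightarrow> complex) \<Rightarrow> bool" where
  "smooth_on S f \<longleftrightarrow>
     (\<exists>D :: nat \<Rightarrow> real \<Rightarrow> complex. (\<forall>x\<in>S. D 0 x = f x) \<and>
        (\<forall>n. \<forall>x\<in>S. (D n has_vector_derivative D (Suc n) x) (at x within S)))"

text \<open>
  \<open>Cc_smooth {0<..}\<close> is \<open>C\<^sub>c\<^sup>\<infinity>(]0,\<infinity>[)\<close> and \<open>Cc_smooth {0..}\<close> is \<open>C\<^sub>c\<^sup>\<infinity>([0,\<infinity>[)\<close>.
\<close>

definition Cc_smooth :: "real set \<Rightarrow> (real \<Rightarrow> complex) set" where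
  "Cc_smooth S = {f. smooth_on S f \<and> (\<exists>K. compact K \<and> K \<subseteq> S \<and> (\<forall>x\<in>S - K. f x = 0))}"

definition deriv2 :: "(real \<Rightarrow> complex) \<Rightarrow> real \<Rightarrow> complex" where
  "deriv2 f x = vector_derivative (\<lambda>y. vector_derivative f (at y)) (at x)"

text \<open>
  \<open>dist_deriv2 f g\<close>: \<open>f'' = g\<close> as distributions on \<open>]0,\<infinity>[\<close>.
\<close>

definition dist_deriv2 :: "(real \<Rightarrow> complex) \<Rightarrow> (real \<Rightarrow> complex) \<Rightarrow> bool" where
  "dist_deriv2 f g \<longleftrightarrow>
     (\<forall>\<phi>\<in>Cc_smooth {0<..}. (\<integral>x. f x * deriv2 \<phi> x \<partial>Rplus) = (\<integral>x. g x * \<phi> x \<partial>Rplus))"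

text \<open>
  \<open>dist_L \<alpha> f g\<close>: \<open>L\<^sub>\<alpha> f = g\<close> as distributions on \<open>]0,\<infinity>[\<close>, where
  \<open>L\<^sub>\<alpha> = - d\<^sup>2/dx\<^sup>2 + (\<alpha> - 1/4) / x\<^sup>2\<close>. The pairing is bilinear (no complex conjugation), so that
  \<open>L\<^sub>\<alpha>\<close> is its own formal transpose.
\<close>

definition dist_L :: "complex \<Rightarrow> (real \<Rightarrow> complex) \<Rightarrow> (real \<Rightarrow> complex) \<Rightarrow> bool" where
  "dist_L \<alpha> f g \<longleftrightarrow>
     (\<forall>\<phi>\<in>Cc_smooth {0<..}.
        (\<integral>x. f x * (- deriv2 \<phi> x + (\<alpha> - 1/4) * (1 / (of_real x)\<^sup>2) * \<phi> x) \<partial>Rplus)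
          = (\<integral>x. g x * \<phi> x \<partial>Rplus))"

text \<open>
  Operators in \<open>L\<^sup>2\<close> are given by their graphs; the domain of \<open>T\<close> is \<open>Domain T\<close>.
\<close>

type_synonym L2_op = "((real \<Rightarrow> complex) \<times> (real \<Rightarrow> complex)) set"

definition op_restrict :: "L2_op \<Rightarrow> (real \<Rightarrow> complex) set \<Rightarrow> L2_op" where
  "op_restrict T D = {(f, g) \<in> T. f \<in> D}"

definition op_closure :: "L2_op \<Rightarrow> L2_op" where
  "op_closure T = {(f, g) \<in> L2 \<times> L2. \<exists>F G. (\<forall>n::nat. (F n, G n) \<in> T) \<and>
      (\<lambda>n. L2_norm (\<lambda>x. F n x - f x)) \<longlonglongrightarrow> 0 \<and>
      (\<lambda>n. L2_norm (\<lambda>x. G n x - g x)) \<longlonglongrightarrow> 0}"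

definition L_max :: "complex \<Rightarrow> L2_op" where
  "L_max \<alpha> = {(f, g) \<in> L2 \<times> L2. dist_L \<alpha> f g}"

definition L_min :: "complex \<Rightarrow> L2_op" where
  "L_min \<alpha> = op_closure (op_restrict (L_max \<alpha>) (Cc_smooth {0<..}))"

definition cutoff :: "(real \<Rightarrow> complex) \<Rightarrow> bool" where
  "cutoff \<xi> \<longleftrightarrow> \<xi> \<in> Cc_smooth {0..} \<and> (\<forall>\<^sub>F x in at_right 0. \<xi> x = 1)"

text \<open>
  \<open>H_dom m \<xi>\<close> is the domain of the operator \<open>H m \<xi>\<close>. Both are meant for \<open>Re m > -1\<close> and a
  cutoff \<open>\<xi>\<close>; then \<open>H_dom m \<xi>\<close> is contained in \<open>Domain (L_max (m\<^sup>2))\<close> and does not depend on the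
  choice of \<open>\<xi>\<close>.
\<close>

definition H_dom :: "complex \<Rightarrow> (real \<Rightarrow> complex) \<Rightarrow> (real \<Rightarrow> complex) set" where
  "H_dom m \<xi> = {f \<in> borel_measurable Rplus. \<exists>u \<in> Domain (L_min (m\<^sup>2)). \<exists>c.
      AE x in Rplus. f x = u x + c * (of_real x powr (1/2 + m) * \<xi> x)}"

definition H :: "complex \<Rightarrow> (real \<Rightarrow> complex) \<Rightarrow> L2_op" where
  "H m \<xi> = op_restrict (L_max (m\<^sup>2)) (H_dom m \<xi>)"

definition H2 :: "(real \<Rightarrow> complex) set" where
  "H2 = {f \<in> L2. \<exists>g\<in>L2. dist_deriv2 f g}"

text \<open>
  The boundary values \<open>f(0)\<close> and \<open>f'(0)\<close> of a class \<open>f\<close> in \<open>H2\<close> are those of its representative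
  \<open>u\<close> in \<open>C\<^sup>1([0,\<infinity>[)\<close>, with derivative \<open>v\<close>.
\<close>

definition H2_0 :: "(real \<Rightarrow> complex) set" where
  "H2_0 = {f \<in> H2. \<exists>u v. (AE x in Rplus. f x = u x) \<and>
      (\<forall>x\<ge>0. (u has_vector_derivative v x) (at x within {0..})) \<and> continuous_on {0..} v \<and>
      u 0 = 0 \<and> v 0 = 0}"

end

theory Submission imports Defs begin

text \<open>
  Writing \<open>a = 1/2 + m\<close>, the operator factorises as \<open>- L\<^bsub>m\<^sup>2\<^esub> = (d/dx + a/x) (d/dx - a/x)\<close>, and
  first order Hardy inequalities for the two factors give
  \<open>(Re m + 1) (Re m - 1) \<parallel>F / x\<^sup>2\<parallel> \<le> \<parallel>L\<^bsub>m\<^sup>2\<^esub> F\<parallel>\<close> for test functions \<open>F\<close>. So for \<open>Re m > 1\<close> the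
  graph norm of \<open>L\<^bsub>m\<^sup>2\<^esub>\<close> controls \<open>\<parallel>F''\<parallel>\<close>, and a limit \<open>u\<close> of test functions in the graph norm is
  the double primitive from \<open>0\<close> of a function in \<open>L\<^sup>2\<close>, which characterises \<open>H2_0\<close>. Conversely, if
  \<open>u\<close> is the double primitive of \<open>h \<in> L\<^sup>2\<close>, Hardy's inequality puts \<open>u' / x\<close> and \<open>u / x\<^sup>2\<close> into
  \<open>L\<^sup>2\<close>; hence cutting off at \<open>0\<close> and at infinity and approximating \<open>h\<close> by polynomials gives test
  functions \<open>F\<close> with \<open>F \<rightarrow> u\<close>, \<open>F'' \<rightarrow> h\<close> and \<open>F / x\<^sup>2 \<rightarrow> u / x\<^sup>2\<close> in \<open>L\<^sup>2\<close>. The function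
  \<open>x\<^bsup>1/2+m\<^esup> \<xi>\<close> is itself such a double primitive.
\<close>

section \<open>Square integrable functions\<close>

text \<open>Test functions vanish near 0, so \<open>f'' = g\<close> in the distributional sense
  determines \<open>f\<close> only up to an affine function, and the two boundary values are what
  excludes it. This is why everything is phrased with double primitives from 0: being one encodes
  the equation and the boundary values at once, and the class is visibly linear. Hardy's inequality
  controls \<open>u / x^2\<close> but not \<open>u\<close> itself, which is why square integrability
  of a double primitive is a separate condition throughout, and why the approximation carries a
  quantitative error weight to reach \<open>F -> u\<close>. The constants \<open>Re m + 1\<close>
  and \<open>1 - Re m\<close> are the first order constants \<open>q + 1/2 + Re c\<close>, for
  \<open>q = 0, c = a\<close> and for \<open>q = 1, c = -a\<close>. The second one vanishes at
  \<open>Re m = 1\<close>, and at the same value \<open>x^(m - 3/2)\<close>, the order of the second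
  derivative of \<open>x^(1/2+m)\<close>, stops being square integrable at 0.\<close>

definition sq :: "(real \<Rightarrow> complex) \<Rightarrow> ennreal" where
  "sq f = (\<integral>\<^sup>+x. ennreal ((cmod (f x))\<^sup>2) \<partial>Rplus)"

text \<open>Working with \<open>sq\<close> in \<open>ennreal\<close> and demanding only
  measurability lets limits be taken before square integrability is known; finiteness is recovered
  afterwards.\<close>

definition L2_null :: "(nat \<Rightarrow> real \<Rightarrow> complex) \<Rightarrow> bool" where
  "L2_null F \<longleftrightarrow> (\<forall>k. F k \<in> borel_measurable Rplus) \<and> (\<lambda>k. sq (F k)) \<longlonglongrightarrow> 0"

lemma L2_iff: "f \<in> L2 \<longleftrightarrow> f \<in> borel_measurable Rplus \<and> sq f < \<infinity>"
proof -
  have "integrable Rplus (\<lambda>x. (cmod (f x))\<^sup>2) \<longleftrightarrow> sq f < \<infinity>" if [measurable]: "f \<in> borel_measurable Rplus"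
    unfolding integrable_iff_bounded sq_def by simp
  then show ?thesis by (auto simp: L2_def)
qed

lemma L2_measurable [measurable_dest]: "f \<in> L2 \<Longrightarrow> f \<in> borel_measurable Rplus"
  by (simp add: L2_iff)

lemma L2_norm_sq: "f \<in> L2 \<Longrightarrow> ennreal ((L2_norm f)\<^sup>2) = sq f"
  unfolding L2_norm_def sq_def
  by (subst nn_integral_eq_integral) (auto simp: L2_def integral_nonneg_AE)

lemma sq_mono_AE:
  assumes "AE x in Rplus. cmod (f x) \<le> cmod (g x)"
  shows "sq f \<le> sq g"
  unfolding sq_def using assms
  by (intro nn_integral_mono_AE) (auto elim!: eventually_mono intro!: ennreal_leI power_mono)

lemma sq_cong_AE:
  assumes "AE x in Rplus. f x = g x"
  shows "sq f = sq g"
  unfolding sq_def using assms by (intro nn_integral_cong_AE) (auto elim!: eventually_mono)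

text \<open>The crude factor 2 comes from \<open>2 |a| |b| <= |a|^2 + |b|^2\<close>. It spares
  square roots in \<open>ennreal\<close>, and constants are irrelevant for null sequences.\<close>

lemma sq_add_le:
  assumes [measurable]: "f \<in> borel_measurable Rplus" "g \<in> borel_measurable Rplus"
  shows "sq (\<lambda>x. f x + g x) \<le> 2 * sq f + 2 * sq g"
proof -
  have "(cmod (f x + g x))\<^sup>2 \<le> 2 * (cmod (f x))\<^sup>2 + 2 * (cmod (g x))\<^sup>2" for x
  proof -
    have "(cmod (f x + g x))\<^sup>2 \<le> (cmod (f x) + cmod (g x))\<^sup>2"
      by (intro power_mono norm_triangle_ineq) auto
    also have "\<dots> \<le> 2 * (cmod (f x))\<^sup>2 + 2 * (cmod (g x))\<^sup>2"
      using sum_squares_bound[of "cmod (f x)" "cmod (g x)"] by (simp add: power2_sum)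
    finally show ?thesis .
  qed
  then have *: "ennreal ((cmod (f x + g x))\<^sup>2) \<le> 2 * ennreal ((cmod (f x))\<^sup>2) + 2 * ennreal ((cmod (g x))\<^sup>2)" for x
    using ennreal_leI[of "(cmod (f x + g x))\<^sup>2" "2 * (cmod (f x))\<^sup>2 + 2 * (cmod (g x))\<^sup>2"]
    by (simp add: ennreal_mult)
  have "sq (\<lambda>x. f x + g x) \<le> (\<integral>\<^sup>+x. 2 * ennreal ((cmod (f x))\<^sup>2) + 2 * ennreal ((cmod (g x))\<^sup>2) \<partial>Rplus)"
    unfolding sq_def by (intro nn_integral_mono *)
  also have "\<dots> = 2 * sq f + 2 * sq g"
    unfolding sq_def by (simp add: nn_integral_add nn_integral_cmult)
  finally show ?thesis .
qed

lemma sq_cmult: "f \<in> borel_measurable Rplus \<Longrightarrow> sq (\<lambda>x. c * f x) = ennreal ((cmod c)\<^sup>2) * sq f"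
  unfolding sq_def by (simp add: norm_mult power_mult_distrib ennreal_mult nn_integral_cmult)

lemma le_abs_mult: "a \<le> C * b \<Longrightarrow> 0 \<le> b \<Longrightarrow> a \<le> \<bar>C\<bar> * b" for a b C :: real
  by (rule order_trans[OF _ mult_right_mono]) auto

lemma L2_dominated:
  assumes "f \<in> L2" "g \<in> borel_measurable Rplus" "AE x in Rplus. cmod (g x) \<le> C * cmod (f x)"
  shows "g \<in> L2"
proof -
  have "sq g \<le> sq (\<lambda>x. of_real C * f x)"
    by (intro sq_mono_AE) (use assms(3) in \<open>auto simp: norm_mult elim!: eventually_mono intro!: le_abs_mult\<close>)
  also have "\<dots> < \<infinity>"
    using assms(1) by (subst sq_cmult) (auto simp: L2_iff ennreal_mult_less_top)
  finally show ?thesis using assms(2) by (simp add: L2_iff)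
qed

lemma L2_cong_AE:
  assumes "f \<in> L2" "g \<in> borel_measurable Rplus" "AE x in Rplus. g x = f x"
  shows "g \<in> L2"
  using assms by (auto simp: L2_iff sq_cong_AE[OF assms(3)])

lemma L2_add: "f \<in> L2 \<Longrightarrow> g \<in> L2 \<Longrightarrow> (\<lambda>x. f x + g x) \<in> L2"
  using sq_add_le[of f g]
  by (auto simp: L2_iff ennreal_mult_less_top intro: le_less_trans)

lemma L2_cmult: "f \<in> L2 \<Longrightarrow> (\<lambda>x. c * f x) \<in> L2"
  by (rule L2_dominated[of f _ "cmod c"]) (auto simp: norm_mult L2_iff)

lemma L2_diff: "f \<in> L2 \<Longrightarrow> g \<in> L2 \<Longrightarrow> (\<lambda>x. f x - g x) \<in> L2"
  using L2_add[of f "\<lambda>x. (-1) * g x"] L2_cmult[of g "-1"] by simp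

lemma L2_uminus: "f \<in> L2 \<Longrightarrow> (\<lambda>x. - f x) \<in> L2"
  using L2_cmult[of f "-1"] by simp

lemma ennreal_squeeze_0:
  fixes f g :: "nat \<Rightarrow> ennreal"
  assumes "g \<longlonglongrightarrow> 0" "\<And>k. f k \<le> g k"
  shows "f \<longlonglongrightarrow> 0"
proof (rule tendsto_sandwich)
  show "(\<lambda>_. 0) \<longlonglongrightarrow> (0::ennreal)" "g \<longlonglongrightarrow> 0"
    using assms by simp_all
qed (use assms in simp_all)

lemma nullD: "L2_null F \<Longrightarrow> F k \<in> borel_measurable Rplus" "L2_null F \<Longrightarrow> (\<lambda>k. sq (F k)) \<longlonglongrightarrow> 0"
  by (auto simp: L2_null_def)

lemma null_iff_L2_norm:
  assumes "\<And>k. F k \<in> L2"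
  shows "L2_null F \<longleftrightarrow> (\<lambda>k. L2_norm (F k)) \<longlonglongrightarrow> 0"
proof -
  have "L2_null F \<longleftrightarrow> (\<lambda>k. ennreal ((L2_norm (F k))\<^sup>2)) \<longlonglongrightarrow> ennreal 0"
    using assms by (simp add: L2_null_def L2_norm_sq L2_iff)
  also have "\<dots> \<longleftrightarrow> (\<lambda>k. (L2_norm (F k))\<^sup>2) \<longlonglongrightarrow> 0"
    by (intro tendsto_ennreal_iff) auto
  also have "\<dots> \<longleftrightarrow> (\<lambda>k. L2_norm (F k)) \<longlonglongrightarrow> 0"
    using tendsto_power[of "\<lambda>k. L2_norm (F k)" 0 sequentially 2]
      tendsto_real_sqrt[of "\<lambda>k. (L2_norm (F k))\<^sup>2" 0 sequentially]
    by (auto simp: L2_norm_def)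
  finally show ?thesis .
qed

lemma null_add:
  assumes "L2_null F" "L2_null G"
  shows "L2_null (\<lambda>k x. F k x + G k x)"
proof -
  note [measurable] = nullD(1)[OF assms(1)] nullD(1)[OF assms(2)]
  have lim: "(\<lambda>k. 2 * sq (F k) + 2 * sq (G k)) \<longlonglongrightarrow> 2 * 0 + 2 * 0"
    using assms by (intro tendsto_add ennreal_tendsto_cmult) (auto simp: L2_null_def)
  have "(\<lambda>k. sq (\<lambda>x. F k x + G k x)) \<longlonglongrightarrow> 0"
    by (rule ennreal_squeeze_0[OF lim[simplified]]) (auto simp: sq_add_le)
  then show ?thesis by (auto simp: L2_null_def)
qed

lemma null_dominated:
  assumes "L2_null F" "\<And>k. G k \<in> borel_measurable Rplus"
    and "\<And>k. AE x in Rplus. cmod (G k x) \<le> C * cmod (F k x)"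
  shows "L2_null G"
proof -
  note [measurable] = nullD(1)[OF assms(1)] assms(2)
  have le: "sq (G k) \<le> ennreal (C\<^sup>2) * sq (F k)" for k
  proof -
    have "sq (G k) \<le> sq (\<lambda>x. of_real C * F k x)"
      by (intro sq_mono_AE) (use assms(3)[of k] in \<open>auto simp: norm_mult elim!: eventually_mono intro!: le_abs_mult\<close>)
    then show ?thesis by (simp add: sq_cmult)
  qed
  have lim: "(\<lambda>k. ennreal (C\<^sup>2) * sq (F k)) \<longlonglongrightarrow> ennreal (C\<^sup>2) * 0"
    using assms by (intro ennreal_tendsto_cmult) (auto simp: L2_null_def)
  have "(\<lambda>k. sq (G k)) \<longlonglongrightarrow> 0"
    by (rule ennreal_squeeze_0[OF lim[simplified]]) (auto simp: le)
  then show ?thesis using assms(2) by (auto simp: L2_null_def)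
qed

lemma null_cmult: assumes "L2_null F" shows "L2_null (\<lambda>k x. c * F k x)"
proof -
  note [measurable] = nullD(1)[OF assms]
  show ?thesis by (rule null_dominated[OF assms, of _ "cmod c"]) (auto simp: norm_mult)
qed

lemma null_diff: "L2_null F \<Longrightarrow> L2_null G \<Longrightarrow> L2_null (\<lambda>k x. F k x - G k x)"
  using null_add[of F "\<lambda>k x. (-1) * G k x"] null_cmult[of G "-1"] by simp

lemma null_cong_AE:
  assumes "L2_null F" "\<And>k. G k \<in> borel_measurable Rplus" "\<And>k. AE x in Rplus. G k x = F k x"
  shows "L2_null G"
proof (rule null_dominated[OF assms(1,2), where C = 1])
  show "AE x in Rplus. cmod (G k x) \<le> 1 * cmod (F k x)" for k
    using assms(3)[of k] by eventually_elim simp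
qed

lemma null_dominated_convergence:
  assumes "w \<in> L2" and "\<And>k. F k \<in> borel_measurable Rplus"
    and "\<And>k. AE x in Rplus. cmod (F k x) \<le> C * cmod (w x)"
    and "AE x in Rplus. (\<lambda>k. F k x) \<longlonglongrightarrow> 0"
  shows "L2_null F"
proof -
  note [measurable] = L2_measurable[OF assms(1)] assms(2)
  have "(\<lambda>k. sq (F k)) \<longlonglongrightarrow> (\<integral>\<^sup>+x. 0 \<partial>Rplus)"
    unfolding sq_def
  proof (rule nn_integral_dominated_convergence[where w = "\<lambda>x. ennreal ((cmod (of_real C * w x))\<^sup>2)"])
    have "(\<lambda>x. of_real C * w x) \<in> L2" using assms(1) by (rule L2_cmult)
    then show "(\<integral>\<^sup>+x. ennreal ((cmod (of_real C * w x))\<^sup>2) \<partial>Rplus) < \<infinity>"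
      by (simp add: L2_iff sq_def)
    show "AE x in Rplus. ennreal ((cmod (F j x))\<^sup>2) \<le> ennreal ((cmod (of_real C * w x))\<^sup>2)" for j
      using assms(3)[of j]
      by (auto simp: norm_mult elim!: eventually_mono intro!: ennreal_leI power_mono le_abs_mult)
    show "AE x in Rplus. (\<lambda>i. ennreal ((cmod (F i x))\<^sup>2)) \<longlonglongrightarrow> 0"
      using assms(4)
    proof eventually_elim
      case (elim x)
      then have "(\<lambda>i. (cmod (F i x))\<^sup>2) \<longlonglongrightarrow> (cmod 0)\<^sup>2" by (intro tendsto_intros)
      then show ?case using tendsto_ennrealI by fastforce
    qed
  qed auto
  then show ?thesis using assms(2) by (auto simp: L2_null_def)
qed

text \<open>Write \<open>f = F k - (F k - f)\<close> for one \<open>k\<close> at which the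
  difference has finite \<open>sq\<close>. This is how a limit known only to be measurable enters
  \<open>L2\<close>.\<close>

lemma null_L2: assumes "L2_null (\<lambda>k x. F k x - f x)" "\<And>k. F k \<in> L2" "f \<in> borel_measurable Rplus"
  shows "f \<in> L2"
proof -
  have "eventually (\<lambda>k. sq (\<lambda>x. F k x - f x) < 1) sequentially"
    using nullD(2)[OF assms(1)] by (rule order_tendstoD) simp
  then obtain k where "sq (\<lambda>x. F k x - f x) < 1" by (auto simp: eventually_sequentially)
  then have "(\<lambda>x. F k x - f x) \<in> L2"
    using nullD(1)[OF assms(1), of k] by (auto simp: L2_iff intro: less_trans)
  from L2_diff[OF assms(2)[of k] this] show ?thesis by simp
qed

lemma null_unique:
  assumes "L2_null (\<lambda>k x. F k x - f x)" "L2_null (\<lambda>k x. F k x - g x)"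
    and [measurable]: "f \<in> borel_measurable Rplus" "g \<in> borel_measurable Rplus"
  shows "AE x in Rplus. f x = g x"
proof -
  have "L2_null (\<lambda>k x. g x - f x)"
    using null_diff[OF assms(1,2)] by simp
  then have "sq (\<lambda>x. g x - f x) = 0" by (simp add: L2_null_def LIMSEQ_const_iff)
  then have "AE x in Rplus. ennreal ((cmod (g x - f x))\<^sup>2) = 0"
    unfolding sq_def by (subst (asm) nn_integral_0_iff_AE) auto
  then show ?thesis by eventually_elim (auto simp: ennreal_eq_0_iff)
qed

lemma L2_mult_integrable:
  assumes "f \<in> L2" "g \<in> L2"
  shows "integrable Rplus (\<lambda>x. f x * g x)"
proof (rule Bochner_Integration.integrable_bound)
  note [measurable] = assms[THEN L2_measurable]
  show "integrable Rplus (\<lambda>x. (cmod (f x))\<^sup>2 + (cmod (g x))\<^sup>2)"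
    using assms by (auto simp: L2_def)
  have "cmod (f x) * cmod (g x) \<le> (cmod (f x))\<^sup>2 + (cmod (g x))\<^sup>2" for x
    using sum_squares_bound[of "cmod (f x)" "cmod (g x)"]
      mult_nonneg_nonneg[OF norm_ge_zero norm_ge_zero, of "f x" "g x"]
    unfolding mult.assoc by linarith
  then show "AE x in Rplus. norm (f x * g x) \<le> norm ((cmod (f x))\<^sup>2 + (cmod (g x))\<^sup>2)"
    by (auto simp: norm_mult)
  show "(\<lambda>x. f x * g x) \<in> borel_measurable Rplus" by measurable
qed

lemma L2_Cauchy_Schwarz:
  assumes "f \<in> L2" "g \<in> L2"
  shows "ennreal ((cmod (\<integral>x. f x * g x \<partial>Rplus))\<^sup>2) \<le> sq f * sq g"
proof -
  note [measurable] = assms[THEN L2_measurable]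
  have "ennreal (cmod (\<integral>x. f x * g x \<partial>Rplus)) \<le> (\<integral>\<^sup>+x. ennreal (cmod (f x * g x)) \<partial>Rplus)"
    by (intro integral_norm_bound_ennreal L2_mult_integrable assms)
  also have "\<dots> = (\<integral>\<^sup>+x. ennreal (cmod (f x)) * ennreal (cmod (g x)) \<partial>Rplus)"
    by (simp add: norm_mult ennreal_mult)
  finally have "(ennreal (cmod (\<integral>x. f x * g x \<partial>Rplus)))\<^sup>2
      \<le> (\<integral>\<^sup>+x. ennreal (cmod (f x)) * ennreal (cmod (g x)) \<partial>Rplus)\<^sup>2"
    by (intro power_mono) auto
  also have "\<dots> \<le> (\<integral>\<^sup>+x. (ennreal (cmod (f x)))\<^sup>2 \<partial>Rplus) * (\<integral>\<^sup>+x. (ennreal (cmod (g x)))\<^sup>2 \<partial>Rplus)"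
    by (intro Cauchy_Schwarz_nn_integral) auto
  finally show ?thesis by (simp add: sq_def ennreal_power)
qed

lemma null_integral_mult:
  assumes F: "L2_null (\<lambda>k x. F k x - f x)" "\<And>k. F k \<in> L2" "f \<in> L2" and g: "g \<in> L2"
  shows "(\<lambda>k. \<integral>x. F k x * g x \<partial>Rplus) \<longlonglongrightarrow> (\<integral>x. f x * g x \<partial>Rplus)"
proof -
  let ?d = "\<lambda>k. (\<integral>x. F k x * g x \<partial>Rplus) - (\<integral>x. f x * g x \<partial>Rplus)"
  have eq: "?d k = (\<integral>x. (F k x - f x) * g x \<partial>Rplus)" for k
    using L2_mult_integrable[OF F(2) g] L2_mult_integrable[OF F(3) g]
    by (simp add: left_diff_distrib)
  have lim: "(\<lambda>k. sq g * sq (\<lambda>x. F k x - f x)) \<longlonglongrightarrow> sq g * 0"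
    using g nullD(2)[OF F(1)] by (intro ennreal_tendsto_cmult) (auto simp: L2_iff)
  have "(\<lambda>k. ennreal ((cmod (?d k))\<^sup>2)) \<longlonglongrightarrow> 0"
    using L2_Cauchy_Schwarz[OF L2_diff[OF F(2,3)] g]
    unfolding eq by (intro ennreal_squeeze_0[OF lim[simplified]]) (simp only: mult.commute[of "sq g"])
  then have "(\<lambda>k. (cmod (?d k))\<^sup>2) \<longlonglongrightarrow> 0"
    unfolding ennreal_0[symmetric] by (subst (asm) tendsto_ennreal_iff) auto
  from tendsto_real_sqrt[OF this] have "?d \<longlonglongrightarrow> 0" by (simp add: tendsto_norm_zero_iff)
  then show ?thesis by (simp add: LIM_zero_iff)
qed

lemma null_AE_subseq:
  assumes "L2_null F"
  shows "\<exists>r::nat\<Rightarrow>nat. strict_mono r \<and> (AE x in Rplus. (\<lambda>k. F (r k) x) \<longlonglongrightarrow> 0)"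
proof -
  have ev: "eventually (\<lambda>k. sq (F k) < 1) sequentially"
    using nullD(2)[OF assms] by (rule order_tendstoD) simp
  \<comment> \<open>Early terms may have infinite \<open>sq\<close>. The shift by \<open>k0\<close>
    makes all terms square integrable, as the extraction of an almost everywhere convergent
    subsequence from L1 convergence requires.\<close>
  then obtain k0 where k0: "\<And>k. k \<ge> k0 \<Longrightarrow> sq (F k) < 1" by (auto simp: eventually_sequentially)
  have L2: "F (k + k0) \<in> L2" for k
    using k0[of "k+k0"] nullD(1)[OF assms, of "k+k0"] by (auto simp: L2_iff intro: less_trans)
  have "\<exists>r::nat\<Rightarrow>nat. strict_mono r \<and> (AE x in Rplus. (\<lambda>n. (cmod (F (r n + k0) x))\<^sup>2) \<longlonglongrightarrow> 0)"
  proof (rule tendsto_L1_AE_subseq)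
    show "integrable Rplus (\<lambda>x. (cmod (F (n + k0) x))\<^sup>2)" for n
      using L2[of n] by (auto simp: L2_def)
    have "(\<lambda>n. ennreal (\<integral>x. norm ((cmod (F (n + k0) x))\<^sup>2) \<partial>Rplus)) = (\<lambda>n. sq (F (n+k0)))"
      using L2 by (auto simp: sq_def L2_def nn_integral_eq_integral)
    moreover have "(\<lambda>n. sq (F (n+k0))) \<longlonglongrightarrow> 0"
      using nullD(2)[OF assms] by (rule LIMSEQ_ignore_initial_segment)
    ultimately have "(\<lambda>n. ennreal (\<integral>x. norm ((cmod (F (n + k0) x))\<^sup>2) \<partial>Rplus)) \<longlonglongrightarrow> ennreal 0"
      by simp
    then show "(\<lambda>n. \<integral>x. norm ((cmod (F (n + k0) x))\<^sup>2) \<partial>Rplus) \<longlonglongrightarrow> 0"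
      by (subst (asm) tendsto_ennreal_iff) auto
  qed
  then obtain r where r: "strict_mono r" "AE x in Rplus. (\<lambda>n. (cmod (F (r n + k0) x))\<^sup>2) \<longlonglongrightarrow> 0" by auto
  have "AE x in Rplus. (\<lambda>k. F (r k + k0) x) \<longlonglongrightarrow> 0"
    using r(2)
  proof eventually_elim
    case (elim x)
    from tendsto_real_sqrt[OF this] show ?case by (simp add: tendsto_norm_zero_iff)
  qed
  moreover have "strict_mono (\<lambda>k. r k + k0)" using r(1) by (auto simp: strict_mono_def)
  ultimately show ?thesis by blast
qed

section \<open>Primitives and the inequality of Hardy\<close>

text \<open>Cauchy-Schwarz for \<open>k s * s^(1/4)\<close> against \<open>s^(-1/4)\<close> on
  \<open>]0, x]\<close> bounds the square of the primitive by \<open>2 x^(1/2)\<close> times the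
  integral of \<open>k^2 s^(1/2)\<close>. After division by \<open>x^2\<close> and exchange of the
  integrals, \<open>2 x^(-3/2)\<close> integrated over \<open>x >= s\<close> gives
  \<open>4 s^(-1/2)\<close>, which cancels the weight and leaves the classical constant 4.\<close>

lemma nn_Hardy:
  fixes k :: "real \<Rightarrow> ennreal"
  assumes [measurable]: "k \<in> borel_measurable lborel"
  shows "(\<integral>\<^sup>+x. (ennreal (1 / x) * (\<integral>\<^sup>+s. k s * indicator {0<..x} s \<partial>lborel))\<^sup>2 * indicator {0<..} x \<partial>lborel)
     \<le> 4 * (\<integral>\<^sup>+s. (k s)\<^sup>2 * indicator {0<..} s \<partial>lborel)"
proof -
  \<comment> \<open>The integrand after Cauchy-Schwarz and division by \<open>x^2\<close>, where
    \<open>2 x^(1/2) x^(-2) = 2 x^(-3/2)\<close>, kept as a function of both variables for the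
    exchange of the integrals.\<close>
  define w where "w s x = (if 0 < s \<and> s \<le> x then (k s)\<^sup>2 * ennreal (s powr (1/2)) * ennreal (2 * x powr (-3/2)) else 0)" for s x
  have [measurable]: "case_prod w \<in> borel_measurable (lborel \<Otimes>\<^sub>M lborel)"
    unfolding w_def by measurable
  have 1: "(ennreal (1 / x) * (\<integral>\<^sup>+s. k s * indicator {0<..x} s \<partial>lborel))\<^sup>2 \<le> (\<integral>\<^sup>+s. w s x \<partial>lborel)" if x: "x > 0" for x
  proof -
    have p: "(s powr a)\<^sup>2 = s powr (2 * a)" for s a :: real
      by (simp add: power2_eq_square flip: powr_add)
    have q: "ennreal (s powr (1/4)) * ennreal (s powr - (1/4)) = 1" if "s > 0" for s :: real
      using that by (simp flip: ennreal_mult powr_add)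
    have "((\<lambda>s. if s \<in> {0..x} then s powr (-1/2) else 0) has_integral 2 * x powr (1/2)) UNIV"
      unfolding has_integral_restrict_UNIV using has_integral_powr_from_0[of "-1/2" x] x
      by (simp add: mult.commute)
    then have hi: "((\<lambda>s. s powr (-1/2) * indicator {0..x} s) has_integral 2 * x powr (1/2)) UNIV"
      by (rule has_integral_eq[rotated]) (auto simp: indicator_def)
    define a where "a s = k s * ennreal (s powr (1/4)) * indicator {0<..x} s" for s
    define b where "b s = ennreal (s powr - (1/4)) * indicator {0<..x} s" for s
    have [measurable]: "a \<in> borel_measurable lborel" "b \<in> borel_measurable lborel"
      unfolding a_def b_def by measurable
    have ab: "k s * indicator {0<..x} s = a s * b s" for s
      by (auto simp: a_def b_def indicator_def mult.assoc q)
    have a2: "(a s)\<^sup>2 = (k s)\<^sup>2 * ennreal (s powr (1/2)) * indicator {0<..x} s" for s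
      by (auto simp: a_def indicator_def power_mult_distrib ennreal_power p)
    \<comment> \<open>At \<open>s = 0\<close> both sides vanish because \<open>0 powr a = 0\<close>,
      so the closed interval of the integral formula does no harm.\<close>
    have b2: "(b s)\<^sup>2 = ennreal (s powr (-1/2) * indicator {0..x} s)" for s
      by (cases "s = 0") (auto simp: b_def indicator_def power_mult_distrib ennreal_power p)
    have b2': "(\<integral>\<^sup>+s. (b s)\<^sup>2 \<partial>lborel) = ennreal (2 * x powr (1/2))"
      unfolding b2 by (intro nn_integral_has_integral_lborel hi) auto
    have "(\<integral>\<^sup>+s. a s * b s \<partial>lborel)\<^sup>2 \<le> (\<integral>\<^sup>+s. (a s)\<^sup>2 \<partial>lborel) * (\<integral>\<^sup>+s. (b s)\<^sup>2 \<partial>lborel)"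
      by (intro Cauchy_Schwarz_nn_integral) auto
    then have "(ennreal (1 / x) * (\<integral>\<^sup>+s. k s * indicator {0<..x} s \<partial>lborel))\<^sup>2 \<le>
       (ennreal (1 / x))\<^sup>2 * ((\<integral>\<^sup>+s. (k s)\<^sup>2 * ennreal (s powr (1/2)) * indicator {0<..x} s \<partial>lborel) * ennreal (2 * x powr (1/2)))"
      unfolding power_mult_distrib ab a2 b2' by (rule mult_left_mono) simp
    also have "\<dots> = (\<integral>\<^sup>+s. (k s)\<^sup>2 * ennreal (s powr (1/2)) * indicator {0<..x} s \<partial>lborel) * ennreal (2 * x powr (-3/2))"
    proof -
      have "(1/x)\<^sup>2 = x powr (-2)" using x by (simp add: powr_minus power_inverse powr_numeral divide_inverse)
      then have "(1 / x)\<^sup>2 * (2 * x powr (1/2)) = 2 * x powr (-3/2)"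
        using x by (simp add: powr_add[symmetric])
      then have "(ennreal (1 / x))\<^sup>2 * ennreal (2 * x powr (1/2)) = ennreal (2 * x powr (-3/2))"
        using x by (simp add: ennreal_power ennreal_mult[symmetric])
      then show ?thesis by (simp only: mult.left_commute[of "(ennreal (1/x))\<^sup>2"])
    qed
    also have "\<dots> = (\<integral>\<^sup>+s. w s x \<partial>lborel)"
      unfolding w_def by (subst nn_integral_multc[symmetric])
         (auto simp: indicator_def intro!: nn_integral_cong)
    finally show ?thesis .
  qed
  have "(\<integral>\<^sup>+x. (ennreal (1 / x) * (\<integral>\<^sup>+s. k s * indicator {0<..x} s \<partial>lborel))\<^sup>2 * indicator {0<..} x \<partial>lborel)
     \<le> (\<integral>\<^sup>+x. (\<integral>\<^sup>+s. w s x \<partial>lborel) \<partial>lborel)"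
    using 1 by (intro nn_integral_mono) (auto simp: indicator_def)
  also have "\<dots> = (\<integral>\<^sup>+s. (\<integral>\<^sup>+x. w s x \<partial>lborel) \<partial>lborel)"
    by (rule lborel_pair.Fubini') measurable
  also have "\<dots> = (\<integral>\<^sup>+s. 4 * ((k s)\<^sup>2 * indicator {0<..} s) \<partial>lborel)"
  proof (intro nn_integral_cong)
    fix s :: real
    show "(\<integral>\<^sup>+x. w s x \<partial>lborel) = 4 * ((k s)\<^sup>2 * indicator {0<..} s)"
    proof (cases "s > 0")
      case True
      have "((\<lambda>x. if x \<in> {s..} then 2 * x powr (-3/2) else 0) has_integral 4 * s powr (-1/2)) UNIV"
        unfolding has_integral_restrict_UNIV
        using has_integral_mult_right[OF has_integral_powr_to_inf[of "-3/2" s], of 2] True by simp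
      then have hi: "((\<lambda>x. 2 * x powr (-3/2) * indicator {s..} x) has_integral 4 * s powr (-1/2)) UNIV"
        by (rule has_integral_eq[rotated]) (auto simp: indicator_def)
      have "(\<integral>\<^sup>+x. w s x \<partial>lborel) = (\<integral>\<^sup>+x. (k s)\<^sup>2 * ennreal (s powr (1/2)) * ennreal (2 * x powr (-3/2) * indicator {s..} x) \<partial>lborel)"
        unfolding w_def using True by (intro nn_integral_cong) (auto simp: indicator_def)
      also have "\<dots> = (k s)\<^sup>2 * ennreal (s powr (1/2)) * (\<integral>\<^sup>+x. ennreal (2 * x powr (-3/2) * indicator {s..} x) \<partial>lborel)"
        by (intro nn_integral_cmult) auto
      also have "(\<integral>\<^sup>+x. ennreal (2 * x powr (-3/2) * indicator {s..} x) \<partial>lborel) = ennreal (4 * s powr (-1/2))"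
        by (intro nn_integral_has_integral_lborel hi) auto
      also have "(k s)\<^sup>2 * ennreal (s powr (1/2)) * ennreal (4 * s powr (-1/2)) = (k s)\<^sup>2 * ennreal 4"
      proof -
        have "s powr (1/2) * s powr (-1/2) = 1" using True by (simp flip: powr_add)
        then have "s powr (1/2) * (4 * s powr (-1/2)) = 4" by linarith
        then show ?thesis by (simp only: mult.assoc ennreal_mult[symmetric] powr_ge_zero zero_le_numeral mult_nonneg_nonneg)
      qed
      finally show ?thesis using True by (simp add: mult.commute)
    qed (simp add: w_def)
  qed
  also have "\<dots> = 4 * (\<integral>\<^sup>+s. (k s)\<^sup>2 * indicator {0<..} s \<partial>lborel)"
    by (intro nn_integral_cmult) auto
  finally show ?thesis .
qed

section \<open>Primitives from 0 and their Hardy inequalities\<close>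

text \<open>\<open>{0<..x}\<close> leaves out 0, where a representative on the open half-line has an
  arbitrary value, and is empty for \<open>x <= 0\<close>, so that \<open>prim h\<close> vanishes
  there.\<close>

definition prim :: "(real \<Rightarrow> complex) \<Rightarrow> real \<Rightarrow> complex" where
  "prim h x = (LINT s:{0<..x}|lebesgue. h s)"

definition loc_integrable :: "(real \<Rightarrow> complex) \<Rightarrow> bool" where
  "loc_integrable h \<longleftrightarrow> (\<forall>x. set_integrable lebesgue {0<..x} h)"

text \<open>Measurability is enough: where \<open>h\<close> is not integrable up to
  \<open>x\<close>, the integral is 0 by convention and the pointwise bound is trivial.\<close>

lemma sq_Hardy:
  assumes "h \<in> borel_measurable Rplus"
  shows "sq (\<lambda>x. prim h x / of_real x) \<le> 4 * sq h"
proof -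
  define k where "k x = ennreal (cmod (if x \<in> {0<..} then h x else 0))" for x
  have [measurable]: "(\<lambda>x. if x \<in> {0<..} then h x else 0) \<in> borel_measurable lebesgue"
    using assms by (intro borel_measurable_if_I) auto
  have [measurable]: "k \<in> borel_measurable lebesgue"
    unfolding k_def by measurable
  \<comment> \<open>\<open>nn_Hardy\<close> rests on Fubini's theorem for the product of Borel
    measures, hence the passage to a Borel function equal to \<open>k\<close> almost
    everywhere.\<close>
  obtain k' where [measurable]: "k' \<in> borel_measurable lborel" and ae: "AE x in lborel. k x = k' x"
    using completion_ex_borel_measurable[OF \<open>k \<in> borel_measurable lebesgue\<close>] by auto
  have *: "ennreal (cmod (prim h x / of_real x)) \<le> ennreal (1 / x) * (\<integral>\<^sup>+s. k' s * indicator {0<..x} s \<partial>lborel)"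
    if x: "x > 0" for x
  proof -
    have "ennreal (cmod (prim h x)) \<le> (\<integral>\<^sup>+s. ennreal (cmod (indicator {0<..x} s *\<^sub>R h s)) \<partial>lebesgue)"
      unfolding prim_def set_lebesgue_integral_def
      by (cases "integrable lebesgue (\<lambda>s. indicat_real {0<..x} s *\<^sub>R h s)")
         (rule integral_norm_bound_ennreal, assumption, subst not_integrable_integral_eq, auto)
    also have "\<dots> = (\<integral>\<^sup>+s. k s * indicator {0<..x} s \<partial>lborel)"
      unfolding nn_integral_completion by (intro nn_integral_cong) (auto simp: k_def indicator_def)
    also have "\<dots> = (\<integral>\<^sup>+s. k' s * indicator {0<..x} s \<partial>lborel)"
      using ae by (intro nn_integral_cong_AE) (auto elim: eventually_mono)
    finally have "ennreal (1/x) * ennreal (cmod (prim h x)) \<le> ennreal (1 / x) * (\<integral>\<^sup>+s. k' s * indicator {0<..x} s \<partial>lborel)"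
      by (intro mult_left_mono) auto
    then show ?thesis using x by (simp add: norm_divide ennreal_mult[symmetric])
  qed
  have "sq (\<lambda>x. prim h x / of_real x) = (\<integral>\<^sup>+x. ennreal ((cmod (prim h x / of_real x))\<^sup>2) * indicator {0<..} x \<partial>lborel)"
    unfolding sq_def by (simp add: nn_integral_restrict_space nn_integral_completion)
  also have "\<dots> \<le> (\<integral>\<^sup>+x. (ennreal (1 / x) * (\<integral>\<^sup>+s. k' s * indicator {0<..x} s \<partial>lborel))\<^sup>2 * indicator {0<..} x \<partial>lborel)"
    using * by (intro nn_integral_mono) (auto simp: indicator_def ennreal_power[symmetric] intro: power_mono)
  also have "\<dots> \<le> 4 * (\<integral>\<^sup>+s. (k' s)\<^sup>2 * indicator {0<..} s \<partial>lborel)"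
    by (rule nn_Hardy) measurable
  also have "(\<integral>\<^sup>+s. (k' s)\<^sup>2 * indicator {0<..} s \<partial>lborel) = (\<integral>\<^sup>+s. (k s)\<^sup>2 * indicator {0<..} s \<partial>lborel)"
    using ae by (intro nn_integral_cong_AE) (auto elim: eventually_mono)
  also have "\<dots> = sq h"
    unfolding sq_def by (simp add: nn_integral_restrict_space nn_integral_completion)
      (auto intro!: nn_integral_cong simp: k_def indicator_def ennreal_power)
  finally show ?thesis .
qed

lemma prim_nonpos: "x \<le> 0 \<Longrightarrow> prim h x = 0"
  by (simp add: prim_def set_lebesgue_integral_def)

lemma prim_cong: "(\<And>s. 0 < s \<Longrightarrow> s \<le> x \<Longrightarrow> f s = g s) \<Longrightarrow> prim f x = prim g x"
  unfolding prim_def by (intro set_lebesgue_integral_cong) auto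

lemma prim_diff: "loc_integrable f \<Longrightarrow> loc_integrable g \<Longrightarrow> prim (\<lambda>x. f x - g x) x = prim f x - prim g x"
  unfolding prim_def loc_integrable_def by (intro set_integral_diff) auto

lemma L2_bounded_support:
  assumes "f \<in> borel_measurable Rplus" and "\<And>x. 0 < x \<Longrightarrow> cmod (f x) \<le> C"
    and "\<And>x. N < x \<Longrightarrow> f x = 0"
  shows "f \<in> L2"
proof -
  have C: "0 \<le> C" using order_trans[OF norm_ge_zero assms(2)[of 1]] by simp
  have "sq f \<le> (\<integral>\<^sup>+x. ennreal (C\<^sup>2) * indicator {0<..N} x \<partial>Rplus)"
    unfolding sq_def using assms(2,3)
    by (intro nn_integral_mono) (auto simp: indicator_def not_le intro!: ennreal_leI power_mono)
  also have "\<dots> = ennreal (C\<^sup>2) * emeasure Rplus {0<..N}"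
    by (intro nn_integral_cmult_indicator) (auto simp: sets_restrict_space_iff)
  also have "emeasure Rplus {0<..N} = emeasure lebesgue {0<..N}"
    by (subst emeasure_restrict_space) auto
  also have "ennreal (C\<^sup>2) * \<dots> < \<infinity>"
    by (cases "N \<ge> 0") (auto simp: ennreal_mult_less_top)
  finally show ?thesis using assms(1) by (simp add: L2_iff)
qed

text \<open>The product with the indicator of \<open>{0<..x}\<close>, itself square integrable, is
  integrable. The point is integrability all the way down to 0.\<close>

lemma loc_L2: assumes "f \<in> L2" shows "loc_integrable f"
  unfolding loc_integrable_def
proof
  fix x
  have "(\<lambda>s. complex_of_real (indicator {0<..x} s)) \<in> L2"
  proof (rule L2_bounded_support[of _ 1 x])
    have "{0<..x} \<in> sets Rplus" by (auto simp: sets_restrict_space_iff)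
    then show "(\<lambda>s. complex_of_real (indicator {0<..x} s)) \<in> borel_measurable Rplus" by measurable
  qed (auto simp: indicator_def)
  from L2_mult_integrable[OF assms this]
  have "integrable lebesgue (\<lambda>s. indicator {0<..} s *\<^sub>R (f s * complex_of_real (indicator {0<..x} s)))"
    by (simp add: integrable_restrict_space)
  then show "set_integrable lebesgue {0<..x} f"
    unfolding set_integrable_def
    by (subst Bochner_Integration.integrable_cong[OF refl, where g = "\<lambda>s. indicator {0<..} s *\<^sub>R (f s * complex_of_real (indicator {0<..x} s))"])
       (auto simp: indicator_def)
qed

lemma loc_continuous: assumes "continuous_on {0..} f" shows "loc_integrable f"
  unfolding loc_integrable_def
proof
  fix x
  have "f absolutely_integrable_on {0..x}"
    using assms by (intro absolutely_integrable_continuous_real) (auto intro: continuous_on_subset)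
  then show "set_integrable lebesgue {0<..x} f"
    by (rule set_integrable_subset) auto
qed

lemma prim_integral:
  assumes "loc_integrable h"
  shows "h integrable_on {0..x}" "prim h x = integral {0..x} h"
proof -
  have "(h has_integral prim h x) {0<..x}"
    using assms unfolding prim_def loc_integrable_def by (intro has_integral_set_lebesgue) auto
  then have "(h has_integral prim h x) {0..x}"
    by (subst has_integral_spike_set_eq[of _ "{0<..x}"]) (auto intro: negligible_subset[of "{0}"])
  then show "h integrable_on {0..x}" "prim h x = integral {0..x} h"
    by (auto simp: integral_unique)
qed

lemma continuous_on_prim: assumes "loc_integrable h" shows "continuous_on {0..} (prim h)"
proof -
  have "continuous (at x within {0..}) (prim h)" if "x \<ge> 0" for x
  proof -
    \<comment> \<open>The interval ends strictly to the right of \<open>x\<close>, so that near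
      \<open>x\<close> it agrees with \<open>{0..}\<close>.\<close>
    have "continuous_on {0..x+1} (\<lambda>y. integral {0..y} h)"
      using prim_integral[OF assms] by (intro indefinite_integral_continuous_1)
    then have "continuous_on {0..x+1} (prim h)"
      by (simp add: prim_integral(2)[OF assms])
    then have "continuous (at x within {0..x+1}) (prim h)"
      using that by (simp add: continuous_on_eq_continuous_within)
    moreover have "at x within {0..x+1} = at x within {0..}"
      by (rule at_within_nhd[of _ "{..<x+1}"]) (use that in auto)
    ultimately show ?thesis by simp
  qed
  then show ?thesis by (simp add: continuous_on_eq_continuous_within)
qed

lemma loc_prim: "loc_integrable h \<Longrightarrow> loc_integrable (prim h)"
  by (rule loc_continuous[OF continuous_on_prim])

lemma measurable_prim [measurable]: assumes "loc_integrable h" shows "prim h \<in> borel_measurable Rplus"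
  by (intro continuous_imp_measurable_on_sets_lebesgue continuous_on_subset[OF continuous_on_prim[OF assms]]) auto

lemma prim_has_vector_derivative:
  assumes "continuous_on {0..} h" "x \<ge> 0"
  shows "(prim h has_vector_derivative h x) (at x within {0..})"
proof -
  have "continuous_on {0..x+1} h" using assms(1) by (rule continuous_on_subset) auto
  then have "((\<lambda>y. integral {0..y} h) has_vector_derivative h x) (at x within {0..x+1})"
    using assms(2) by (intro integral_has_vector_derivative) auto
  then have "(prim h has_vector_derivative h x) (at x within {0..x+1})"
    by (simp only: prim_integral(2)[OF loc_continuous[OF assms(1)], symmetric])
  moreover have "at x within {0..x+1} = at x within {0..}"
    by (rule at_within_nhd[of _ "{..<x+1}"]) (use assms in auto)
  ultimately show ?thesis by simp
qed

text \<open>The derivative is asked for only inside the interval, with mere continuity at the ends.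
  This suits functions such as \<open>x^(1/2+m)\<close>, whose differentiation formula is available
  only for \<open>x > 0\<close>.\<close>

lemma prim_eqI:
  assumes "loc_integrable f" "x \<ge> 0" "continuous_on {0..x} F" "F 0 = 0"
    and "\<And>y. 0 < y \<Longrightarrow> y < x \<Longrightarrow> (F has_vector_derivative f y) (at y)"
  shows "prim f x = F x"
proof -
  have "(f has_integral (F x - F 0)) {0..x}"
    by (rule fundamental_theorem_of_calculus_interior_strong[of "{}"]) (use assms in auto)
  then show ?thesis using assms(4) by (simp add: prim_integral(2)[OF assms(1)] integral_unique)
qed

text \<open>With \<open>w = |prim h / x|\<close>, the modulus of \<open>prim (prim h) x\<close> is
  at most the integral of \<open>s * w s\<close> over \<open>]0, x]\<close>, hence at most
  \<open>x * prim w x\<close>. Division by \<open>x^2\<close> leaves \<open>prim w / x\<close>, and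
  Hardy's inequality for \<open>w\<close> and then for \<open>h\<close> gives
  \<open>16 = 4 * 4\<close>.\<close>

lemma sq_Hardy2:
  assumes "h \<in> L2"
  shows "sq (\<lambda>x. prim (prim h) x / (of_real x)\<^sup>2) \<le> 16 * sq h"
proof -
  define w where "w x = complex_of_real (cmod (prim h x / of_real x))" for x
  have [measurable]: "prim h \<in> borel_measurable Rplus"
    using assms by (intro measurable_prim loc_L2)
  have [measurable]: "(\<lambda>x. complex_of_real x) \<in> borel_measurable Rplus"
    by (intro continuous_imp_measurable_on_sets_lebesgue continuous_intros) auto
  have [measurable]: "w \<in> borel_measurable Rplus" unfolding w_def by measurable
  have sqw: "sq w \<le> 4 * sq h"
    using sq_Hardy[OF L2_measurable[OF assms]] by (simp add: sq_def w_def)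
  have wL2: "w \<in> L2"
    using assms by (auto simp: L2_iff ennreal_mult_less_top intro: le_less_trans[OF sqw])
  have "cmod (prim (prim h) x) \<le> cmod (of_real x * prim w x)" if "x > 0" for x
  proof -
    have i1: "set_integrable lebesgue {0<..x} (prim h)" and i2: "set_integrable lebesgue {0<..x} w"
      using loc_prim[OF loc_L2[OF assms]] loc_L2[OF wL2] by (auto simp: loc_integrable_def)
    have i3: "set_integrable lebesgue {0<..x} (\<lambda>s. cmod (w s))"
      using i2 by (rule set_integrable_norm)
    have "cmod (prim (prim h) x) \<le> (LINT s:{0<..x}|lebesgue. cmod (prim h s))"
      unfolding prim_def[of "prim h"] by (rule set_integral_norm_bound[OF i1])
    also have "\<dots> \<le> (LINT s:{0<..x}|lebesgue. x * cmod (w s))"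
    proof (rule set_integral_mono)
      show "set_integrable lebesgue {0<..x} (\<lambda>s. cmod (prim h s))" using i1 by (rule set_integrable_norm)
      show "set_integrable lebesgue {0<..x} (\<lambda>s. x * cmod (w s))"
        using i3 by (intro set_integrable_mult_right) auto
      fix s assume s: "s \<in> {0<..x}"
      then have "cmod (prim h s) = s * cmod (w s)" by (simp add: w_def norm_divide)
      also have "\<dots> \<le> x * cmod (w s)" using s by (intro mult_right_mono) auto
      finally show "cmod (prim h s) \<le> x * cmod (w s)" .
    qed
    also have "\<dots> = x * (LINT s:{0<..x}|lebesgue. cmod (w s))"
      by (rule set_integral_mult_right)
    also have "\<dots> = cmod (of_real (x * (LINT s:{0<..x}|lebesgue. cmod (w s))))"
      using that unfolding norm_of_real
      by (subst abs_of_nonneg) (auto simp: set_lebesgue_integral_def intro!: mult_nonneg_nonneg Bochner_Integration.integral_nonneg)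
    also have "of_real (x * (LINT s:{0<..x}|lebesgue. cmod (w s))) = of_real x * prim w x"
      unfolding prim_def by (simp add: w_def[abs_def] set_integral_complex_of_real)
    finally show ?thesis .
  qed
  then have "sq (\<lambda>x. prim (prim h) x / (of_real x)\<^sup>2) \<le> sq (\<lambda>x. prim w x / of_real x)"
    by (intro sq_mono_AE AE_I2) (auto simp: norm_divide norm_mult power2_eq_square field_simps norm_power)
  also have "\<dots> \<le> 4 * sq w" by (rule sq_Hardy) measurable
  also have "\<dots> \<le> 4 * (4 * sq h)" by (intro mult_left_mono sqw) auto
  finally show ?thesis by (simp add: mult.assoc[symmetric])
qed

section \<open>Test functions\<close>

lemma has_vector_derivative_at_0_outside:
  fixes f :: "real \<Rightarrow> 'a::real_normed_vector"
  assumes "(f has_vector_derivative d) (at x)" "open U" "x \<in> U" "\<And>y. y \<in> U \<Longrightarrow> f y = 0"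
  shows "d = 0"
proof -
  have "(f has_vector_derivative 0) (at x)"
    using assms by (intro has_vector_derivative_transform_within_open[of "\<lambda>_. 0" 0 x U f]) auto
  then show ?thesis using assms(1) vector_derivative_unique_at by blast
qed

lemma deriv2_eq:
  assumes "\<And>x. x > 0 \<Longrightarrow> (f has_vector_derivative f1 x) (at x)"
    and "\<And>x. x > 0 \<Longrightarrow> (f1 has_vector_derivative f2 x) (at x)" and "x > 0"
  shows "deriv2 f x = f2 x"
proof -
  have "((\<lambda>y. vector_derivative f (at y)) has_vector_derivative f2 x) (at x)"
    using assms by (intro has_vector_derivative_transform_within_open[OF assms(2), of x "{0<..}"])
      (auto intro!: vector_derivative_at[OF assms(1), symmetric])
  then show ?thesis unfolding deriv2_def by (rule vector_derivative_at)
qed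

lemma has_vector_derivative_within_Ioi:
  "(x::real) > 0 \<Longrightarrow> (f has_vector_derivative d) (at x within {0<..}) = (f has_vector_derivative d) (at x)"
  by (simp add: at_within_open[of x "{0<..}"])

text \<open>
  \<open>D n\<close> is the \<open>n\<close>-th derivative of a test function, extended by \<open>0\<close> to the whole line.
\<close>

definition tower :: "(nat \<Rightarrow> real \<Rightarrow> complex) \<Rightarrow> real \<Rightarrow> real \<Rightarrow> bool" where
  "tower D a b \<longleftrightarrow> 0 < a \<and> (\<forall>n x. (D n has_vector_derivative D (Suc n) x) (at x)) \<and>
     (\<forall>n x. x \<notin> {a..b} \<longrightarrow> D n x = 0)"

text \<open>A compact subset of the open half-line keeps a distance \<open>a > 0\<close> from 0, so
  extension by 0 is smooth across 0. The derivatives inherit the support because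
  \<open>{a..b}\<close> is closed: each point outside has a neighbourhood where the function
  vanishes.\<close>

lemma Cc_smoothE:
  assumes "\<phi> \<in> Cc_smooth {0<..}"
  obtains D a b where "tower D a b" "\<And>x. x > 0 \<Longrightarrow> D 0 x = \<phi> x"
proof -
  obtain D K where DK: "\<forall>x\<in>{0<..}. D 0 x = \<phi> x"
      "\<forall>n. \<forall>x\<in>{0<..}. (D n has_vector_derivative D (Suc n) x) (at x within {0<..})"
    and K: "compact K" "K \<subseteq> {0<..}" and K': "\<forall>x\<in>{0<..} - K. \<phi> x = 0"
    using assms unfolding Cc_smooth_def smooth_on_def by blast
  have D: "\<And>x. x > 0 \<Longrightarrow> D 0 x = \<phi> x"
      "\<And>n x. x > 0 \<Longrightarrow> (D n has_vector_derivative D (Suc n) x) (at x)"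
    using DK by (auto simp: has_vector_derivative_within_Ioi)
  note K = K K'[rule_format]
  obtain b where b: "\<And>x. x \<in> K \<Longrightarrow> x \<le> b"
    using compact_imp_bounded[OF K(1)] by (meson bdd_above.E bounded_imp_bdd_above)
  obtain a where a: "0 < a" "\<And>x. x \<in> K \<Longrightarrow> a \<le> x"
  proof (cases "K = {}")
    case False
    then obtain s where "s \<in> K" "\<forall>t\<in>K. s \<le> t" using compact_attains_inf[OF K(1)] by auto
    with K(2) that[of s] show ?thesis by auto
  qed (use that[of 1] in auto)
  have Kab: "K \<subseteq> {a..b}" using a b by auto
  define E where "E n x = (if x > 0 then D n x else 0)" for n x
  have E_der: "(E n has_vector_derivative E (Suc n) x) (at x)" if "x > 0" for n x
    using D(2)[OF that, of n] that
    by (auto simp: E_def intro: has_vector_derivative_transform_within_open[of _ _ _ "{0<..}"])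
  have E0: "E n x = 0" if "x \<notin> {a..b}" for n x
    using that
  proof (induction n arbitrary: x)
    case 0
    then have "x \<notin> K" using Kab by blast
    then show ?case using D(1)[of x] K(3)[of x] by (auto simp: E_def)
  next
    case (Suc n)
    show ?case
    proof (cases "x > 0")
      case True
      have "open (- {a..b})" by (simp add: open_Compl)
      then show ?thesis using has_vector_derivative_at_0_outside[OF E_der[OF True], of "-{a..b}" n] Suc by auto
    qed (simp add: E_def)
  qed
  have "(E n has_vector_derivative E (Suc n) x) (at x)" for n x
  proof (cases "x > 0")
    case False
    then have "(E n has_vector_derivative 0) (at x)"
      using a by (intro has_vector_derivative_transform_within_open[of "\<lambda>_. 0" 0 x "{..<a}" "E n"]) (auto simp: E0)
    then show ?thesis using False by (simp add: E_def[of "Suc n"])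
  qed (rule E_der)
  with E0 a(1) have "tower E a b" by (auto simp: tower_def)
  with that D(1) show ?thesis by (auto simp: E_def)
qed

lemma Cc_smoothI:
  assumes "smooth_on {0<..} f" "0 < a" "\<And>x. x > 0 \<Longrightarrow> x \<notin> {a..b} \<Longrightarrow> f x = 0"
  shows "f \<in> Cc_smooth {0<..}"
  unfolding Cc_smooth_def using assms by (auto intro!: exI[of _ "{a..b}"])

lemma towerD:
  assumes "tower D a b"
  shows "0 < a" "(D n has_vector_derivative D (Suc n) x) (at x)" "x \<notin> {a..b} \<Longrightarrow> D n x = 0"
    "continuous_on S (D n)"
  using assms unfolding tower_def
  by (auto intro!: continuous_at_imp_continuous_on has_vector_derivative_continuous)

lemma tower_deriv2:
  assumes "tower D a b" "\<And>x. x > 0 \<Longrightarrow> D 0 x = \<phi> x" "x > 0"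
  shows "deriv2 \<phi> x = D 2 x"
proof (rule deriv2_eq[OF _ _ assms(3)])
  show "(D 1 has_vector_derivative D 2 x) (at x)" for x
    using towerD(2)[OF assms(1), of 1] by (simp add: numeral_2_eq_2)
  show "(\<phi> has_vector_derivative D 1 x) (at x)" if "x > 0" for x
    using towerD(2)[OF assms(1), of 0 x] assms(2) that
    by (auto intro: has_vector_derivative_transform_within_open[of _ _ _ "{0<..}"])
qed

lemma compact_support_integrable:
  fixes p :: "real \<Rightarrow> 'a::euclidean_space"
  assumes "0 < a" "continuous_on {0<..} p" "\<And>x. x > 0 \<Longrightarrow> x \<notin> {a..b} \<Longrightarrow> p x = 0"
  shows "integrable Rplus p" "(\<integral>x. p x \<partial>Rplus) = integral {a..b} p"
proof -
  have ai: "set_integrable lebesgue {a..b} p"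
    using assms by (intro absolutely_integrable_continuous_real) (auto intro: continuous_on_subset)
  have eq: "(\<lambda>x. indicat_real {0<..} x *\<^sub>R p x) = (\<lambda>x. indicat_real {a..b} x *\<^sub>R p x)"
    using assms by (auto simp: indicator_def fun_eq_iff)
  show "integrable Rplus p"
    using ai by (simp add: integrable_restrict_space set_integrable_def eq)
  show "(\<integral>x. p x \<partial>Rplus) = integral {a..b} p"
    using set_lebesgue_integral_eq_integral(2)[OF ai]
    by (simp add: integral_restrict_space set_lebesgue_integral_def eq)
qed

lemma compact_support_integral_derivative:
  fixes p P :: "real \<Rightarrow> 'a::euclidean_space"
  assumes "0 < a" "continuous_on {0<..} p" "\<And>x. x > 0 \<Longrightarrow> (P has_vector_derivative p x) (at x)"
    and "\<And>x. x > 0 \<Longrightarrow> x \<notin> {a..b} \<Longrightarrow> P x = 0"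
  shows "(\<integral>x. p x \<partial>Rplus) = 0"
proof -
  \<comment> \<open>Widened so that both ends lie where \<open>P\<close> vanishes;
    \<open>max\<close> takes care of an empty \<open>{a..b}\<close>.\<close>
  let ?b = "max a b + 1"
  have p0: "p x = 0" if "x > 0" "x \<notin> {a/2..?b}" for x
  proof (rule has_vector_derivative_at_0_outside[OF assms(3)[OF that(1)], of "{0<..} - {a..b}"])
    show "open ({0<..} - {a..b})" by (intro open_Diff) auto
  qed (use that assms(4) in auto)
  have "(\<integral>x. p x \<partial>Rplus) = integral {a/2..?b} p"
    using assms(1) by (intro compact_support_integrable(2)[OF _ assms(2)] p0) auto
  also have "(p has_integral (P ?b - P (a/2))) {a/2..?b}"
    using assms(1) by (intro fundamental_theorem_of_calculus)
      (auto intro!: has_vector_derivative_at_within assms(3))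
  then have "integral {a/2..?b} p = P ?b - P (a/2)" by (rule integral_unique)
  also have "P ?b = 0"
  proof (rule assms(4))
    have "b < ?b" "a < ?b" by linarith+
    then show "0 < ?b" "?b \<notin> {a..b}" using assms(1) by (simp_all only: atLeastAtMost_iff not_le) linarith+
  qed
  also have "P (a / 2) = 0" using assms(1) by (auto simp: assms(4))
  finally show ?thesis by simp
qed

lemma integral_by_parts:
  fixes f g :: "real \<Rightarrow> complex"
  assumes "\<And>x. x > 0 \<Longrightarrow> (f has_vector_derivative f' x) (at x)"
    "\<And>x. x > 0 \<Longrightarrow> (g has_vector_derivative g' x) (at x)"
    "continuous_on {0<..} f'" "continuous_on {0<..} g'" "0 < a"
    "\<And>x. x > 0 \<Longrightarrow> x \<notin> {a..b} \<Longrightarrow> g x = 0" "\<And>x. x > 0 \<Longrightarrow> x \<notin> {a..b} \<Longrightarrow> g' x = 0"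
  shows "(\<integral>x. f x * g' x \<partial>Rplus) = - (\<integral>x. f' x * g x \<partial>Rplus)"
proof -
  have c: "continuous_on {0<..} f" "continuous_on {0<..} g"
    using assms(1,2) by (auto intro!: continuous_at_imp_continuous_on has_vector_derivative_continuous)
  have i: "integrable Rplus (\<lambda>x. f x * g' x)" "integrable Rplus (\<lambda>x. f' x * g x)"
    using assms c by (intro compact_support_integrable[of a _ b] continuous_intros; simp)+
  have "(\<integral>x. f x * g' x + f' x * g x \<partial>Rplus) = 0"
    using assms c by (intro compact_support_integral_derivative[of a _ "\<lambda>x. f x * g x" b])
      (auto intro!: continuous_intros has_vector_derivative_mult)
  then show ?thesis using i by (simp add: add_eq_0_iff)
qed

text \<open>The compact support of the tower removes all boundary terms, whatever \<open>f\<close>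
  does at 0 and at infinity.\<close>

lemma tower_by_parts2:
  assumes D: "tower D a b" and f: "\<And>x. x > 0 \<Longrightarrow> (f has_vector_derivative f1 x) (at x)"
    "\<And>x. x > 0 \<Longrightarrow> (f1 has_vector_derivative f2 x) (at x)" "continuous_on {0<..} f2"
  shows "(\<integral>x. f x * D 2 x \<partial>Rplus) = (\<integral>x. f2 x * D 0 x \<partial>Rplus)"
proof -
  have c: "continuous_on {0<..} f1"
    using f(2) by (auto intro!: continuous_at_imp_continuous_on has_vector_derivative_continuous)
  have "(\<integral>x. f x * D 2 x \<partial>Rplus) = - (\<integral>x. f1 x * D 1 x \<partial>Rplus)"
    using towerD(2)[OF D, of 1] towerD[OF D] c f
    by (intro integral_by_parts[of _ _ _ _ a b]) (auto simp: numeral_2_eq_2)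
  also have "(\<integral>x. f1 x * D 1 x \<partial>Rplus) = - (\<integral>x. f2 x * D 0 x \<partial>Rplus)"
    using towerD(2)[OF D, of 0] towerD[OF D] f
    by (intro integral_by_parts[of _ _ _ _ a b]) auto
  finally show ?thesis by simp
qed

section \<open>Hardy inequalities of first and second order for test functions\<close>

lemma measurable_continuous_Ioi: "continuous_on {0<..} f \<Longrightarrow> f \<in> borel_measurable Rplus"
  by (rule continuous_imp_measurable_on_sets_lebesgue) auto

lemma compact_support_L2:
  assumes "0 < a" "continuous_on {0<..} f" "\<And>x. x > 0 \<Longrightarrow> x \<notin> {a..b} \<Longrightarrow> f x = 0"
  shows "f \<in> L2"
  unfolding L2_def using assms
  by (auto intro!: measurable_continuous_Ioi compact_support_integrable[of a _ b] continuous_intros)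

lemma compact_support_sq:
  assumes "0 < a" "continuous_on {0<..} f" "\<And>x. x > 0 \<Longrightarrow> x \<notin> {a..b} \<Longrightarrow> f x = 0"
  shows "sq f = ennreal (\<integral>x. (cmod (f x))\<^sup>2 \<partial>Rplus)" "integrable Rplus (\<lambda>x. (cmod (f x))\<^sup>2)"
proof -
  show "integrable Rplus (\<lambda>x. (cmod (f x))\<^sup>2)"
    using compact_support_L2[OF assms] by (simp add: L2_def)
  then show "sq f = ennreal (\<integral>x. (cmod (f x))\<^sup>2 \<partial>Rplus)"
    unfolding sq_def by (intro nn_integral_eq_integral) auto
qed

text \<open>
  Expanding \<open>|F' + (c - d) F / x|\<^sup>2 \<ge> 0\<close> bounds the difference of the two integrands from below by
  \<open>d\<close> times the derivative of \<open>|F|\<^sup>2 / x\<^bsup>2q+1\<^esup>\<close>, which integrates to \<open>0\<close>.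
\<close>

lemma first_order_Hardy:
  fixes F F' :: "real \<Rightarrow> complex" and c :: complex and q :: nat
  assumes a: "0 < a" and F: "\<And>x. x > 0 \<Longrightarrow> (F has_vector_derivative F' x) (at x)" "continuous_on {0<..} F'"
    and supp: "\<And>x. x > 0 \<Longrightarrow> x \<notin> {a..b} \<Longrightarrow> F x = 0" "\<And>x. x > 0 \<Longrightarrow> x \<notin> {a..b} \<Longrightarrow> F' x = 0"
  defines "d \<equiv> q + 1/2 + Re c"
  shows "ennreal (d\<^sup>2) * sq (\<lambda>x. F x / of_real x ^ (q + 1)) \<le> sq (\<lambda>x. (F' x + c * F x / of_real x) / of_real x ^ q)"
proof -
  let ?f = "\<lambda>x. F x / of_real x ^ (q + 1)" and ?g = "\<lambda>x. (F' x + c * F x / of_real x) / of_real x ^ q"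
  have cF: "continuous_on {0<..} F"
    using F(1) by (auto intro!: continuous_at_imp_continuous_on has_vector_derivative_continuous)
  have cf: "continuous_on {0<..} ?f" and cg: "continuous_on {0<..} ?g"
    by (auto intro!: continuous_intros cF F(2))
  define P where "P x = (F x \<bullet> F x) * (1/x) ^ (2*q+1)" for x
  define p where "p x = 2 * (F x \<bullet> F' x) * (1/x) ^ (2*q+1) - (2*q+1) * (F x \<bullet> F x) * (1/x) ^ (2*q+2)" for x
  have cp: "continuous_on {0<..} p"
    unfolding p_def by (auto intro!: continuous_intros cF F(2))
  have P: "(P has_vector_derivative p x) (at x)" if "x > 0" for x
  proof -
    have 1: "((\<lambda>x. F x \<bullet> F x) has_vector_derivative 2 * (F x \<bullet> F' x)) (at x)"
      using bounded_bilinear.has_vector_derivative[OF bounded_bilinear_inner F(1)[OF that] F(1)[OF that]]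
      by (simp add: inner_commute)
    have "((\<lambda>x. 1/x) has_real_derivative - ((1/x)\<^sup>2)) (at x)"
      using that by (auto intro!: derivative_eq_intros simp: power2_eq_square)
    from DERIV_power[OF this, of "2*q+1"]
    have "((\<lambda>x. (1/x) ^ (2*q+1)) has_real_derivative - ((2*q+1) * (1/x) ^ (2*q+2))) (at x)"
      by (simp add: algebra_simps power2_eq_square)
    then have 2: "((\<lambda>x. (1/x) ^ (2*q+1)) has_vector_derivative - ((2*q+1) * (1/x) ^ (2*q+2))) (at x)"
      by (simp add: has_real_derivative_iff_has_vector_derivative)
    have "(F x \<bullet> F x) * - ((2*q+1) * (1/x) ^ (2*q+2)) + 2 * (F x \<bullet> F' x) * (1/x) ^ (2*q+1) = p x"
      unfolding p_def by simp
    with has_vector_derivative_mult[OF 1 2] show ?thesis unfolding P_def[abs_def] by simp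
  qed
  have p0: "(\<integral>x. p x \<partial>Rplus) = 0"
    by (rule compact_support_integral_derivative[OF a cp P, of b]) (auto simp: P_def supp)
  have ip: "integrable Rplus p"
    by (rule compact_support_integrable[OF a cp, of b]) (auto simp: p_def supp)
  have iF: "sq ?f = ennreal (\<integral>x. (cmod (?f x))\<^sup>2 \<partial>Rplus)" "integrable Rplus (\<lambda>x. (cmod (?f x))\<^sup>2)"
    by (rule compact_support_sq[OF a cf, of b]; simp add: supp)+
  have iG: "sq ?g = ennreal (\<integral>x. (cmod (?g x))\<^sup>2 \<partial>Rplus)" "integrable Rplus (\<lambda>x. (cmod (?g x))\<^sup>2)"
    by (rule compact_support_sq[OF a cg, of b]; simp add: supp)+
  have le: "d * p x \<le> (cmod (?g x))\<^sup>2 - d\<^sup>2 * (cmod (?f x))\<^sup>2" if "x > 0" for x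
  proof -
    define r where "r = 1 / x"
    have r: "r > 0" using that by (simp add: r_def)
    let ?u = "F' x + c * F x * of_real r"
    have g: "(cmod (?g x))\<^sup>2 = (?u \<bullet> ?u) * r ^ (2*q)"
      using that by (simp add: dot_square_norm norm_divide norm_power r_def power_divide power_mult[symmetric] mult.commute)
    have f: "(cmod (?f x))\<^sup>2 = (F x \<bullet> F x) * r ^ (2*q+2)"
      using that by (simp add: dot_square_norm norm_divide norm_power norm_mult r_def power_divide power_mult[symmetric] mult.commute power_add[symmetric] power_mult_distrib power2_eq_square mult_2_right)
    have "0 \<le> (?u - of_real (d * r) * F x) \<bullet> (?u - of_real (d * r) * F x)" by simp
    also have "\<dots> = (?u \<bullet> ?u) - 2 * d * r * (F x \<bullet> F' x) - 2 * d * Re c * r\<^sup>2 * (F x \<bullet> F x) + d\<^sup>2 * r\<^sup>2 * (F x \<bullet> F x)"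
      by (simp add: inner_complex_def algebra_simps power2_eq_square)
    finally have "0 \<le> ((?u \<bullet> ?u) - 2 * d * r * (F x \<bullet> F' x) - 2 * d * Re c * r\<^sup>2 * (F x \<bullet> F x) + d\<^sup>2 * r\<^sup>2 * (F x \<bullet> F x)) * r ^ (2*q)"
      using r by (intro mult_nonneg_nonneg) auto
    also have "\<dots> = (?u \<bullet> ?u) * r ^ (2*q) - d\<^sup>2 * ((F x \<bullet> F x) * r ^ (2*q+2)) - d * p x"
    proof -
      \<comment> \<open>This is the reason for the value of \<open>d\<close>: since
        \<open>2 d = 2 q + 1 + 2 Re c\<close>, the coefficient \<open>d^2 - 2 d Re c\<close> of
        \<open>|F|^2 r^2\<close> equals \<open>d (2 q + 1) - d^2\<close>, so that only
        \<open>- d^2\<close> is left beside \<open>- d * p\<close>.\<close>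
      have Rc: "Re c = d - real q - 1/2" by (simp add: d_def)
      show ?thesis unfolding p_def r_def[symmetric] Rc by (simp add: algebra_simps power2_eq_square power_add)
    qed
    finally show ?thesis unfolding g f by simp
  qed
  have "(\<integral>x. d * p x \<partial>Rplus) \<le> (\<integral>x. (cmod (?g x))\<^sup>2 - d\<^sup>2 * (cmod (?f x))\<^sup>2 \<partial>Rplus)"
    using ip iF(2) iG(2) le by (intro integral_mono) auto
  also have "\<dots> = (\<integral>x. (cmod (?g x))\<^sup>2 \<partial>Rplus) - d\<^sup>2 * (\<integral>x. (cmod (?f x))\<^sup>2 \<partial>Rplus)"
    using iF(2) iG(2) by (subst Bochner_Integration.integral_diff) simp_all
  finally have "d\<^sup>2 * (\<integral>x. (cmod (?f x))\<^sup>2 \<partial>Rplus) \<le> (\<integral>x. (cmod (?g x))\<^sup>2 \<partial>Rplus)"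
    using p0 by simp
  then show ?thesis
    unfolding iF(1) iG(1) by (simp only: ennreal_mult'[symmetric] zero_le_power2 ennreal_leI)
qed

text \<open>The inequality for \<open>w = F' - A F / x\<close>, with \<open>F = D 0\<close>, bounds
  \<open>w / x\<close>. The one for \<open>F\<close> is taken with the extra weight
  \<open>1 / x\<close> (\<open>q = 1\<close>), so that \<open>w / x\<close> is exactly its right
  hand side and the two constants multiply.\<close>

lemma second_order_Hardy:
  assumes m: "Re m > 1" and D: "tower D a b"
  shows "sq (\<lambda>x. D 0 x / (of_real x)\<^sup>2) \<le>
     ennreal (1 / ((Re m + 1) * (Re m - 1))\<^sup>2) * sq (\<lambda>x. - D 2 x + (m\<^sup>2 - 1/4) * D 0 x / (of_real x)\<^sup>2)"
proof -
  define A where "A = 1/2 + m"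
  define w where "w x = D 1 x - A * D 0 x / of_real x" for x
  define w' where "w' x = D 2 x - A * D 1 x / of_real x + A * D 0 x / (of_real x)\<^sup>2" for x
  have w: "(w has_vector_derivative w' x) (at x)" if "x > 0" for x
  proof -
    have "((\<lambda>x. complex_of_real (1/x)) has_vector_derivative of_real (- (1/x\<^sup>2))) (at x)"
      using that by (intro has_vector_derivative_of_real)
        (auto intro!: derivative_eq_intros simp: has_real_derivative_iff_has_vector_derivative[symmetric] power2_eq_square)
    from has_vector_derivative_mult[OF towerD(2)[OF D, of 0 x] this]
    have "((\<lambda>x. D 1 x - A * (D 0 x * complex_of_real (1/x))) has_vector_derivative
        D 2 x - A * (D 0 x * of_real (- (1/x\<^sup>2)) + D 1 x * complex_of_real (1/x))) (at x)"
      using towerD(2)[OF D, of 1 x]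
      by (intro has_vector_derivative_diff has_vector_derivative_mult_right) (auto simp: numeral_2_eq_2)
    then show ?thesis
      by (simp add: w_def[abs_def] w'_def algebra_simps)
  qed
  have cw: "continuous_on {0<..} w'"
    unfolding w'_def by (auto intro!: continuous_intros towerD[OF D])
  have "ennreal ((real 0 + 1/2 + Re A)\<^sup>2) * sq (\<lambda>x. w x / of_real x ^ (0 + 1))
      \<le> sq (\<lambda>x. (w' x + A * w x / of_real x) / of_real x ^ 0)"
    by (rule first_order_Hardy[OF towerD(1)[OF D] w cw, of b]) (auto simp: w_def w'_def towerD(3)[OF D])
  also have "\<dots> = sq (\<lambda>x. - D 2 x + (m\<^sup>2 - 1/4) * D 0 x / (of_real x)\<^sup>2)"
  proof -
    \<comment> \<open>The factorisation: the terms with \<open>D 1\<close> cancel, and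
      \<open>A^2 - A = m^2 - 1/4\<close>.\<close>
    have "w' x + A * w x / of_real x = - (- D 2 x + (m\<^sup>2 - 1/4) * D 0 x / (of_real x)\<^sup>2)" if "x > 0" for x
      using that unfolding w_def w'_def A_def by (simp add: field_simps power2_eq_square)
    then show ?thesis unfolding sq_def by (intro nn_integral_cong) (auto simp only: norm_minus_cancel space_lebesgue_on greaterThan_iff power_0 div_by_1)
  qed
  finally have 1: "ennreal ((Re m + 1)\<^sup>2) * sq (\<lambda>x. w x / of_real x) \<le> \<dots>"
    by (simp add: A_def add.commute)
  have "ennreal ((real 1 + 1/2 + Re (-A))\<^sup>2) * sq (\<lambda>x. D 0 x / of_real x ^ (1 + 1))
      \<le> sq (\<lambda>x. (D 1 x + (-A) * D 0 x / of_real x) / of_real x ^ 1)"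
    using towerD(2)[OF D, of 0]
    by (intro first_order_Hardy[OF towerD(1)[OF D], of _ _ b]) (auto simp: towerD[OF D])
  note 2 = this
  have 2: "ennreal ((Re m - 1)\<^sup>2) * sq (\<lambda>x. D 0 x / (of_real x)\<^sup>2) \<le> sq (\<lambda>x. w x / of_real x)"
  proof -
    have "(real 1 + 1/2 + Re (-A))\<^sup>2 = (Re m - 1)\<^sup>2" by (simp add: A_def power2_eq_square algebra_simps)
    moreover have "D 1 x + (-A) * D 0 x / of_real x = w x" for x by (simp add: w_def)
    ultimately show ?thesis using 2 by (simp add: power2_eq_square[of "complex_of_real _"])
  qed
  let ?c = "((Re m + 1) * (Re m - 1))\<^sup>2"
  have "ennreal ?c * sq (\<lambda>x. D 0 x / (of_real x)\<^sup>2) \<le> sq (\<lambda>x. - D 2 x + (m\<^sup>2 - 1/4) * D 0 x / (of_real x)\<^sup>2)"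
    using order_trans[OF mult_left_mono[OF 2] 1]
    by (simp add: power_mult_distrib ennreal_mult mult.assoc)
  then have "ennreal (1 / ?c) * (ennreal ?c * sq (\<lambda>x. D 0 x / (of_real x)\<^sup>2)) \<le> ennreal (1 / ?c) * sq (\<lambda>x. - D 2 x + (m\<^sup>2 - 1/4) * D 0 x / (of_real x)\<^sup>2)"
    by (intro mult_left_mono) auto
  moreover have "ennreal (1 / ?c) * ennreal ?c = 1"
    using m by (simp add: ennreal_mult[symmetric])
  ultimately show ?thesis by (simp add: mult.assoc[symmetric])
qed

section \<open>Smooth functions and cutoffs\<close>

text \<open>Iterating one chosen derivative inside \<open>P\<close> produces the whole sequence of
  derivatives. Smoothness is thereby reduced to finding a class of functions closed under
  differentiation, without formulas for the \<open>n\<close>-th derivative.\<close>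

lemma smooth_onI:
  assumes "P f" and step: "\<And>f. P f \<Longrightarrow> \<exists>g. P g \<and> (\<forall>x\<in>S. (f has_vector_derivative g x) (at x within S))"
  shows "smooth_on S f"
proof -
  obtain N where N: "\<And>f. P f \<Longrightarrow> P (N f) \<and> (\<forall>x\<in>S. (f has_vector_derivative N f x) (at x within S))"
    using step by metis
  have "P ((N ^^ n) f)" for n by (induction n) (use assms(1) N in auto)
  then show ?thesis unfolding smooth_on_def using N by (intro exI[of _ "\<lambda>n. (N ^^ n) f"]) auto
qed

lemma smooth_onD:
  assumes "smooth_on S f"
  obtains g where "smooth_on S g" "\<And>x. x \<in> S \<Longrightarrow> (f has_vector_derivative g x) (at x within S)"
proof -
  obtain D where D: "\<And>x. x \<in> S \<Longrightarrow> D 0 x = f x"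
    "\<And>n x. x \<in> S \<Longrightarrow> (D n has_vector_derivative D (Suc n) x) (at x within S)"
    using assms unfolding smooth_on_def by blast
  show ?thesis
  proof (rule that)
    show "smooth_on S (D 1)"
      unfolding smooth_on_def using D(2) by (intro exI[of _ "\<lambda>n. D (Suc n)"]) auto
    show "(f has_vector_derivative D 1 x) (at x within S)" if "x \<in> S" for x
      using D(2)[OF that, of 0] unfolding One_nat_def
      by (rule has_vector_derivative_transform[OF that, rotated]) (simp add: D(1))
  qed
qed

lemma smooth_on_antiderivative:
  assumes "smooth_on S g" "\<And>x. x \<in> S \<Longrightarrow> (f has_vector_derivative g x) (at x within S)"
  shows "smooth_on S f"
proof (rule smooth_onI[of "\<lambda>h. h = f \<or> smooth_on S h"])
  fix h assume "h = f \<or> smooth_on S h"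
  then show "\<exists>g. (g = f \<or> smooth_on S g) \<and> (\<forall>x\<in>S. (h has_vector_derivative g x) (at x within S))"
    using assms smooth_onD by metis
qed simp

lemma smooth_on_const: "smooth_on S (\<lambda>_. c)"
  by (rule smooth_onI[of "\<lambda>h. \<exists>c. h = (\<lambda>_. c)"]) (auto intro!: exI[of _ "\<lambda>_. 0"])

text \<open>
  Sums of products are closed under differentiation, unlike products; this replaces the Leibniz
  formula.
\<close>

inductive sum_of_products :: "((real \<Rightarrow> complex) \<Rightarrow> bool) \<Rightarrow> (real \<Rightarrow> complex) \<Rightarrow> bool" for Q where
  prod: "Q f \<Longrightarrow> Q g \<Longrightarrow> sum_of_products Q (\<lambda>x. f x * g x)"
| add: "sum_of_products Q f \<Longrightarrow> sum_of_products Q g \<Longrightarrow> sum_of_products Q (\<lambda>x. f x + g x)"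

lemma smooth_on_sum_of_products:
  assumes "sum_of_products (smooth_on S) f"
  shows "smooth_on S f"
proof (rule smooth_onI[of "sum_of_products (smooth_on S)", OF assms])
  fix f assume "sum_of_products (smooth_on S) f"
  then show "\<exists>g. sum_of_products (smooth_on S) g \<and> (\<forall>x\<in>S. (f has_vector_derivative g x) (at x within S))"
  proof induction
    case (prod f g)
    obtain f' where "smooth_on S f'" "\<And>x. x \<in> S \<Longrightarrow> (f has_vector_derivative f' x) (at x within S)"
      using smooth_onD[OF prod(1)] by blast
    moreover obtain g' where "smooth_on S g'" "\<And>x. x \<in> S \<Longrightarrow> (g has_vector_derivative g' x) (at x within S)"
      using smooth_onD[OF prod(2)] by blast
    ultimately show ?case using prod
      by (intro exI[of _ "\<lambda>x. f x * g' x + f' x * g x"])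
         (auto intro!: sum_of_products.intros has_vector_derivative_mult)
  next
    case (add f g)
    then obtain f' g' where "sum_of_products (smooth_on S) f'" "sum_of_products (smooth_on S) g'"
      "\<forall>x\<in>S. (f has_vector_derivative f' x) (at x within S)" "\<forall>x\<in>S. (g has_vector_derivative g' x) (at x within S)"
      by blast
    then show ?case
      by (intro exI[of _ "\<lambda>x. f' x + g' x"]) (auto intro!: sum_of_products.intros has_vector_derivative_add)
  qed
qed

lemma smooth_on_mult: "smooth_on S f \<Longrightarrow> smooth_on S g \<Longrightarrow> smooth_on S (\<lambda>x. f x * g x)"
  by (rule smooth_on_sum_of_products[OF sum_of_products.prod])

lemma smooth_on_add:
  assumes "smooth_on S f" "smooth_on S g"
  shows "smooth_on S (\<lambda>x. f x + g x)"
proof -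
  have "smooth_on S (\<lambda>x. f x * 1 + g x * 1)"
    by (rule smooth_on_sum_of_products) (intro sum_of_products.intros smooth_on_const assms)
  then show ?thesis by simp
qed

lemma has_vector_derivative_scale:
  fixes f :: "real \<Rightarrow> complex"
  assumes "(f has_vector_derivative f') (at (c * x))"
  shows "((\<lambda>x. f (c * x)) has_vector_derivative of_real c * f') (at x)"
proof -
  have "((\<lambda>x. c * x) has_vector_derivative c) (at x)"
    by (auto intro!: derivative_eq_intros simp: has_real_derivative_iff_has_vector_derivative[symmetric])
  from vector_diff_chain_at[OF this assms] show ?thesis by (simp add: o_def scaleR_conv_of_real)
qed

text \<open>The free factor \<open>k\<close> absorbs the powers of \<open>c\<close> coming from the
  chain rule, and so closes the class under differentiation.\<close>

lemma smooth_on_scale: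
  assumes "smooth_on {0<..} f" "c > 0"
  shows "smooth_on {0<..} (\<lambda>x. f (c * x))"
proof (rule smooth_onI[of "\<lambda>h. \<exists>k g. smooth_on {0<..} g \<and> h = (\<lambda>x. k * g (c * x))"])
  show "\<exists>k g. smooth_on {0<..} g \<and> (\<lambda>x. f (c * x)) = (\<lambda>x. k * g (c * x))"
    using assms(1) by (intro exI[of _ 1] exI[of _ f]) simp
  fix h assume "\<exists>k g. smooth_on {0<..} g \<and> h = (\<lambda>x. k * g (c * x))"
  then obtain k g where g: "smooth_on {0<..} g" and h: "h = (\<lambda>x. k * g (c * x))" by blast
  obtain g' where g': "smooth_on {0<..} g'" "\<And>x. x > 0 \<Longrightarrow> (g has_vector_derivative g' x) (at x)"
    using smooth_onD[OF g] by (auto simp: has_vector_derivative_within_Ioi)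
  have "(h has_vector_derivative (k * of_real c) * g' (c * x)) (at x within {0<..})" if "x > 0" for x
    unfolding h using has_vector_derivative_mult_right[OF has_vector_derivative_scale[OF g'(2)], of c x k] assms(2) that
    by (simp add: has_vector_derivative_within_Ioi mult.assoc)
  then show "\<exists>h'. (\<exists>k g. smooth_on {0<..} g \<and> h' = (\<lambda>x. k * g (c * x))) \<and>
      (\<forall>x\<in>{0<..}. (h has_vector_derivative h' x) (at x within {0<..}))"
    using g'(1) by (intro exI[of _ "\<lambda>x. (k * of_real c) * g' (c * x)"]) auto
qed

lemma smooth_on_polynomial_function:
  assumes "polynomial_function p"
  shows "smooth_on S p"
proof (rule smooth_onI[of polynomial_function, OF assms])
  fix f :: "real \<Rightarrow> complex" assume "polynomial_function f"
  then obtain g where "polynomial_function g" "\<And>x. (f has_vector_derivative g x) (at x)"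
    using has_vector_derivative_polynomial_function by blast
  then show "\<exists>g. polynomial_function g \<and> (\<forall>x\<in>S. (f has_vector_derivative g x) (at x within S))"
    using has_vector_derivative_at_within by blast
qed

lemma smooth_on_prim:
  assumes "continuous_on {0..} h" "smooth_on {0<..} h"
  shows "smooth_on {0<..} (prim h)"
  using assms(2)
proof (rule smooth_on_antiderivative)
  fix x :: real assume "x \<in> {0<..}"
  then show "(prim h has_vector_derivative h x) (at x within {0<..})"
    by (intro has_vector_derivative_within_subset[OF prim_has_vector_derivative[OF assms(1)]]) auto
qed

lemma at_within_Ici: "(x::real) > 0 \<Longrightarrow> at x within {0..} = at x"
  by (rule at_within_interior) simp

text \<open>The bound on \<open>x^n |D n x|\<close> is invariant under dilation of \<open>x\<close>,
  hence it survives uniformly when \<open>\<xi>\<close> is rescaled. Orders up to 2 are those that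
  enter a second derivative.\<close>

lemma cutoffE:
  assumes "cutoff \<xi>"
  obtains D :: "nat \<Rightarrow> real \<Rightarrow> complex" and a b M where
    "0 < a" "1 \<le> b" "a \<le> b" "1 \<le> M"
    "\<And>x. 0 \<le> x \<Longrightarrow> D 0 x = \<xi> x"
    "\<And>n x. 0 < x \<Longrightarrow> (D n has_vector_derivative D (Suc n) x) (at x)"
    "\<And>x. 0 < x \<Longrightarrow> x \<le> a \<Longrightarrow> D 0 x = 1" "\<And>n x. 0 < x \<Longrightarrow> x \<le> a \<Longrightarrow> D (Suc n) x = 0"
    "\<And>n x. b \<le> x \<Longrightarrow> D n x = 0" "\<And>n x. 0 < x \<Longrightarrow> n \<le> 2 \<Longrightarrow> x ^ n * cmod (D n x) \<le> M"
    "\<And>n x. 0 < x \<Longrightarrow> n \<le> 2 \<Longrightarrow> cmod (D n x) \<le> M"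
proof -
  have \<xi>: "\<xi> \<in> Cc_smooth {0..}" "eventually (\<lambda>x. \<xi> x = 1) (at_right 0)"
    using assms by (auto simp: cutoff_def)
  obtain D K where D0: "\<forall>x\<in>{0..}. D 0 x = \<xi> x"
    and D: "\<forall>n. \<forall>x\<in>{0..}. (D n has_vector_derivative D (Suc n) x) (at x within {0..})"
    and K: "compact K" "K \<subseteq> {0..}" and K': "\<forall>x\<in>{0..} - K. \<xi> x = 0"
    using \<xi>(1) unfolding Cc_smooth_def smooth_on_def by blast
  obtain b0 where b0: "\<And>x. x \<in> K \<Longrightarrow> x \<le> b0"
    using compact_imp_bounded[OF K(1)] by (meson bdd_above.E bounded_imp_bdd_above)
  obtain a0 where a0: "0 < a0" "\<And>x. 0 < x \<Longrightarrow> x < a0 \<Longrightarrow> \<xi> x = 1"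
    using \<xi>(2) by (auto simp: eventually_at_right_field)
  have der: "(D n has_vector_derivative D (Suc n) x) (at x)" if "x > 0" for n x
    using D that at_within_Ici[OF that] by (metis atLeast_iff less_imp_le)
  \<comment> \<open>\<open>b >= 1\<close> bounds \<open>x^j\<close> by \<open>b^2\<close> for
    \<open>j <= 2\<close> and \<open>x <= b\<close>; lying strictly above \<open>b0\<close> puts
    \<open>b\<close> itself into the open set where all derivatives vanish.\<close>
  define b where "b = max 1 (max a0 (b0 + 1))"
  have b: "b \<ge> 1" "b \<ge> a0" "b > b0" by (auto simp: b_def)
  have Db: "D n x = 0" if "x > max b0 0" for n x
    using that
  proof (induction n arbitrary: x)
    case 0
    then have "x \<notin> K" using b0[of x] by auto
    then show ?case using 0 D0 K' by auto
  next
    case (Suc n)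
    show ?case
      by (rule has_vector_derivative_at_0_outside[OF der[of x n], of "{max b0 0<..}"]) (use Suc in auto)
  qed
  have Da: "D (Suc n) x = 0" if "0 < x" "x < a0" for n x
    using that
  proof (induction n arbitrary: x)
    case 0
    have 1: "((\<lambda>x. D 0 x - 1) has_vector_derivative D (Suc 0) x) (at x)"
      using has_vector_derivative_diff[OF der[OF 0(1), of 0] has_vector_derivative_const[of 1]] by simp
    show ?case
      by (rule has_vector_derivative_at_0_outside[OF 1, of "{0<..<a0}"]) (use 0 a0(2) D0 in auto)
  next
    case (Suc n)
    show ?case
      by (rule has_vector_derivative_at_0_outside[OF der[of x "Suc n"], of "{0<..<a0}"]) (use Suc in auto)
  qed
  have "\<exists>B. \<forall>x\<in>{0..b}. cmod (D n x) \<le> B" for n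
  proof -
    have "continuous_on {0..} (D n)"
      using D by (auto simp: continuous_on_eq_continuous_within intro: has_vector_derivative_continuous)
    then have "continuous_on {0..b} (D n)" by (rule continuous_on_subset) auto
    then have "compact (D n ` {0..b})" by (rule compact_continuous_image) auto
    then show ?thesis using compact_imp_bounded bounded_iff by (metis imageI)
  qed
  then obtain B where B: "\<And>n x. x \<in> {0..b} \<Longrightarrow> cmod (D n x) \<le> B n" by metis
  define M where "M = 1 + (\<bar>B 0\<bar> + \<bar>B 1\<bar> + \<bar>B 2\<bar>) * b\<^sup>2"
  have M: "x ^ j * cmod (D n x) \<le> M" if "0 < x" "n \<le> 2" "j \<le> 2" for x n j
  proof (cases "x \<le> b")
    case True
    have b2: "1 \<le> b\<^sup>2" using b(1) by simp
    have "x ^ j \<le> b ^ j" using True that by (intro power_mono) auto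
    also have "\<dots> \<le> b\<^sup>2" using b(1) that by (intro power_increasing) auto
    finally have "x ^ j * cmod (D n x) \<le> b\<^sup>2 * \<bar>B n\<bar>"
      using B[of x n] that True by (intro mult_mono) auto
    also have "n = 0 \<or> n = 1 \<or> n = 2" using that by auto
    then have "\<bar>B n\<bar> \<le> \<bar>B 0\<bar> + \<bar>B 1\<bar> + \<bar>B 2\<bar>" by auto
    then have "b\<^sup>2 * \<bar>B n\<bar> \<le> b\<^sup>2 * (\<bar>B 0\<bar> + \<bar>B 1\<bar> + \<bar>B 2\<bar>)" by (intro mult_left_mono) auto
    finally show ?thesis by (simp add: M_def mult.commute)
  next
    case False
    then have "D n x = 0" using that b by (intro Db) auto
    then show ?thesis by (simp add: M_def)
  qed
  show ?thesis
  \<comment> \<open>\<open>\<xi> = 1\<close> is known on the open interval \<open>]0, a0[\<close>;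
    halving makes it hold up to and including the chosen endpoint.\<close>
  proof (rule that[of "a0/2" b M D])
    show "x ^ n * cmod (D n x) \<le> M" if "0 < x" "n \<le> 2" for n x using M that by blast
    show "cmod (D n x) \<le> M" if "0 < x" "n \<le> 2" for n x using M[of x n 0] that by simp
    show "D n x = 0" if "b \<le> x" for n x using that b by (intro Db) auto
    show "0 < a0 / 2" "1 \<le> b" "a0 / 2 \<le> b" using a0(1) b by auto
    show "1 \<le> M" by (simp add: M_def)
    show "D 0 x = \<xi> x" if "0 \<le> x" for x using D0 that by simp
    show "D 0 x = 1" if "0 < x" "x \<le> a0 / 2" for x using D0 a0(2)[of x] that by simp
    show "D (Suc n) x = 0" if "0 < x" "x \<le> a0 / 2" for n x using that by (intro Da) auto
  qed (rule der)
qed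

section \<open>Cutoffs at 0 and at infinity\<close>

text \<open>The bounds \<open>C / x\<close> and \<open>C / x^2\<close> are matched to Hardy's
  inequality: they dominate \<open>X' u'\<close> and \<open>X'' u\<close> by
  \<open>C |u' / x|\<close> and \<open>C |u / x^2|\<close>.\<close>

definition cutoff_seq :: "real \<Rightarrow> real \<Rightarrow> real \<Rightarrow> (nat \<Rightarrow> real \<Rightarrow> complex) \<Rightarrow> (nat \<Rightarrow> real \<Rightarrow> complex) \<Rightarrow>
    (nat \<Rightarrow> real \<Rightarrow> complex) \<Rightarrow> bool" where
  "cutoff_seq a b C X X' X'' \<longleftrightarrow> 0 < a \<and> 1 \<le> b \<and> a \<le> b \<and> 0 \<le> C \<and>
     (\<forall>k. smooth_on {0<..} (X k)) \<and>
     (\<forall>k. \<forall>x>0. (X k has_vector_derivative X' k x) (at x) \<and> (X' k has_vector_derivative X'' k x) (at x) \<and>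
        cmod (X k x) \<le> C \<and> cmod (X' k x) \<le> C / x \<and> cmod (X'' k x) \<le> C / x\<^sup>2 \<and>
        (x \<le> a / Suc k \<or> x \<ge> b * Suc k \<longrightarrow> X k x = 0 \<and> X' k x = 0 \<and> X'' k x = 0) \<and>
        (b / Suc k \<le> x \<and> x \<le> a * Suc k \<longrightarrow> X k x = 1 \<and> X' k x = 0 \<and> X'' k x = 0)) \<and>
     (\<forall>k. continuous_on {0<..} (X'' k))"

text \<open>
  The hypothesis supplies the only bump function that is needed: \<open>1 - \<xi> (n x)\<close> and \<open>\<xi> (x / n)\<close> cut
  off at \<open>0\<close> and at infinity, and by scaling the \<open>j\<close>-th derivative of their product is \<open>O(x\<^bsup>-j\<^esup>)\<close>
  uniformly in \<open>n\<close>.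
\<close>

lemma cutoff_seq_exists:
  assumes "cutoff \<xi>"
  obtains a b C X X' X'' where "cutoff_seq a b C X X' X''"
proof -
  obtain D :: "nat \<Rightarrow> real \<Rightarrow> complex" and a b M where ab: "0 < a" "1 \<le> b" "a \<le> b" "1 \<le> M"
    and D\<xi>: "\<And>x. 0 \<le> x \<Longrightarrow> D 0 x = \<xi> x"
    and der: "\<And>n x. 0 < x \<Longrightarrow> (D n has_vector_derivative D (Suc n) x) (at x)"
    and Da: "\<And>x. 0 < x \<Longrightarrow> x \<le> a \<Longrightarrow> D 0 x = 1" "\<And>n x. 0 < x \<Longrightarrow> x \<le> a \<Longrightarrow> D (Suc n) x = 0"
    and Db: "\<And>n x. b \<le> x \<Longrightarrow> D n x = 0" and M: "\<And>n x. 0 < x \<Longrightarrow> n \<le> 2 \<Longrightarrow> x ^ n * cmod (D n x) \<le> M"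
    and M0: "\<And>n x. 0 < x \<Longrightarrow> n \<le> 2 \<Longrightarrow> cmod (D n x) \<le> M"
    by (rule cutoffE[OF assms], rule that)
  have smD: "smooth_on {0<..} (D 0)"
    unfolding smooth_on_def using der by (intro exI[of _ D]) (auto simp: has_vector_derivative_within_Ioi)
  define t where "t k = real (Suc k)" for k
  have t: "t k \<ge> 1" for k by (simp add: t_def)
  have t0: "t k > 0" for k by (simp add: t_def)
  define s where "s k = 1 / t k" for k
  have s0: "s k > 0" and ts: "complex_of_real (t k) * of_real (s k) = 1" "t k * s k = 1" for k
    using t0[of k] by (auto simp: s_def simp flip: of_real_mult)
  define X where "X k x = (1 - D 0 (t k * x)) * D 0 (s k * x)" for k x
  define X' where "X' k x = (1 - D 0 (t k * x)) * (of_real (s k) * D 1 (s k * x)) - of_real (t k) * D 1 (t k * x) * D 0 (s k * x)" for k x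
  \<comment> \<open>The mixed term of the product rule appears without its factors
    \<open>t k\<close> and \<open>s k\<close>, whose product is 1.\<close>
  define X'' where "X'' k x = (1 - D 0 (t k * x)) * (of_real (s k)^2 * D 2 (s k * x)) - 2 * (D 1 (t k * x) * D 1 (s k * x))
     - of_real (t k)^2 * D 2 (t k * x) * D 0 (s k * x)" for k x
  have dt: "((\<lambda>x. D n (t k * x)) has_vector_derivative of_real (t k) * D (Suc n) (t k * x)) (at x)"
    and ds: "((\<lambda>x. D n (s k * x)) has_vector_derivative of_real (s k) * D (Suc n) (s k * x)) (at x)" if "x > 0" for n k x
    using that t0[of k] s0[of k] by (auto intro!: has_vector_derivative_scale der)
  have dt1: "((\<lambda>x. 1 - D 0 (t k * x)) has_vector_derivative - (of_real (t k) * D 1 (t k * x))) (at x)" if "x > 0" for k x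
    using has_vector_derivative_diff[OF has_vector_derivative_const[of 1] dt[OF that, of 0 k]] by simp
  have X: "(X k has_vector_derivative X' k x) (at x)" if "x > 0" for k x
    using has_vector_derivative_mult[OF dt1[OF that] ds[OF that, of 0 k]]
    unfolding X_def[abs_def] X'_def by simp
  have X': "(X' k has_vector_derivative X'' k x) (at x)" if "x > 0" for k x
  proof -
    have 1: "((\<lambda>x. of_real (s k) * D 1 (s k * x)) has_vector_derivative of_real (s k) * (of_real (s k) * D 2 (s k * x))) (at x)"
      using has_vector_derivative_mult_right[OF ds[OF that, of 1 k]] by (simp add: numeral_2_eq_2)
    have 2: "((\<lambda>x. of_real (t k) * D 1 (t k * x)) has_vector_derivative of_real (t k) * (of_real (t k) * D 2 (t k * x))) (at x)"
      using has_vector_derivative_mult_right[OF dt[OF that, of 1 k]] by (simp add: numeral_2_eq_2)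
    have "(X' k has_vector_derivative
       ((1 - D 0 (t k * x)) * (of_real (s k) * (of_real (s k) * D 2 (s k * x))) + - (of_real (t k) * D 1 (t k * x)) * (of_real (s k) * D 1 (s k * x)))
       - (of_real (t k) * D 1 (t k * x) * (of_real (s k) * D 1 (s k * x)) + of_real (t k) * (of_real (t k) * D 2 (t k * x)) * D 0 (s k * x))) (at x)"
      unfolding X'_def[abs_def] using ds[OF that, of 0 k]
      by (intro has_vector_derivative_diff has_vector_derivative_mult dt1 1 2 that) auto
    also have "((1 - D 0 (t k * x)) * (of_real (s k) * (of_real (s k) * D 2 (s k * x))) + - (of_real (t k) * D 1 (t k * x)) * (of_real (s k) * D 1 (s k * x)))
       - (of_real (t k) * D 1 (t k * x) * (of_real (s k) * D 1 (s k * x)) + of_real (t k) * (of_real (t k) * D 2 (t k * x)) * D 0 (s k * x))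
       = (1 - D 0 (t k * x)) * (of_real (s k)^2 * D 2 (s k * x)) - 2 * ((of_real (t k) * of_real (s k)) * (D 1 (t k * x) * D 1 (s k * x)))
     - of_real (t k)^2 * D 2 (t k * x) * D 0 (s k * x)"
      by (simp add: algebra_simps power2_eq_square)
    finally show ?thesis unfolding X''_def ts by simp
  qed
  have bound: "cmod (1 - D 0 (t k * x)) \<le> 2 * M" if "x > 0" for k x
    using norm_triangle_ineq4[of 1 "D 0 (t k * x)"] M0[of "t k * x" 0] ab t0[of k] that by simp
  have bt: "cmod (of_real (t k) ^ n * D n (t k * x)) * x ^ n \<le> M"
    and bs: "cmod (of_real (s k) ^ n * D n (s k * x)) * x ^ n \<le> M" if "x > 0" "n \<le> 2" for k x n
    using M[of "t k * x" n] M[of "s k * x" n] that t0[of k] s0[of k]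
    by (simp_all add: norm_mult norm_power power_mult_distrib mult_ac)
  \<comment> \<open>The bound for the second derivative is the largest of the three and amounts to
    \<open>2 + 2 + 1 = 5\<close> times \<open>M^2\<close>.\<close>
  define C where "C = 6 * M\<^sup>2"
  have CM: "2 * M * M \<le> C" "2 * M * M + M * M \<le> C" "2 * M * M + 2 * (M * M) + M * M \<le> C"
    by (simp_all add: C_def power2_eq_square)
  have b0: "cmod (X k x) \<le> C" if "x > 0" for k x
  proof -
    have "cmod (X k x) \<le> (2 * M) * M"
      unfolding X_def norm_mult using bound[OF that] M0[of "s k * x" 0] that s0[of k] ab
      by (intro mult_mono) auto
    also have "\<dots> \<le> C" using CM by simp
    finally show ?thesis .
  qed
  have b1: "cmod (X' k x) \<le> C / x" if "x > 0" for k x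
  proof -
    have "cmod (X' k x) * x \<le> (cmod ((1 - D 0 (t k * x)) * (of_real (s k) * D 1 (s k * x))) + cmod (of_real (t k) * D 1 (t k * x) * D 0 (s k * x))) * x"
      unfolding X'_def using that by (intro mult_right_mono norm_triangle_ineq4) auto
    also have "\<dots> = cmod (1 - D 0 (t k * x)) * (cmod (of_real (s k) ^ 1 * D 1 (s k * x)) * x ^ 1)
        + (cmod (of_real (t k) ^ 1 * D 1 (t k * x)) * x ^ 1) * cmod (D 0 (s k * x))"
      unfolding norm_mult by (simp add: algebra_simps)
    also have "\<dots> \<le> (2 * M) * M + M * M"
      using bound[OF that] bt[OF that, of 1] bs[OF that, of 1] M0[of "s k * x" 0] that s0[of k] ab
      by (intro add_mono mult_mono) auto
    also have "\<dots> \<le> C" using CM by simp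
    finally show ?thesis using that by (simp add: field_simps)
  qed
  have b2: "cmod (X'' k x) \<le> C / x\<^sup>2" if "x > 0" for k x
  proof -
    \<comment> \<open>The factor \<open>t k * s k = 1\<close> is put back, so that
      \<open>x^2\<close> can be split into one \<open>x\<close> for each of the two first
      derivatives.\<close>
    have "(of_real (t k) ^ 1 * D 1 (t k * x)) * (of_real (s k) ^ 1 * D 1 (s k * x)) = of_real (t k) * of_real (s k) * (D 1 (t k * x) * D 1 (s k * x))"
      by (simp add: mult_ac)
    then have st: "D 1 (t k * x) * D 1 (s k * x) = (of_real (t k) ^ 1 * D 1 (t k * x)) * (of_real (s k) ^ 1 * D 1 (s k * x))"
      unfolding ts(1)[of k] by simp
    have "cmod (X'' k x) * x\<^sup>2 \<le> ((cmod ((1 - D 0 (t k * x)) * (of_real (s k)^2 * D 2 (s k * x))) + cmod (2 * (D 1 (t k * x) * D 1 (s k * x))))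
       + cmod (of_real (t k)^2 * D 2 (t k * x) * D 0 (s k * x))) * x\<^sup>2"
      unfolding X''_def using that
      by (intro mult_right_mono order_trans[OF norm_triangle_ineq4 add_right_mono[OF norm_triangle_ineq4]]) auto
    also have "\<dots> = cmod (1 - D 0 (t k * x)) * (cmod (of_real (s k) ^ 2 * D 2 (s k * x)) * x ^ 2)
        + 2 * ((cmod (of_real (t k) ^ 1 * D 1 (t k * x)) * x ^ 1) * (cmod (of_real (s k) ^ 1 * D 1 (s k * x)) * x ^ 1))
        + (cmod (of_real (t k) ^ 2 * D 2 (t k * x)) * x ^ 2) * cmod (D 0 (s k * x))"
      unfolding st norm_mult by (simp add: algebra_simps power2_eq_square)
    also have "\<dots> \<le> (2 * M) * M + 2 * (M * M) + M * M"
      using bound[OF that] bt[OF that, of 1] bs[OF that, of 1] bt[OF that, of 2] bs[OF that, of 2] M0[of "s k * x" 0] that s0[of k] ab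
      by (intro add_mono mult_mono mult_left_mono) auto
    also have "\<dots> \<le> C" using CM by simp
    finally show ?thesis using that by (simp add: field_simps)
  qed
  have z: "X k x = 0 \<and> X' k x = 0 \<and> X'' k x = 0" if "x > 0" "x \<le> a / Suc k \<or> x \<ge> b * Suc k" for k x
    using that(2)
  proof
    assume "x \<le> a / Suc k"
    then have "t k * x \<le> a" "t k * x > 0" using that(1) t0[of k] by (simp_all add: t_def field_simps del: of_nat_Suc)
    then show ?thesis using Da(1) Da(2)[of _ 0] Da(2)[of _ 1] by (simp add: X_def X'_def X''_def numeral_2_eq_2)
  next
    assume "x \<ge> b * Suc k"
    then have "s k * x \<ge> b" by (simp add: s_def t_def pos_le_divide_eq del: of_nat_Suc)
    then show ?thesis using Db by (simp add: X_def X'_def X''_def)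
  qed
  have o: "X k x = 1 \<and> X' k x = 0 \<and> X'' k x = 0" if "x > 0" "b / Suc k \<le> x" "x \<le> a * Suc k" for k x
  proof -
    have "s k * x \<le> a" "s k * x > 0" "t k * x \<ge> b"
      using that t0[of k] by (simp_all add: s_def t_def field_simps del: of_nat_Suc)
    then show ?thesis using Da(1) Da(2)[of _ 0] Da(2)[of _ 1] Db by (simp add: X_def X'_def X''_def numeral_2_eq_2)
  qed
  have smX: "smooth_on {0<..} (X k)" for k
  proof -
    have "smooth_on {0<..} (\<lambda>x. 1 + (-1) * D 0 (t k * x))"
      by (intro smooth_on_add smooth_on_mult smooth_on_const smooth_on_scale[OF smD] t0)
    then show ?thesis unfolding X_def[abs_def]
      by (intro smooth_on_mult smooth_on_scale[OF smD] s0) simp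
  qed
  have cD: "continuous_on {0<..} (D n)" for n
    using der by (auto intro!: continuous_at_imp_continuous_on has_vector_derivative_continuous)
  have "continuous_on {0<..} (\<lambda>x. D n (t k * x))" "continuous_on {0<..} (\<lambda>x. D n (s k * x))" for n k
    using t0[of k] s0[of k] by (auto intro!: continuous_on_compose2[OF cD] continuous_intros)
  then have "continuous_on {0<..} (X'' k)" for k
    unfolding X''_def[abs_def] by (intro continuous_intros)
  then have "cutoff_seq a b C X X' X''"
    unfolding cutoff_seq_def using ab(1-3) smX X X' b0 b1 b2 z o by (auto simp: C_def)
  then show ?thesis by (rule that)
qed

section \<open>Approximation by test functions\<close>

lemma measurable_of_real_Rplus [measurable]: "(\<lambda>x. complex_of_real x) \<in> borel_measurable Rplus"
  by (intro measurable_continuous_Ioi continuous_intros)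

lemma measurable_ident_Rplus [measurable]: "(\<lambda>x. x) \<in> borel_measurable Rplus"
  by (intro continuous_imp_measurable_on_sets_lebesgue continuous_intros) auto

section \<open>Density of polynomials in the square integrable functions on a bounded
  interval\<close>

text \<open>For \<open>R > 0\<close> this is the radial retraction onto the disc of radius
  \<open>R\<close>: a truncation that is continuous, so that it respects pointwise limits and keeps
  continuous functions continuous.\<close>

definition clip :: "real \<Rightarrow> complex \<Rightarrow> complex" where
  "clip R z = of_real (R / max R (cmod z)) * z"

lemma clip_bounds:
  assumes "R > 0"
  shows "cmod (clip R z) \<le> R" "cmod (clip R z) \<le> cmod z" "cmod z \<le> R \<Longrightarrow> clip R z = z"
proof -
  show "cmod (clip R z) \<le> R"
    using assms by (cases "cmod z \<le> R") (auto simp: clip_def norm_mult norm_divide max_def)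
  have "cmod (clip R z) = R / max R (cmod z) * cmod z"
    unfolding clip_def norm_mult norm_of_real using assms by (simp add: less_max_iff_disj)
  also have "\<dots> \<le> 1 * cmod z" using assms by (intro mult_right_mono) auto
  finally show "cmod (clip R z) \<le> cmod z" by simp
  show "cmod z \<le> R \<Longrightarrow> clip R z = z" using assms by (simp add: clip_def max_def)
qed

lemma continuous_on_clip: "R > 0 \<Longrightarrow> continuous_on S (clip R)"
  unfolding clip_def[abs_def] by (intro continuous_intros) auto

lemma tendsto_clip: "R > 0 \<Longrightarrow> (f \<longlongrightarrow> l) F \<Longrightarrow> ((\<lambda>x. clip R (f x)) \<longlongrightarrow> clip R l) F"
  using continuous_on_clip[of R UNIV] by (intro continuous_on_tendsto_compose[of UNIV "clip R"]) auto

lemma nullE: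
  assumes "L2_null F" "(r::real) > 0"
  obtains k where "sq (F k) \<le> ennreal r"
proof -
  have "eventually (\<lambda>k. sq (F k) < ennreal r) sequentially"
    using nullD(2)[OF assms(1)] by (rule order_tendstoD) (use assms(2) in simp)
  then obtain k where "sq (F k) < ennreal r" by (auto simp: eventually_sequentially)
  then show ?thesis by (intro that[of k]) auto
qed

text \<open>Truncation makes \<open>h\<close> bounded, and \<open>measurable_on\<close> supplies
  continuous functions converging to \<open>h\<close> almost everywhere. Truncating these as well
  yields a constant majorant on \<open>]0, N]\<close>, hence convergence in the mean, and the
  theorem of Weierstrass replaces one of them by a polynomial.\<close>

lemma polynomial_dense_L2:
  assumes h: "h \<in> L2" and r: "r > (0::real)"
  obtains p :: "real \<Rightarrow> complex" where "polynomial_function p"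
    "sq (\<lambda>x. if x \<le> N then h x - p x else 0) \<le> ennreal r"
proof -
  note [measurable] = L2_measurable[OF h]
  \<comment> \<open>Three errors of size \<open>R\<close> add up to
    \<open>2 R + 2 (2 R + 2 R) = 10 R\<close> under \<open>sq_add_le\<close>.\<close>
  define R where "R = r / 16"
  have R: "R > 0" using r by (simp add: R_def)
  have cl[measurable]: "clip (Suc k) \<in> borel_measurable borel" for k
    by (intro borel_measurable_continuous_onI continuous_on_clip) auto
  have "L2_null (\<lambda>k x. h x - clip (Suc k) (h x))"
  proof (rule null_dominated_convergence[OF h, where C = 2])
    show "AE x in Rplus. cmod (h x - clip (Suc k) (h x)) \<le> 2 * cmod (h x)" for k
      using clip_bounds(2)[of "Suc k"] by (intro AE_I2 order_trans[OF norm_triangle_ineq4]) (simp add: add_left_mono)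
    have "eventually (\<lambda>k. h x - clip (Suc k) (h x) = 0) sequentially" for x
      using eventually_ge_at_top[of "nat \<lceil>cmod (h x)\<rceil>"]
    proof eventually_elim
      case (elim k)
      then have "cmod (h x) \<le> Suc k" by linarith
      then show ?case by (simp add: clip_bounds(3) del: of_nat_Suc)
    qed
    then show "AE x in Rplus. (\<lambda>k. h x - clip (Suc k) (h x)) \<longlonglongrightarrow> 0"
      by (intro AE_I2 tendsto_eventually)
  qed measurable
  then obtain k where k: "sq (\<lambda>x. h x - clip (Suc k) (h x)) \<le> ennreal R" by (rule nullE[OF _ R])
  define K where "K = real (Suc k)"
  have K: "K > 0" by (simp add: K_def)
  have [measurable]: "clip K \<in> borel_measurable borel" unfolding K_def by (rule cl)
  have "(\<lambda>x. if x \<in> {0<..} then h x else 0) measurable_on UNIV"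
    by (intro lebesgue_measurable_imp_measurable_on borel_measurable_if_I) auto
  then obtain Z g where Z: "negligible Z" and g: "\<And>n. continuous_on UNIV (g n)"
    and lim: "\<And>x. x \<notin> Z \<Longrightarrow> (\<lambda>n. g n x) \<longlonglongrightarrow> (if x \<in> {0<..} then h x else 0)"
    unfolding measurable_on_def by auto
  have [measurable]: "g n \<in> borel_measurable Rplus" for n
    by (intro measurable_continuous_Ioi continuous_on_subset[OF g]) auto
  have "L2_null (\<lambda>n x. if x \<le> N then clip K (h x) - clip K (g n x) else 0)"
  proof (rule null_dominated_convergence[where C = 1])
    show "(\<lambda>x. if x \<le> N then complex_of_real (2 * K) else 0) \<in> L2"
      by (rule L2_bounded_support[of _ "2 * K" N]) (use K in auto)
    have "cmod (clip K (h x) - clip K (g n x)) \<le> 2 * K" for n x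
      using norm_triangle_ineq4[of "clip K (h x)" "clip K (g n x)"] clip_bounds(1)[OF K, of "h x"] clip_bounds(1)[OF K, of "g n x"]
      by linarith
    then show "AE x in Rplus. cmod (if x \<le> N then clip K (h x) - clip K (g n x) else 0)
        \<le> 1 * cmod (if x \<le> N then complex_of_real (2 * K) else 0)" for n
      using K by (intro AE_I2) auto
    have "AE x in Rplus. x \<notin> Z"
      using AE_not_in[of Z lebesgue] Z
      by (subst AE_restrict_space_iff) (auto simp: negligible_iff_null_sets elim: eventually_mono)
    then show "AE x in Rplus. (\<lambda>n. if x \<le> N then clip K (h x) - clip K (g n x) else 0) \<longlonglongrightarrow> 0"
      using AE_space
    proof eventually_elim
      case (elim x)
      then have "(\<lambda>n. g n x) \<longlonglongrightarrow> h x" using lim[of x] by simp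
      then have "(\<lambda>n. clip K (h x) - clip K (g n x)) \<longlonglongrightarrow> clip K (h x) - clip K (h x)"
        by (intro tendsto_intros tendsto_clip K)
      then show ?case by (cases "x \<le> N") simp_all
    qed
  qed measurable
  then obtain n where n: "sq (\<lambda>x. if x \<le> N then clip K (h x) - clip K (g n x) else 0) \<le> ennreal R"
    by (rule nullE[OF _ R])
  \<comment> \<open>A uniform error \<open>\<delta>\<close> on \<open>]0, N]\<close> contributes at
    most \<open>\<delta>^2 |N| <= R\<close>; the added 1 keeps the quotient meaningful for
    \<open>N = 0\<close>.\<close>
  define \<delta> where "\<delta> = sqrt (R / (1 + \<bar>N\<bar>))"
  have \<delta>: "\<delta> > 0" using R by (simp add: \<delta>_def)
  have "continuous_on {0..N} (\<lambda>x. clip K (g n x))"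
    by (rule continuous_on_compose2[OF continuous_on_clip[OF K] continuous_on_subset[OF g]]) auto
  then obtain p :: "real \<Rightarrow> complex" where p: "polynomial_function p"
    "\<And>x. x \<in> {0..N} \<Longrightarrow> cmod (clip K (g n x) - p x) < \<delta>"
    using Stone_Weierstrass_polynomial_function[OF compact_Icc _ \<delta>] by metis
  have [measurable]: "p \<in> borel_measurable Rplus"
    using p(1) by (intro measurable_continuous_Ioi continuous_on_polymonial_function)
  have "sq (\<lambda>x. if x \<le> N then clip K (g n x) - p x else 0) \<le> (\<integral>\<^sup>+x. ennreal (\<delta>\<^sup>2) * indicator {0<..N} x \<partial>Rplus)"
    unfolding sq_def using p(2) \<delta>
    by (intro nn_integral_mono) (auto simp: indicator_def less_imp_le intro!: ennreal_leI power_mono)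
  also have "\<dots> = ennreal (\<delta>\<^sup>2) * emeasure Rplus {0<..N}"
    by (intro nn_integral_cmult_indicator) (auto simp: sets_restrict_space_iff)
  also have "emeasure Rplus {0<..N} = emeasure lebesgue {0<..N}"
    by (subst emeasure_restrict_space) auto
  also have "\<dots> \<le> ennreal \<bar>N\<bar>" by (cases "N \<ge> 0") auto
  also have "ennreal (\<delta>\<^sup>2) * ennreal \<bar>N\<bar> = ennreal (R / (1 + \<bar>N\<bar>) * \<bar>N\<bar>)"
  proof -
    have "\<delta>\<^sup>2 = R / (1 + \<bar>N\<bar>)" using R by (simp add: \<delta>_def)
    then show ?thesis using R by (simp only: ennreal_mult'[symmetric] abs_ge_zero ennreal_mult'')
  qed
  also have "\<dots> \<le> ennreal R"
    using R by (intro ennreal_leI) (simp add: field_simps)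
  finally have p3: "sq (\<lambda>x. if x \<le> N then clip K (g n x) - p x else 0) \<le> ennreal R"
    by (simp add: mult_left_mono)
  let ?f1 = "\<lambda>x. h x - clip K (h x)" and ?f2 = "\<lambda>x. if x \<le> N then clip K (h x) - clip K (g n x) else 0"
    and ?f3 = "\<lambda>x. if x \<le> N then clip K (g n x) - p x else 0"
  have "sq (\<lambda>x. if x \<le> N then h x - p x else 0) \<le> sq (\<lambda>x. (if x \<le> N then ?f1 x else 0) + (?f2 x + ?f3 x))"
    by (intro sq_mono_AE AE_I2) auto
  also have "\<dots> \<le> 2 * sq (\<lambda>x. if x \<le> N then ?f1 x else 0) + 2 * sq (\<lambda>x. ?f2 x + ?f3 x)"
    by (rule sq_add_le) measurable
  also have "\<dots> \<le> 2 * sq ?f1 + 2 * (2 * sq ?f2 + 2 * sq ?f3)"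
    by (intro add_mono mult_left_mono sq_add_le sq_mono_AE) (auto intro!: AE_I2)
  also have "\<dots> \<le> 2 * ennreal R + 2 * (2 * ennreal R + 2 * ennreal R)"
    using k n p3 unfolding K_def[symmetric] by (intro add_mono mult_left_mono) auto
  also have "\<dots> = ennreal (10 * R)"
    using R by (simp add: ennreal_mult'[symmetric] ennreal_plus[symmetric] ennreal_numeral[symmetric] del: ennreal_plus ennreal_numeral)
  also have "\<dots> \<le> ennreal r" using r by (intro ennreal_leI) (simp add: R_def)
  finally show ?thesis using that p(1) by blast
qed

lemma L2_Hardy: "h \<in> L2 \<Longrightarrow> (\<lambda>x. prim h x / of_real x) \<in> L2"
  and L2_Hardy2: "h \<in> L2 \<Longrightarrow> (\<lambda>x. prim (prim h) x / (of_real x)\<^sup>2) \<in> L2"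
proof -
  assume h: "h \<in> L2"
  note [measurable] = measurable_prim[OF loc_L2[OF h]] measurable_prim[OF loc_prim[OF loc_L2[OF h]]]
  show "(\<lambda>x. prim h x / of_real x) \<in> L2"
    using h sq_Hardy[OF L2_measurable[OF h]]
    by (auto simp: L2_iff ennreal_mult_less_top intro: le_less_trans)
  show "(\<lambda>x. prim (prim h) x / (of_real x)\<^sup>2) \<in> L2"
    using h sq_Hardy2[OF h] by (auto simp: L2_iff ennreal_mult_less_top intro: le_less_trans)
qed

lemma null_Hardy2:
  assumes "L2_null F" "\<And>k. F k \<in> L2"
  shows "L2_null (\<lambda>k x. prim (F k) x / of_real x)" "L2_null (\<lambda>k x. prim (prim (F k)) x / (of_real x)\<^sup>2)"
proof -
  have lim: "(\<lambda>k. 4 * sq (F k)) \<longlonglongrightarrow> 4 * 0" "(\<lambda>k. 16 * sq (F k)) \<longlonglongrightarrow> 16 * 0"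
    using nullD(2)[OF assms(1)] by (intro ennreal_tendsto_cmult; simp)+
  show "L2_null (\<lambda>k x. prim (F k) x / of_real x)"
    unfolding L2_null_def using L2_Hardy[OF assms(2)] sq_Hardy[OF L2_measurable[OF assms(2)]]
    by (auto intro: ennreal_squeeze_0[OF lim(1)[unfolded mult_zero_right]] dest: L2_measurable)
  show "L2_null (\<lambda>k x. prim (prim (F k)) x / (of_real x)\<^sup>2)"
    unfolding L2_null_def using L2_Hardy2[OF assms(2)] sq_Hardy2[OF assms(2)]
    by (auto intro: ennreal_squeeze_0[OF lim(2)[unfolded mult_zero_right]] dest: L2_measurable)
qed

lemma cutoff_seqD:
  assumes "cutoff_seq a b C X X' X''"
  shows "0 < a" "1 \<le> b" "a \<le> b" "0 \<le> C" "smooth_on {0<..} (X k)"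
    and "x > 0 \<Longrightarrow> (X k has_vector_derivative X' k x) (at x)"
    and "x > 0 \<Longrightarrow> (X' k has_vector_derivative X'' k x) (at x)"
    and "x > 0 \<Longrightarrow> cmod (X k x) \<le> C" "x > 0 \<Longrightarrow> cmod (X' k x) \<le> C / x" "x > 0 \<Longrightarrow> cmod (X'' k x) \<le> C / x\<^sup>2"
    and "x > 0 \<Longrightarrow> x \<le> a / real (Suc k) \<or> x \<ge> b * real (Suc k) \<Longrightarrow> X k x = 0 \<and> X' k x = 0 \<and> X'' k x = 0"
    and "x > 0 \<Longrightarrow> b / real (Suc k) \<le> x \<Longrightarrow> x \<le> a * real (Suc k) \<Longrightarrow> X k x = 1 \<and> X' k x = 0 \<and> X'' k x = 0"
    and "continuous_on {0<..} (X k)" "continuous_on {0<..} (X' k)" "continuous_on {0<..} (X'' k)"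
proof -
  show 1: "0 < a" "1 \<le> b" "a \<le> b" "0 \<le> C" "smooth_on {0<..} (X k)" "continuous_on {0<..} (X'' k)"
    using assms unfolding cutoff_seq_def by blast+
  have 2: "\<forall>k. \<forall>x>0. (X k has_vector_derivative X' k x) (at x) \<and> (X' k has_vector_derivative X'' k x) (at x) \<and>
        cmod (X k x) \<le> C \<and> cmod (X' k x) \<le> C / x \<and> cmod (X'' k x) \<le> C / x\<^sup>2 \<and>
        (x \<le> a / real (Suc k) \<or> x \<ge> b * real (Suc k) \<longrightarrow> X k x = 0 \<and> X' k x = 0 \<and> X'' k x = 0) \<and>
        (b / real (Suc k) \<le> x \<and> x \<le> a * real (Suc k) \<longrightarrow> X k x = 1 \<and> X' k x = 0 \<and> X'' k x = 0)"
    using assms unfolding cutoff_seq_def by blast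
  show "x > 0 \<Longrightarrow> (X k has_vector_derivative X' k x) (at x)"
    "x > 0 \<Longrightarrow> (X' k has_vector_derivative X'' k x) (at x)"
    "x > 0 \<Longrightarrow> cmod (X k x) \<le> C" "x > 0 \<Longrightarrow> cmod (X' k x) \<le> C / x" "x > 0 \<Longrightarrow> cmod (X'' k x) \<le> C / x\<^sup>2"
    "x > 0 \<Longrightarrow> x \<le> a / real (Suc k) \<or> x \<ge> b * real (Suc k) \<Longrightarrow> X k x = 0 \<and> X' k x = 0 \<and> X'' k x = 0"
    "x > 0 \<Longrightarrow> b / real (Suc k) \<le> x \<Longrightarrow> x \<le> a * real (Suc k) \<Longrightarrow> X k x = 1 \<and> X' k x = 0 \<and> X'' k x = 0"
    using 2[rule_format, of x k] by blast+
  show "continuous_on {0<..} (X k)" "continuous_on {0<..} (X' k)"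
    using 2 by (auto intro!: continuous_at_imp_continuous_on has_vector_derivative_continuous)
qed

lemma cutoff_seq_eventually:
  assumes "cutoff_seq a b C X X' X''" "x > 0"
  shows "eventually (\<lambda>k. X k x = 1 \<and> X' k x = 0 \<and> X'' k x = 0) sequentially"
proof -
  note X = cutoff_seqD[OF assms(1)]
  show ?thesis
    using eventually_ge_at_top[of "nat \<lceil>b / x\<rceil>"] eventually_ge_at_top[of "nat \<lceil>x / a\<rceil>"]
  proof eventually_elim
    case (elim k)
    then have "b / x \<le> real (Suc k)" "x / a \<le> real (Suc k)" by linarith+
    then have "b / real (Suc k) \<le> x" "x \<le> a * real (Suc k)"
      using assms(2) X(1) by (simp_all add: field_simps del: of_nat_Suc)
    then show ?case by (rule X(12)[OF assms(2)])
  qed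
qed

lemma null_cutoff:
  assumes X: "cutoff_seq a b C X X' X''" and w: "w \<in> L2"
  shows "L2_null (\<lambda>k x. (X k x - 1) * w x)"
    and "L2_null (\<lambda>k x. X' k x * (of_real x * w x))"
    and "L2_null (\<lambda>k x. X'' k x * ((of_real x)\<^sup>2 * w x))"
proof -
  note X' = cutoff_seqD[OF X]
  note [measurable] = L2_measurable[OF w]
  have [measurable]: "X k \<in> borel_measurable Rplus" "X' k \<in> borel_measurable Rplus" "X'' k \<in> borel_measurable Rplus" for k
    by (intro measurable_continuous_Ioi X')+
  have lim: "(\<lambda>k. X k x) \<longlonglongrightarrow> 1" "(\<lambda>k. X' k x) \<longlonglongrightarrow> 0" "(\<lambda>k. X'' k x) \<longlonglongrightarrow> 0" if "x > 0" for x
    using cutoff_seq_eventually[OF X that] by (auto intro!: tendsto_eventually elim: eventually_mono)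
  show "L2_null (\<lambda>k x. (X k x - 1) * w x)"
  proof (rule null_dominated_convergence[OF w, where C = "C + 1"])
    show "AE x in Rplus. cmod ((X k x - 1) * w x) \<le> (C + 1) * cmod (w x)" for k
    proof (intro AE_I2)
      fix x assume "x \<in> space Rplus"
      then have "cmod (X k x - 1) \<le> C + 1" using X'(8)[of x k] norm_triangle_ineq4[of "X k x" 1] by simp
      then show "cmod ((X k x - 1) * w x) \<le> (C + 1) * cmod (w x)" by (simp add: norm_mult mult_right_mono)
    qed
    show "AE x in Rplus. (\<lambda>k. (X k x - 1) * w x) \<longlonglongrightarrow> 0"
    proof (intro AE_I2)
      fix x assume "x \<in> space Rplus"
      then have "(\<lambda>k. (X k x - 1) * w x) \<longlonglongrightarrow> (1 - 1) * w x" by (intro tendsto_intros lim) auto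
      then show "(\<lambda>k. (X k x - 1) * w x) \<longlonglongrightarrow> 0" by simp
    qed
  qed measurable
  show "L2_null (\<lambda>k x. X' k x * (of_real x * w x))"
  proof (rule null_dominated_convergence[OF w, where C = C])
    show "AE x in Rplus. cmod (X' k x * (of_real x * w x)) \<le> C * cmod (w x)" for k
    proof (intro AE_I2)
      fix x assume "x \<in> space Rplus"
      then have "cmod (X' k x) * x \<le> C" using X'(9)[of x k] by (simp add: field_simps)
      then show "cmod (X' k x * (of_real x * w x)) \<le> C * cmod (w x)"
        using mult_right_mono[of "cmod (X' k x) * x" C "cmod (w x)"] \<open>x \<in> space Rplus\<close> by (simp add: norm_mult mult.assoc)
    qed
    show "AE x in Rplus. (\<lambda>k. X' k x * (of_real x * w x)) \<longlonglongrightarrow> 0"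
      by (intro AE_I2 tendsto_mult_left_zero lim) auto
  qed measurable
  show "L2_null (\<lambda>k x. X'' k x * ((of_real x)\<^sup>2 * w x))"
  proof (rule null_dominated_convergence[OF w, where C = C])
    show "AE x in Rplus. cmod (X'' k x * ((of_real x)\<^sup>2 * w x)) \<le> C * cmod (w x)" for k
    proof (intro AE_I2)
      fix x assume "x \<in> space Rplus"
      then have "cmod (X'' k x) * x\<^sup>2 \<le> C" using X'(10)[of x k] by (simp add: field_simps)
      then show "cmod (X'' k x * ((of_real x)\<^sup>2 * w x)) \<le> C * cmod (w x)"
        using mult_right_mono[of "cmod (X'' k x) * x\<^sup>2" C "cmod (w x)"] by (simp add: norm_mult norm_power mult.assoc)
    qed
    show "AE x in Rplus. (\<lambda>k. X'' k x * ((of_real x)\<^sup>2 * w x)) \<longlonglongrightarrow> 0"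
      by (intro AE_I2 tendsto_mult_left_zero lim) auto
  qed measurable
qed

text \<open>On \<open>]0, N k]\<close>, outside which \<open>X k\<close> vanishes, the double
  primitive \<open>U k\<close> of a polynomial differs from that of \<open>h\<close> by the double
  primitive of the error \<open>e k\<close>. So \<open>X k * U k\<close> misses its target by cutoff
  errors of fixed functions, which tend to 0 by dominated convergence, and by terms in
  \<open>e k\<close>, which Hardy's inequality controls. The last conclusion has a premise because
  Hardy's inequality bounds \<open>prim (prim h)\<close> only after division by
  \<open>x^2\<close>.\<close>

lemma test_function_approximation:
  assumes X: "cutoff_seq a b C X X' X''" and h: "h \<in> L2"
  obtains D :: "nat \<Rightarrow> nat \<Rightarrow> real \<Rightarrow> complex" where "\<And>k. \<exists>a b. tower (D k) a b"
    "L2_null (\<lambda>k x. D k 2 x - h x)"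
    "L2_null (\<lambda>k x. D k 0 x / (of_real x)\<^sup>2 - prim (prim h) x / (of_real x)\<^sup>2)"
    "prim (prim h) \<in> L2 \<Longrightarrow> L2_null (\<lambda>k x. D k 0 x - prim (prim h) x)"
proof -
  note X' = cutoff_seqD[OF X]
  define N where "N k = b * real (Suc k)" for k
  have N: "N k \<ge> 1" for k
  proof -
    have "1 * 1 \<le> b * real (Suc k)" using X'(2) by (intro mult_mono) auto
    then show ?thesis by (simp add: N_def)
  qed
  \<comment> \<open>The fourth power makes even \<open>N k ^ 2 * e k\<close> a null sequence. This
    pays for removing the weight \<open>1 / x^2\<close>, since \<open>1 <= N k ^ 2 / x^2\<close> on
    \<open>]0, N k]\<close>.\<close>
  have "\<exists>p. polynomial_function p \<and>
      sq (\<lambda>x. if x \<le> N k then h x - p x else 0) \<le> ennreal (1 / (real (Suc k) * N k ^ 4))" for k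
    by (rule polynomial_dense_L2[OF h, of "1 / (real (Suc k) * N k ^ 4)" "N k"])
       (use N[of k] in \<open>auto intro!: divide_pos_pos mult_pos_pos\<close>)
  then obtain p where p: "\<And>k. polynomial_function (p k)"
    "\<And>k. sq (\<lambda>x. if x \<le> N k then h x - p k x else 0) \<le> ennreal (1 / (real (Suc k) * N k ^ 4))" by metis
  have cp: "continuous_on S (p k)" for S k using p(1) by (rule continuous_on_polymonial_function)
  note [measurable] = L2_measurable[OF h]
  have [measurable]: "p k \<in> borel_measurable Rplus" for k by (intro measurable_continuous_Ioi cp)
  have [measurable]: "X k \<in> borel_measurable Rplus" "X' k \<in> borel_measurable Rplus" "X'' k \<in> borel_measurable Rplus" for k
    by (intro measurable_continuous_Ioi X')+
  have lp: "loc_integrable (p k)" for k by (intro loc_continuous cp)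
  have lh: "loc_integrable h" by (rule loc_L2[OF h])
  \<comment> \<open>The polynomial approximates \<open>h\<close> only up to \<open>N k\<close> and
    is in general not square integrable on the half-line. Primitives evaluated at
    \<open>x <= N k\<close> do not see the truncation.\<close>
  define e where "e k x = (if x \<le> N k then h x - p k x else 0)" for k x
  have em[measurable]: "e k \<in> borel_measurable Rplus" for k unfolding e_def by measurable
  have eL2: "e k \<in> L2" for k
    using le_less_trans[OF p(2)[of k], of \<infinity>] by (simp add: L2_iff em e_def[abs_def])
  note [measurable] = measurable_prim[OF loc_L2[OF eL2]] measurable_prim[OF loc_prim[OF loc_L2[OF eL2]]]
    measurable_prim[OF lh] measurable_prim[OF loc_prim[OF lh]]
  have nN: "L2_null (\<lambda>k x. of_real (N k ^ 2) * e k x)"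
  proof -
    have "sq (\<lambda>x. of_real (N k ^ 2) * e k x) \<le> ennreal (1 / real (Suc k))" for k
    proof -
      have "sq (\<lambda>x. of_real (N k ^ 2) * e k x) = ennreal (N k ^ 4) * sq (e k)"
        by (subst sq_cmult) (simp_all add: norm_power power_mult[symmetric])
      also have "\<dots> \<le> ennreal (N k ^ 4) * ennreal (1 / (real (Suc k) * N k ^ 4))"
        using p(2)[of k] by (intro mult_left_mono) (auto simp: e_def[abs_def])
      also have "\<dots> = ennreal (1 / real (Suc k))"
        using N[of k] by (simp add: ennreal_mult'[symmetric] del: of_nat_Suc)
      finally show ?thesis .
    qed
    moreover have "(\<lambda>k. ennreal (1 / real (Suc k))) \<longlonglongrightarrow> 0"
      using tendsto_ennrealI[OF LIMSEQ_inverse_real_of_nat] by (simp add: divide_inverse del: of_nat_Suc)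
    ultimately show ?thesis unfolding L2_null_def by (auto intro: ennreal_squeeze_0)
  qed
  have NL2: "(\<lambda>x. of_real (N k ^ 2) * e k x) \<in> L2" for k by (intro L2_cmult eL2)
  have ne: "L2_null e"
  proof (rule null_dominated[OF nN, where C = 1])
    have "1 * cmod (e k x) \<le> N k ^ 2 * cmod (e k x)" for k x
      using N[of k] by (intro mult_right_mono one_le_power) auto
    then show "AE x in Rplus. cmod (e k x) \<le> 1 * cmod (of_real (N k ^ 2) * e k x)" for k
      by (simp add: norm_mult norm_power)
  qed measurable
  note ne1 = null_Hardy2[OF ne eL2]
  have pc: "prim (\<lambda>x. of_real (N k ^ 2) * f x) = (\<lambda>x. of_real (N k ^ 2) * prim f x)" for k f
    unfolding prim_def fun_eq_iff by (simp add: set_integral_mult_right)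
  have nN1: "L2_null (\<lambda>k x. of_real (N k ^ 2) * prim (prim (e k)) x / (of_real x)\<^sup>2)"
    using null_Hardy2(2)[OF nN NL2] unfolding pc .
  define V where "V k = prim (p k)" for k
  define U where "U k = prim (V k)" for k
  have cV: "continuous_on {0..} (V k)" "continuous_on {0..} (U k)" for k
    unfolding V_def U_def by (intro continuous_on_prim loc_prim lp)+
  have smU: "smooth_on {0<..} (U k)" for k
    unfolding U_def V_def
    by (intro smooth_on_prim continuous_on_prim lp cp smooth_on_polynomial_function p(1))
  have dV: "(V k has_vector_derivative p k x) (at x)" and dU: "(U k has_vector_derivative V k x) (at x)" if "x > 0" for k x
    using prim_has_vector_derivative[OF cp, of x k] prim_has_vector_derivative[OF cV(1), of x k] that
    unfolding U_def V_def by (simp_all add: at_within_Ici)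
  have VU: "V k x = prim h x - prim (e k) x" "U k x = prim (prim h) x - prim (prim (e k)) x" if "x \<le> N k" for k x
  proof -
    have 1: "prim (e k) y = prim h y - V k y" if "y \<le> N k" for y
      using prim_diff[OF lh lp, of k y] prim_cong[of y "e k" "\<lambda>x. h x - p k x"] that by (simp add: e_def V_def)
    then show "V k x = prim h x - prim (e k) x" using that by simp
    have "loc_integrable (V k)" unfolding V_def by (intro loc_prim lp)
    then show "U k x = prim (prim h) x - prim (prim (e k)) x"
      using prim_diff[OF loc_prim[OF lh], of "V k" x] prim_cong[of x "prim (e k)" "\<lambda>x. prim h x - V k x"] 1 that
      by (simp add: U_def)
  qed
  define F where "F k x = X k x * U k x" for k x
  define F1 where "F1 k x = X k x * V k x + X' k x * U k x" for k x
  define F2 where "F2 k x = X k x * p k x + 2 * (X' k x * V k x) + X'' k x * U k x" for k x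
  have dF: "(F k has_vector_derivative F1 k x) (at x)" "(F1 k has_vector_derivative F2 k x) (at x)" if "x > 0" for k x
  proof -
    show "(F k has_vector_derivative F1 k x) (at x)"
      unfolding F_def[abs_def] F1_def by (intro has_vector_derivative_mult X' dU that)
    have "(F1 k has_vector_derivative (X k x * p k x + X' k x * V k x) + (X' k x * V k x + X'' k x * U k x)) (at x)"
      unfolding F1_def[abs_def] by (intro has_vector_derivative_add has_vector_derivative_mult X' dU dV that)
    then show "(F1 k has_vector_derivative F2 k x) (at x)" by (simp add: F2_def algebra_simps)
  qed
  have "\<exists>D a b. tower D a b \<and> (\<forall>x>0. D 0 x = F k x) \<and> (\<forall>x>0. D 2 x = F2 k x)" for k
  proof -
    have Fk: "F k \<in> Cc_smooth {0<..}"
      unfolding F_def[abs_def]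
    proof (rule Cc_smoothI[where a = "a / real (Suc k)" and b = "b * real (Suc k)"])
      show "smooth_on {0<..} (\<lambda>x. X k x * U k x)" by (intro smooth_on_mult smU X')
      show "X k x * U k x = 0" if "x > 0" "x \<notin> {a / real (Suc k)..b * real (Suc k)}" for x
      proof -
        have "x \<le> a / real (Suc k) \<or> x \<ge> b * real (Suc k)" using that(2) by auto
        then show ?thesis using X'(11)[OF that(1)] by simp
      qed
    qed (use X'(1) in simp)
    obtain D a b where D: "tower D a b" "\<And>x. x > 0 \<Longrightarrow> D 0 x = F k x"
      by (rule Cc_smoothE[OF Fk], rule that)
    moreover have "D 2 x = F2 k x" if "x > 0" for x
      using tower_deriv2[OF D that] deriv2_eq[of "F k" "F1 k" "F2 k", OF dF that] by simp
    ultimately show ?thesis by blast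
  qed
  then obtain D where D: "\<And>k. \<exists>a b. tower (D k) a b" "\<And>k x. x > 0 \<Longrightarrow> D k 0 x = F k x" "\<And>k x. x > 0 \<Longrightarrow> D k 2 x = F2 k x"
    by metis
  have Dm[measurable]: "D k n \<in> borel_measurable Rplus" for k n
    using D(1)[of k] by (auto intro!: measurable_continuous_Ioi dest: towerD)
  have XN: "X k x = 0" "X' k x = 0" "X'' k x = 0" if "x > 0" "\<not> x \<le> N k" for k x
    using X'(11)[OF that(1), of k] that(2) by (auto simp: N_def)
  have n1: "L2_null (\<lambda>k x. X k x * e k x)"
    by (rule null_dominated[OF ne, where C = C]) (auto intro!: AE_I2 mult_right_mono X' simp: norm_mult)
  have n2: "L2_null (\<lambda>k x. X' k x * prim (e k) x)"
  proof (rule null_dominated[OF ne1(1), where C = C])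
    show "AE x in Rplus. cmod (X' k x * prim (e k) x) \<le> C * cmod (prim (e k) x / of_real x)" for k
    proof (intro AE_I2)
      fix x assume "x \<in> space Rplus"
      then show "cmod (X' k x * prim (e k) x) \<le> C * cmod (prim (e k) x / of_real x)"
        using mult_right_mono[OF X'(9)[of x k], of "cmod (prim (e k) x)"] by (simp add: norm_mult norm_divide)
    qed
  qed measurable
  have n3: "L2_null (\<lambda>k x. X'' k x * prim (prim (e k)) x)"
  proof (rule null_dominated[OF ne1(2), where C = C])
    show "AE x in Rplus. cmod (X'' k x * prim (prim (e k)) x) \<le> C * cmod (prim (prim (e k)) x / (of_real x)\<^sup>2)" for k
    proof (intro AE_I2)
      fix x assume "x \<in> space Rplus"
      then show "cmod (X'' k x * prim (prim (e k)) x) \<le> C * cmod (prim (prim (e k)) x / (of_real x)\<^sup>2)"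
        using mult_right_mono[OF X'(10)[of x k], of "cmod (prim (prim (e k)) x)"] by (simp add: norm_mult norm_divide norm_power)
    qed
  qed measurable
  have n4: "L2_null (\<lambda>k x. X k x * (prim (prim (e k)) x / (of_real x)\<^sup>2))"
    by (rule null_dominated[OF ne1(2), where C = C])
      (auto intro!: AE_I2 mult_right_mono X' simp: norm_mult simp del: times_divide_eq_right)
  have n5: "L2_null (\<lambda>k x. X k x * prim (prim (e k)) x)"
  proof (rule null_dominated[OF nN1, where C = C])
    show "AE x in Rplus. cmod (X k x * prim (prim (e k)) x) \<le> C * cmod (of_real (N k ^ 2) * prim (prim (e k)) x / (of_real x)\<^sup>2)" for k
    proof (intro AE_I2)
      fix x assume "x \<in> space Rplus"
      then have x: "x > 0" by simp
      show "cmod (X k x * prim (prim (e k)) x) \<le> C * cmod (of_real (N k ^ 2) * prim (prim (e k)) x / (of_real x)\<^sup>2)"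
      proof (cases "x \<le> N k")
        case True
        then have "x\<^sup>2 \<le> N k ^ 2" using x by (intro power_mono) auto
        then have "1 \<le> N k ^ 2 / x\<^sup>2" using x by simp
        then have le: "cmod (prim (prim (e k)) x) * 1 \<le> cmod (prim (prim (e k)) x) * (N k ^ 2 / x\<^sup>2)"
          by (rule mult_left_mono) simp
        have "cmod (X k x) * (cmod (prim (prim (e k)) x) * 1) \<le> C * (cmod (prim (prim (e k)) x) * (N k ^ 2 / x\<^sup>2))"
          using X'(4) X'(8)[OF x] by (intro mult_mono[OF _ le]) auto
        then show ?thesis by (simp add: norm_mult norm_divide norm_power mult_ac)
      qed (use XN x X'(4) in \<open>simp\<close>)
    qed
  qed measurable
  have hL2: "(\<lambda>x. prim h x / of_real x) \<in> L2" "(\<lambda>x. prim (prim h) x / (of_real x)\<^sup>2) \<in> L2"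
    using L2_Hardy[OF h] L2_Hardy2[OF h] by auto
  show ?thesis
  proof (rule that[of D, OF D(1)])
    \<comment> \<open>The product rule for \<open>(X k * U k)''\<close> with
      \<open>p k = h - e k\<close> and the corresponding expressions for \<open>V k\<close> and
      \<open>U k\<close>. Powers of \<open>x\<close> are multiplied and divided to expose the square
      integrable functions \<open>prim h / x\<close> and \<open>prim (prim h) / x^2\<close>.\<close>
    have "L2_null (\<lambda>k x. (X k x - 1) * h x - X k x * e k x + 2 * (X' k x * (of_real x * (prim h x / of_real x)) - X' k x * prim (e k) x)
       + (X'' k x * ((of_real x)\<^sup>2 * (prim (prim h) x / (of_real x)\<^sup>2)) - X'' k x * prim (prim (e k)) x))"
      by (intro null_add null_diff null_cmult null_cutoff[OF X] h hL2 n1 n2 n3)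
    then show "L2_null (\<lambda>k x. D k 2 x - h x)"
    proof (rule null_cong_AE; (intro AE_I2)?)
      fix k x assume "x \<in> space Rplus"
      then have x: "x > 0" by simp
      show "D k 2 x - h x = (X k x - 1) * h x - X k x * e k x + 2 * (X' k x * (of_real x * (prim h x / of_real x)) - X' k x * prim (e k) x)
       + (X'' k x * ((of_real x)\<^sup>2 * (prim (prim h) x / (of_real x)\<^sup>2)) - X'' k x * prim (prim (e k)) x)"
      proof (cases "x \<le> N k")
        case True
        have px: "p k x = h x - e k x" using True by (simp add: e_def)
        show ?thesis using x by (simp add: D(3) F2_def VU[OF True] px algebra_simps)
      qed (use x XN in \<open>simp add: D(3) F2_def\<close>)
    qed measurable
    have "L2_null (\<lambda>k x. (X k x - 1) * (prim (prim h) x / (of_real x)\<^sup>2) - X k x * (prim (prim (e k)) x / (of_real x)\<^sup>2))"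
      by (intro null_diff null_cutoff[OF X] hL2 n4)
    then show "L2_null (\<lambda>k x. D k 0 x / (of_real x)\<^sup>2 - prim (prim h) x / (of_real x)\<^sup>2)"
    proof (rule null_cong_AE; (intro AE_I2)?)
      fix k x assume "x \<in> space Rplus"
      then have x: "x > 0" by simp
      show "D k 0 x / (of_real x)\<^sup>2 - prim (prim h) x / (of_real x)\<^sup>2 =
         (X k x - 1) * (prim (prim h) x / (of_real x)\<^sup>2) - X k x * (prim (prim (e k)) x / (of_real x)\<^sup>2)"
      proof (cases "x \<le> N k")
        case True
        then show ?thesis using x by (simp add: D(2) F_def VU[OF True] diff_divide_distrib algebra_simps)
      qed (use x XN in \<open>simp add: D(2) F_def\<close>)
    qed measurable
    assume uL2: "prim (prim h) \<in> L2"
    have "L2_null (\<lambda>k x. (X k x - 1) * prim (prim h) x - X k x * prim (prim (e k)) x)"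
      by (intro null_diff null_cutoff[OF X] uL2 n5)
    then show "L2_null (\<lambda>k x. D k 0 x - prim (prim h) x)"
    proof (rule null_cong_AE; (intro AE_I2)?)
      fix k x assume "x \<in> space Rplus"
      then have x: "x > 0" by simp
      show "D k 0 x - prim (prim h) x = (X k x - 1) * prim (prim h) x - X k x * prim (prim (e k)) x"
      proof (cases "x \<le> N k")
        case True
        then show ?thesis using x by (simp add: D(2) F_def VU[OF True] algebra_simps)
      qed (use x XN in \<open>simp add: D(2) F_def\<close>)
    qed measurable
  qed
qed

section \<open>Distributional derivatives\<close>

lemma tower_Cc_smooth:
  assumes "tower D a b"
  shows "D n \<in> Cc_smooth {0<..}"
proof (rule Cc_smoothI[OF _ towerD(1)[OF assms]])
  show "smooth_on {0<..} (D n)"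
    unfolding smooth_on_def
  proof (intro exI[of _ "\<lambda>k. D (k + n)"] conjI ballI allI)
    show "(D (k + n) has_vector_derivative D (Suc k + n) x) (at x within {0<..})" for k x
      using towerD(2)[OF assms, of "k + n" x] by (simp add: has_vector_derivative_at_within)
  qed simp
  show "D n x = 0" if "x \<notin> {a..b}" for x using that by (rule towerD(3)[OF assms])
qed

lemma
  assumes D: "tower D a b"
  shows tower_L2: "D n \<in> L2"
    and tower_L2_div: "(\<lambda>x. D n x / (of_real x)\<^sup>2) \<in> L2"
    and tower_L2_mult: "(\<lambda>x. (of_real x)\<^sup>2 * D n x) \<in> L2"
  by (rule compact_support_L2[OF towerD(1)[OF D], of _ b];
      auto intro!: continuous_intros towerD(4)[OF D] simp: towerD(3)[OF D])+

text \<open>The conjugate of \<open>g\<close> is approximated by second derivatives of test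
  functions, which are again test functions. In the limit the vanishing pairings give the integral
  of \<open>|g|^2\<close>; the conjugate compensates for the bilinear pairing.\<close>

lemma fundamental_lemma:
  assumes X: "cutoff_seq a b C X X' X''" and g: "g \<in> L2"
    and 0: "\<And>\<phi>. \<phi> \<in> Cc_smooth {0<..} \<Longrightarrow> (\<integral>x. g x * \<phi> x \<partial>Rplus) = 0"
  shows "AE x in Rplus. g x = 0"
proof -
  note [measurable] = L2_measurable[OF g]
  have cg: "(\<lambda>x. cnj (g x)) \<in> L2"
    by (rule L2_dominated[OF g, where C = 1]) (auto intro: measurable_compose[OF _ borel_measurable_continuous_onI[OF continuous_on_cnj[OF continuous_on_id]]])
  obtain D :: "nat \<Rightarrow> nat \<Rightarrow> real \<Rightarrow> complex" where D: "\<And>k. \<exists>a b. tower (D k) a b"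
    "L2_null (\<lambda>k x. D k 2 x - cnj (g x))"
    by (rule test_function_approximation[OF X cg], rule that)
  have DL2: "D k 2 \<in> L2" and DCc: "D k 2 \<in> Cc_smooth {0<..}" for k
    using D(1)[of k] tower_L2 tower_Cc_smooth by blast+
  have "(\<lambda>k. \<integral>x. D k 2 x * g x \<partial>Rplus) \<longlonglongrightarrow> (\<integral>x. cnj (g x) * g x \<partial>Rplus)"
    by (rule null_integral_mult[OF D(2) DL2 cg g])
  moreover have "(\<integral>x. D k 2 x * g x \<partial>Rplus) = 0" for k
    using 0[OF DCc[of k]] by (simp add: mult.commute)
  ultimately have "(\<integral>x. cnj (g x) * g x \<partial>Rplus) = 0"
    by (simp add: LIMSEQ_const_iff)
  also have "(\<lambda>x. cnj (g x) * g x) = (\<lambda>x. complex_of_real ((cmod (g x))\<^sup>2))"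
    unfolding complex_norm_square by (simp add: mult.commute)
  finally have "(\<integral>x. (cmod (g x))\<^sup>2 \<partial>Rplus) = 0"
    unfolding integral_complex_of_real by simp
  then have "AE x in Rplus. (cmod (g x))\<^sup>2 = 0"
    using g by (subst (asm) integral_nonneg_eq_0_iff_AE) (auto simp: L2_def)
  then show ?thesis by eventually_elim simp
qed

text \<open>The double primitive may fail to be square integrable, so the left side is read as the
  pairing of \<open>prim (prim h) / x^2\<close> with \<open>x^2 \<phi>''\<close>, where both factors
  are. Integration by parts takes place on the approximating test functions and passes to the
  limit.\<close>

lemma integral_prim_prim_deriv2:
  assumes X: "cutoff_seq a b C X X' X''" and h: "h \<in> L2" and \<phi>: "\<phi> \<in> Cc_smooth {0<..}"
  shows "(\<integral>x. prim (prim h) x * deriv2 \<phi> x \<partial>Rplus) = (\<integral>x. h x * \<phi> x \<partial>Rplus)"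
proof -
  obtain E a' b' where E: "tower E a' b'" "\<And>x. x > 0 \<Longrightarrow> E 0 x = \<phi> x"
    by (rule Cc_smoothE[OF \<phi>], rule that)
  note E2 = tower_deriv2[OF E]
  obtain D :: "nat \<Rightarrow> nat \<Rightarrow> real \<Rightarrow> complex" where D: "\<And>k. \<exists>a b. tower (D k) a b"
    "L2_null (\<lambda>k x. D k 2 x - h x)"
    "L2_null (\<lambda>k x. D k 0 x / (of_real x)\<^sup>2 - prim (prim h) x / (of_real x)\<^sup>2)"
    by (rule test_function_approximation[OF X h], rule that)
  have DL2: "D k 2 \<in> L2" "(\<lambda>x. D k 0 x / (of_real x)\<^sup>2) \<in> L2" for k
    using D(1)[of k] tower_L2 tower_L2_div by blast+
  have 1: "(\<lambda>k. \<integral>x. D k 2 x * E 0 x \<partial>Rplus) \<longlonglongrightarrow> (\<integral>x. h x * E 0 x \<partial>Rplus)"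
    by (rule null_integral_mult[OF D(2) DL2(1) h tower_L2[OF E(1)]])
  have 2: "(\<lambda>k. \<integral>x. D k 0 x / (of_real x)\<^sup>2 * ((of_real x)\<^sup>2 * E 2 x) \<partial>Rplus) \<longlonglongrightarrow>
     (\<integral>x. prim (prim h) x / (of_real x)\<^sup>2 * ((of_real x)\<^sup>2 * E 2 x) \<partial>Rplus)"
    by (rule null_integral_mult[OF D(3) DL2(2) L2_Hardy2[OF h] tower_L2_mult[OF E(1)]])
  have "(\<integral>x. D k 0 x / (of_real x)\<^sup>2 * ((of_real x)\<^sup>2 * E 2 x) \<partial>Rplus) = (\<integral>x. D k 2 x * E 0 x \<partial>Rplus)" for k
  proof -
    obtain a b where Dk: "tower (D k) a b" using D(1) by blast
    have "(\<integral>x. D k 0 x / (of_real x)\<^sup>2 * ((of_real x)\<^sup>2 * E 2 x) \<partial>Rplus) = (\<integral>x. D k 0 x * E 2 x \<partial>Rplus)"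
      by (intro Bochner_Integration.integral_cong) auto
    also have "\<dots> = (\<integral>x. D k 2 x * E 0 x \<partial>Rplus)"
      using towerD(2)[OF Dk, of 0] towerD(2)[OF Dk, of 1]
      by (intro tower_by_parts2[OF E(1)]) (auto simp: numeral_2_eq_2 towerD(4)[OF Dk])
    finally show ?thesis .
  qed
  with 2 have "(\<lambda>k. \<integral>x. D k 2 x * E 0 x \<partial>Rplus) \<longlonglongrightarrow>
     (\<integral>x. prim (prim h) x / (of_real x)\<^sup>2 * ((of_real x)\<^sup>2 * E 2 x) \<partial>Rplus)" by simp
  from LIMSEQ_unique[OF this 1]
  have "(\<integral>x. prim (prim h) x / (of_real x)\<^sup>2 * ((of_real x)\<^sup>2 * E 2 x) \<partial>Rplus) = (\<integral>x. h x * E 0 x \<partial>Rplus)" .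
  also have "(\<integral>x. prim (prim h) x / (of_real x)\<^sup>2 * ((of_real x)\<^sup>2 * E 2 x) \<partial>Rplus) =
      (\<integral>x. prim (prim h) x * deriv2 \<phi> x \<partial>Rplus)"
    by (intro Bochner_Integration.integral_cong) (auto simp: E2)
  also have "(\<integral>x. h x * E 0 x \<partial>Rplus) = (\<integral>x. h x * \<phi> x \<partial>Rplus)"
    by (intro Bochner_Integration.integral_cong) (auto simp: E)
  finally show ?thesis .
qed

lemma prim_eq_beyond_support:
  assumes "\<And>s. s > b \<Longrightarrow> h s = 0" "x \<ge> b"
  shows "prim h x = prim h b"
proof -
  have "indicat_real {0<..x} s *\<^sub>R h s = indicat_real {0<..b} s *\<^sub>R h s" for s
    using assms(1)[of s] assms(2) by (cases "s > b") (simp_all add: indicator_def)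
  then show ?thesis unfolding prim_def set_lebesgue_integral_def by (simp only:)
qed

text \<open>
  The test functions are \<open>\<phi> = X\<^sub>k \<phi>\<^sub>0\<close>, where \<open>\<phi>\<^sub>0'' = \<psi>\<close> and \<open>\<phi>\<^sub>0\<close> vanishes near infinity. The
  terms of \<open>\<phi>''\<close> with derivatives of \<open>X\<^sub>k\<close> live on an interval of length \<open>O(1/k)\<close> at distance of
  order \<open>1/k\<close> from \<open>0\<close>, and are \<open>O(k\<^sup>2)\<close> there, so that \<open>w = o(x)\<close> makes their contribution vanish.
\<close>

lemma integral_test_function_eq_0:
  assumes X: "cutoff_seq a b C X X' X''" and w: "continuous_on {0<..} w"
    and w0: "((\<lambda>x. w x / of_real x) \<longlongrightarrow> 0) (at_right 0)"
    and 0: "\<And>\<phi>. \<phi> \<in> Cc_smooth {0<..} \<Longrightarrow> (\<integral>x. w x * deriv2 \<phi> x \<partial>Rplus) = 0"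
    and \<psi>: "\<psi> \<in> Cc_smooth {0<..}"
  shows "(\<integral>x. w x * \<psi> x \<partial>Rplus) = 0"
proof -
  note X' = cutoff_seqD[OF X]
  obtain E a' b' where E: "tower E a' b'" and E\<psi>: "\<And>x. x > 0 \<Longrightarrow> E 0 x = \<psi> x"
    by (rule Cc_smoothE[OF \<psi>], rule that)
  note E' = towerD[OF E]
  define B where "B = max b' 1"
  have B: "B \<ge> 1" "B \<ge> b'" by (auto simp: B_def)
  have EB: "E 0 x = 0" if "x > B" for x using that B by (intro E') auto
  \<comment> \<open>Subtracting the value at \<open>B\<close> turns \<open>A\<close>, and below it
    \<open>\<phi>\<close>, into primitives that vanish beyond \<open>B\<close>. In exchange they
    need not vanish near 0, which the factor \<open>X k\<close> repairs.\<close>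
  define A where "A x = prim (E 0) x - prim (E 0) B" for x
  define \<phi> where "\<phi> x = prim A x - prim A B" for x
  have lE: "loc_integrable (E 0)" by (intro loc_continuous E')
  have cA: "continuous_on {0..} A"
    unfolding A_def[abs_def] by (intro continuous_intros continuous_on_prim lE)
  have c\<phi>: "continuous_on {0..} \<phi>"
    unfolding \<phi>_def[abs_def] by (intro continuous_intros continuous_on_prim loc_continuous cA)
  have dA: "(A has_vector_derivative E 0 x) (at x)" if "x > 0" for x
    using has_vector_derivative_diff[OF prim_has_vector_derivative[OF E'(4), of x 0] has_vector_derivative_const] that
    unfolding A_def[abs_def] by (simp add: at_within_Ici)
  have d\<phi>: "(\<phi> has_vector_derivative A x) (at x)" if "x > 0" for x
    using has_vector_derivative_diff[OF prim_has_vector_derivative[OF cA, of x] has_vector_derivative_const] that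
    unfolding \<phi>_def[abs_def] by (simp add: at_within_Ici)
  have AB: "A x = 0" if "x \<ge> B" for x
    using prim_eq_beyond_support[of B "E 0" x, OF EB] that by (simp add: A_def)
  have \<phi>B: "\<phi> x = 0" if "x \<ge> B" for x
    using prim_eq_beyond_support[of B A x] AB that by (simp add: \<phi>_def)
  have smE: "smooth_on {0<..} (E 0)"
    using tower_Cc_smooth[OF E, of 0] by (simp add: Cc_smooth_def)
  have smA: "smooth_on {0<..} A"
    by (rule smooth_on_antiderivative[OF smE]) (simp add: has_vector_derivative_within_Ioi dA)
  have sm\<phi>: "smooth_on {0<..} \<phi>"
    by (rule smooth_on_antiderivative[OF smA]) (simp add: has_vector_derivative_within_Ioi d\<phi>)
  have "compact (A ` {0..B})" "compact (\<phi> ` {0..B})"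
    by (intro compact_continuous_image continuous_on_subset[OF cA] continuous_on_subset[OF c\<phi>]; simp)+
  then obtain M1 M2 where M1: "\<And>x. x \<in> {0..B} \<Longrightarrow> cmod (A x) \<le> M1" and M2: "\<And>x. x \<in> {0..B} \<Longrightarrow> cmod (\<phi> x) \<le> M2"
    by (metis bounded_iff compact_imp_bounded imageI)
  define M where "M = max M1 M2"
  have "M1 \<ge> 0" using M1[of 1] B(1) order_trans[OF norm_ge_zero M1[of 1]] by simp
  then have M0: "M \<ge> 0" by (simp add: M_def)
  have M: "cmod (A x) \<le> M" "cmod (\<phi> x) \<le> M" if "x > 0" for x
    using M1[of x] M2[of x] AB[of x] \<phi>B[of x] M0 that by (cases "x \<le> B"; auto simp: M_def)+
  define P where "P k x = X k x * \<phi> x" for k x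
  define P1 where "P1 k x = X k x * A x + X' k x * \<phi> x" for k x
  define R where "R k x = 2 * (X' k x * A x) + X'' k x * \<phi> x" for k x
  have d2: "deriv2 (P k) x = X k x * E 0 x + R k x" if "x > 0" for k x
  proof (rule deriv2_eq[of _ "P1 k", OF _ _ that])
    fix y :: real assume y: "y > 0"
    show "(P k has_vector_derivative P1 k y) (at y)"
      unfolding P_def[abs_def] P1_def by (intro has_vector_derivative_mult X' d\<phi> y)
    have "(P1 k has_vector_derivative (X k y * E 0 y + X' k y * A y) + (X' k y * A y + X'' k y * \<phi> y)) (at y)"
      unfolding P1_def[abs_def] by (intro has_vector_derivative_add has_vector_derivative_mult X' d\<phi> dA y)
    then show "(P1 k has_vector_derivative X k y * E 0 y + R k y) (at y)" by (simp add: R_def algebra_simps)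
  qed
  have PCc: "P k \<in> Cc_smooth {0<..}" for k
    unfolding P_def[abs_def]
  proof (rule Cc_smoothI[where a = "a / real (Suc k)" and b = "b * real (Suc k)"])
    show "smooth_on {0<..} (\<lambda>x. X k x * \<phi> x)" by (intro smooth_on_mult sm\<phi> X')
    show "X k x * \<phi> x = 0" if "x > 0" "x \<notin> {a / real (Suc k)..b * real (Suc k)}" for x
    proof -
      have "x \<le> a / real (Suc k) \<or> x \<ge> b * real (Suc k)" using that(2) by auto
      then show ?thesis using X'(11)[OF that(1)] by simp
    qed
  qed (use X'(1) in simp)
  have cR: "continuous_on {0<..} (R k)" for k
    unfolding R_def[abs_def]
    by (intro continuous_intros X' continuous_on_subset[OF cA] continuous_on_subset[OF c\<phi>]) auto
  \<comment> \<open>From \<open>|w| <= \<epsilon> x\<close>, \<open>|R k| <= 3 C M / x^2\<close> and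
    \<open>x >= a / t\<close>, the integrand is at most \<open>\<epsilon> (3 C M) t / a\<close> on
    an interval of length at most \<open>b / t\<close>. The powers of \<open>t\<close> cancel, and
    \<open>B >= 1\<close> is a further factor.\<close>
  define K where "K = 3 * C * M * B * b / a"
  have K: "K \<ge> 0" using X'(1-4) M0 B by (simp add: K_def)
  have "cmod (\<integral>x. w x * \<psi> x \<partial>Rplus) \<le> \<epsilon> * K" if \<epsilon>: "\<epsilon> > 0" for \<epsilon> :: real
  proof -
    have "eventually (\<lambda>x. cmod (w x / of_real x) < \<epsilon>) (at_right 0)"
      using w0 \<epsilon> by (auto simp: tendsto_iff)
    then obtain \<delta> where \<delta>: "\<delta> > 0" "\<And>x. 0 < x \<Longrightarrow> x < \<delta> \<Longrightarrow> cmod (w x / of_real x) < \<epsilon>"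
      by (auto simp: eventually_at_right_field)
    \<comment> \<open>The first entry puts the outer transition zone of \<open>X k\<close> beyond
      \<open>B\<close>; together with the second it gives \<open>X k = 1\<close> on the support of
      \<open>\<psi>\<close>. The other two bring the inner transition zone into
      \<open>]0, \<delta>[\<close>, where \<open>w\<close> is small, and into \<open>]0, 1]\<close>,
      where \<open>1 / x <= 1 / x^2\<close>. The factor 2 yields a strict inequality.\<close>
    define k where "k = nat \<lceil>max (B / a) (max (b / a') (max (2 * b / \<delta>) b))\<rceil>"
    define t where "t = real (Suc k)"
    have "t \<ge> B / a" "t \<ge> b / a'" "t \<ge> 2 * b / \<delta>" "t \<ge> b" unfolding t_def k_def by linarith+
    then have t: "B \<le> a * t" "b / t \<le> a'" "b / t < \<delta>" "b / t \<le> 1" "t > 0"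
      using X'(1,2) E'(1) \<delta>(1) by (auto simp: field_simps t_def simp del: of_nat_Suc)
    have XE: "X k x * E 0 x = E 0 x" if "x > 0" for x
    proof (cases "x \<in> {a'..b'}")
      case True
      then show ?thesis using X'(12)[OF that, of k] t(1,2) B by (simp add: t_def)
    qed (simp add: E'(3))
    have R0: "R k x = 0" if "x > 0" "x < a / t \<or> x > b / t" for x
    proof (cases "x < a / t")
      case True
      then show ?thesis using X'(11)[OF that(1), of k] by (simp add: R_def t_def)
    next
      case False
      with that have x: "x > b / t" by auto
      show ?thesis
      proof (cases "x \<le> a * t")
        case True
        then show ?thesis using X'(12)[OF that(1), of k] x by (simp add: R_def t_def)
      next
        case False
        then have "x \<ge> B" using t(1) by simp
        then show ?thesis by (simp add: R_def AB \<phi>B)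
      qed
    qed
    define c where "c = \<epsilon> * (3 * C * M * B) * t / a"
    have wR: "cmod (w x * R k x) \<le> c * indicator {0<..b/t} x" if "x > 0" for x
    proof (cases "a / t \<le> x \<and> x \<le> b / t")
      case True
      have "x < \<delta>" using True t(3) by auto
      then have "cmod (w x) \<le> \<epsilon> * x" using \<delta>(2)[OF that] that by (simp add: norm_divide field_simps)
      have x1: "x \<le> 1" using True t(4) by auto
      have "cmod (R k x) \<le> cmod (2 * (X' k x * A x)) + cmod (X'' k x * \<phi> x)"
        unfolding R_def by (rule norm_triangle_ineq)
      also have "\<dots> \<le> 2 * (C / x * M) + C / x\<^sup>2 * M"
      proof -
        have "cmod (2 * (X' k x * A x)) = 2 * (cmod (X' k x) * cmod (A x))" "cmod (X'' k x * \<phi> x) = cmod (X'' k x) * cmod (\<phi> x)"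
          by (simp_all add: norm_mult)
        then show ?thesis
          using X'(4) M[OF that] X'(9)[OF that, of k] X'(10)[OF that, of k] that
          by (simp only:) (intro add_mono mult_mono mult_left_mono; simp)
      qed
      also have "C / x * M \<le> C / x\<^sup>2 * M"
        using x1 that X'(4) M0 by (intro mult_right_mono divide_left_mono) (auto simp: power2_eq_square mult_left_le)
      finally have "cmod (R k x) \<le> 3 * C * M / x\<^sup>2" by (simp add: field_simps)
      then have "cmod (w x * R k x) \<le> (\<epsilon> * x) * (3 * C * M / x\<^sup>2)"
        unfolding norm_mult using \<open>cmod (w x) \<le> \<epsilon> * x\<close> that \<epsilon> by (intro mult_mono) auto
      also have "\<dots> = \<epsilon> * (3 * C * M) * (1 / x)" using that by (simp add: power2_eq_square)
      also have "\<dots> \<le> \<epsilon> * (3 * C * M) * (t / a)"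
      proof (rule mult_left_mono)
        show "1 / x \<le> t / a" using True that X'(1) t(5) by (simp add: field_simps)
        show "0 \<le> \<epsilon> * (3 * C * M)" using \<epsilon> X'(4) M0 by simp
      qed
      also have "\<dots> \<le> \<epsilon> * (3 * C * M) * (t / a) * B"
        using \<epsilon> X'(1,4) M0 B(1) t(5) mult_left_mono[OF B(1), of "\<epsilon> * (3 * C * M) * (t / a)"] by simp
      also have "\<dots> = c" by (simp add: c_def)
      finally show ?thesis using True that by simp
    next
      case False
      then have "R k x = 0" using R0[OF that] by auto
      moreover have "c \<ge> 0" using \<epsilon> X'(1,4) M0 B(1) t(5) by (simp add: c_def)
      ultimately show ?thesis by simp
    qed
    have suppR: "w x * R k x = 0" if "x > 0" "x \<notin> {a / t..b / t}" for x using R0[OF that(1)] that(2) by auto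
    have at: "0 < a / t" using X'(1) t(5) by simp
    have iR: "integrable Rplus (\<lambda>x. w x * R k x)"
      by (rule compact_support_integrable[OF at _ suppR]) (intro continuous_intros w cR)
    have iE: "integrable Rplus (\<lambda>x. w x * E 0 x)"
      by (rule compact_support_integrable[OF E'(1)]) (auto intro!: continuous_intros w E' simp: E'(3))
    have m: "{0<..b/t} \<in> sets Rplus" by (auto simp: sets_restrict_space_iff)
    have em: "emeasure Rplus {0<..b/t} = ennreal (b / t)"
      using X'(2) t(5) by (subst emeasure_restrict_space) auto
    have "0 = (\<integral>x. w x * deriv2 (P k) x \<partial>Rplus)" using 0[OF PCc] by simp
    also have "\<dots> = (\<integral>x. w x * E 0 x + w x * R k x \<partial>Rplus)"
      by (intro Bochner_Integration.integral_cong) (auto simp: d2 XE distrib_left)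
    also have "\<dots> = (\<integral>x. w x * E 0 x \<partial>Rplus) + (\<integral>x. w x * R k x \<partial>Rplus)"
      by (rule Bochner_Integration.integral_add[OF iE iR])
    finally have "cmod (\<integral>x. w x * E 0 x \<partial>Rplus) = cmod (\<integral>x. w x * R k x \<partial>Rplus)"
      by (metis add_eq_0_iff norm_minus_cancel)
    also have "\<dots> \<le> (\<integral>x. cmod (w x * R k x) \<partial>Rplus)" by (rule integral_norm_bound)
    also have "\<dots> \<le> (\<integral>x. c * indicator {0<..b/t} x \<partial>Rplus)"
      using iR wR m em by (intro integral_mono integrable_mult_right integrable_real_indicator) auto
    also have "\<dots> = c * (b / t)"
    proof -
      have "{0<..b/t} \<inter> {0<..} = {0<..b/t}" by auto
      then show ?thesis using m em X'(2) t(5) by (simp add: measure_def)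
    qed
    also have "\<dots> = \<epsilon> * K" using t(5) by (simp add: c_def K_def)
    finally show ?thesis
      using Bochner_Integration.integral_cong[OF refl, of Rplus "\<lambda>x. w x * E 0 x" "\<lambda>x. w x * \<psi> x"] E\<psi> by simp
  qed
  note le = this
  have "cmod (\<integral>x. w x * \<psi> x \<partial>Rplus) \<le> 0"
  proof (rule field_le_epsilon)
    fix e :: real assume e: "e > 0"
    have "e / (K + 1) * K \<le> e" using e K by (simp add: field_simps)
    then show "cmod (\<integral>x. w x * \<psi> x \<partial>Rplus) \<le> 0 + e" using le[of "e / (K + 1)"] e K by (simp add: add_pos_nonneg)
  qed
  then show ?thesis by simp
qed

text \<open>Functions with vanishing distributional second derivative are affine, and
  \<open>w = o(x)\<close> at 0 leaves only 0. As \<open>w\<close> need not be square integrable, the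
  fundamental lemma is applied to \<open>X k * w\<close>, and \<open>X k\<close> is moved onto the
  test function.\<close>

lemma AE_eq_0_if_deriv2_eq_0:
  assumes X: "cutoff_seq a b C X X' X''" and w: "continuous_on {0<..} w"
    and w0: "((\<lambda>x. w x / of_real x) \<longlongrightarrow> 0) (at_right 0)"
    and 0: "\<And>\<phi>. \<phi> \<in> Cc_smooth {0<..} \<Longrightarrow> (\<integral>x. w x * deriv2 \<phi> x \<partial>Rplus) = 0"
  shows "AE x in Rplus. w x = 0"
proof -
  note X' = cutoff_seqD[OF X]
  have "AE x in Rplus. X k x * w x = 0" for k
  proof (rule fundamental_lemma[OF X])
    have supp: "X k x = 0" if "x > 0" "x \<notin> {a / real (Suc k)..b * real (Suc k)}" for x
    proof -
      have "x \<le> a / real (Suc k) \<or> x \<ge> b * real (Suc k)" using that(2) by auto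
      then show ?thesis using X'(11)[OF that(1)] by simp
    qed
    have pos: "0 < a / real (Suc k)" using X'(1) by simp
    show "(\<lambda>x. X k x * w x) \<in> L2"
      by (rule compact_support_L2[OF pos, of _ "b * real (Suc k)"]) (auto intro!: continuous_intros w X' simp: supp)
    fix \<psi> assume \<psi>: "\<psi> \<in> Cc_smooth {0<..}"
    have "(\<lambda>x. X k x * \<psi> x) \<in> Cc_smooth {0<..}"
      by (rule Cc_smoothI[OF _ pos, of _ "b * real (Suc k)"])
         (use \<psi> in \<open>auto intro!: smooth_on_mult X' simp: supp Cc_smooth_def\<close>)
    from integral_test_function_eq_0[OF X w w0 0 this]
    show "(\<integral>x. X k x * w x * \<psi> x \<partial>Rplus) = 0" by (simp add: mult_ac)
  qed
  then have "AE x in Rplus. \<forall>k. X k x * w x = 0" by (subst AE_all_countable) blast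
  then show ?thesis using AE_space
  proof eventually_elim
    case (elim x)
    then obtain k where "X k x = 1"
      using cutoff_seq_eventually[OF X, of x] by (auto simp: eventually_sequentially)
    then show ?case using elim by auto
  qed
qed

text \<open>In the forward direction the continuously differentiable representative is compared with
  the double primitive of \<open>g = f''\<close>. Both have the same distributional second
  derivative, and value and slope 0 at 0, so their difference is \<open>o(x)\<close> and must
  vanish. Conversely, \<open>prim (prim h)\<close> with derivative \<open>prim h\<close> is a
  representative with the required boundary values.\<close>

lemma H2_0_iff:
  assumes X: "cutoff_seq a b C X X' X''"
  shows "f \<in> H2_0 \<longleftrightarrow> f \<in> L2 \<and> (\<exists>h\<in>L2. AE x in Rplus. f x = prim (prim h) x)"
proof
  assume "f \<in> H2_0"
  then have H: "f \<in> H2" and ex_uv: "\<exists>u v. (AE x in Rplus. f x = u x) \<and>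
      (\<forall>x\<ge>0. (u has_vector_derivative v x) (at x within {0..})) \<and> continuous_on {0..} v \<and> u 0 = 0 \<and> v 0 = 0"
    unfolding H2_0_def mem_Collect_eq by blast+
  from H have f: "f \<in> L2" and ex_g: "\<exists>g\<in>L2. dist_deriv2 f g"
    unfolding H2_def mem_Collect_eq by blast+
  obtain g where g: "g \<in> L2" "dist_deriv2 f g" using ex_g by blast
  obtain u v where fu: "AE x in Rplus. f x = u x"
    and u': "\<forall>x\<ge>0. (u has_vector_derivative v x) (at x within {0..})"
    and v: "continuous_on {0..} v" and uv0: "u 0 = 0" "v 0 = 0"
    using ex_uv by blast
  note u = u'[rule_format]
  note lg = loc_L2[OF g(1)]
  have "continuous_on {0..} u"
    using u by (auto simp: continuous_on_eq_continuous_within intro: has_vector_derivative_continuous)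
  then have cu: "continuous_on {0<..} u" by (rule continuous_on_subset) auto
  have cJ: "continuous_on {0<..} (prim (prim g))"
    by (rule continuous_on_subset[OF continuous_on_prim[OF loc_prim[OF lg]]]) auto
  define w where "w x = u x - prim (prim g) x" for x
  have cw: "continuous_on {0<..} w" unfolding w_def[abs_def] by (intro continuous_intros cu cJ)
  have "AE x in Rplus. w x = 0"
  proof (rule AE_eq_0_if_deriv2_eq_0[OF X cw])
    \<comment> \<open>As \<open>w 0 = 0\<close>, the difference quotient at 0 is
      \<open>w x / x\<close>, so a vanishing one-sided derivative is the condition
      \<open>w = o(x)\<close>.\<close>
    have "(w has_vector_derivative v 0 - prim g 0) (at 0 within {0..})"
      unfolding w_def[abs_def]
      by (intro has_vector_derivative_diff u prim_has_vector_derivative continuous_on_prim lg) auto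
    then have "(w has_vector_derivative 0) (at 0 within {0..})" by (simp add: uv0 prim_nonpos)
    then have "((\<lambda>y. (1 / norm (y - 0)) *\<^sub>R (w y - (w 0 + (y - 0) *\<^sub>R 0))) \<longlongrightarrow> 0) (at 0 within {0..})"
      unfolding has_vector_derivative_def has_derivative_within by blast
    then have lim: "((\<lambda>y. (1 / norm (y - 0)) *\<^sub>R (w y - (w 0 + (y - 0) *\<^sub>R 0))) \<longlongrightarrow> 0) (at_right 0)"
      by (rule tendsto_within_subset) auto
    have w00: "w 0 = 0" by (simp add: w_def uv0 prim_nonpos)
    have "eventually (\<lambda>y. (1 / norm (y - 0)) *\<^sub>R (w y - (w 0 + (y - 0) *\<^sub>R 0)) = w y / of_real y) (at_right 0)"
      using eventually_at_right_less[of "0::real"]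
      by eventually_elim (simp add: scaleR_conv_of_real w00 divide_inverse mult.commute)
    then show "((\<lambda>x. w x / of_real x) \<longlongrightarrow> 0) (at_right 0)"
      by (rule Lim_transform_eventually[OF lim])
    fix \<phi> :: "real \<Rightarrow> complex" assume \<phi>: "\<phi> \<in> Cc_smooth {0<..}"
    obtain E a' b' where E: "tower E a' b'" "\<And>x. x > 0 \<Longrightarrow> E 0 x = \<phi> x"
      by (rule Cc_smoothE[OF \<phi>], rule that)
    note E2 = tower_deriv2[OF E]
    have i: "integrable Rplus (\<lambda>x. u x * E 2 x)" "integrable Rplus (\<lambda>x. prim (prim g) x * E 2 x)"
      by (rule compact_support_integrable[OF towerD(1)[OF E(1)], of _ b'];
          auto intro!: continuous_intros cu cJ towerD[OF E(1)] simp: towerD(3)[OF E(1)])+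
    have "(\<integral>x. w x * deriv2 \<phi> x \<partial>Rplus) = (\<integral>x. u x * E 2 x - prim (prim g) x * E 2 x \<partial>Rplus)"
      by (intro Bochner_Integration.integral_cong) (auto simp: E2 w_def left_diff_distrib)
    also have "\<dots> = (\<integral>x. u x * E 2 x \<partial>Rplus) - (\<integral>x. prim (prim g) x * E 2 x \<partial>Rplus)"
      by (rule Bochner_Integration.integral_diff[OF i])
    also have "(\<integral>x. u x * E 2 x \<partial>Rplus) = (\<integral>x. f x * E 2 x \<partial>Rplus)"
      using fu f by (intro integral_cong_AE borel_measurable_times L2_measurable measurable_continuous_Ioi cu towerD(4)[OF E(1)])
        (auto elim: eventually_mono)
    also have "\<dots> = (\<integral>x. f x * deriv2 \<phi> x \<partial>Rplus)"
      by (intro Bochner_Integration.integral_cong) (auto simp: E2)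
    also have "\<dots> = (\<integral>x. g x * \<phi> x \<partial>Rplus)" using g(2) \<phi> by (simp add: dist_deriv2_def)
    also have "(\<integral>x. prim (prim g) x * E 2 x \<partial>Rplus) = (\<integral>x. prim (prim g) x * deriv2 \<phi> x \<partial>Rplus)"
      by (intro Bochner_Integration.integral_cong) (auto simp: E2)
    also have "\<dots> = (\<integral>x. g x * \<phi> x \<partial>Rplus)" by (rule integral_prim_prim_deriv2[OF X g(1) \<phi>])
    finally show "(\<integral>x. w x * deriv2 \<phi> x \<partial>Rplus) = 0" by simp
  qed
  with fu have "AE x in Rplus. f x = prim (prim g) x" by eventually_elim (simp add: w_def)
  with f g(1) show "f \<in> L2 \<and> (\<exists>h\<in>L2. AE x in Rplus. f x = prim (prim h) x)" by blast
next
  assume "f \<in> L2 \<and> (\<exists>h\<in>L2. AE x in Rplus. f x = prim (prim h) x)"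
  then obtain h where f: "f \<in> L2" and h: "h \<in> L2" and fh: "AE x in Rplus. f x = prim (prim h) x" by blast
  note lh = loc_L2[OF h]
  have "dist_deriv2 f h"
    unfolding dist_deriv2_def
  proof
    fix \<phi> :: "real \<Rightarrow> complex" assume \<phi>: "\<phi> \<in> Cc_smooth {0<..}"
    obtain E a' b' where E: "tower E a' b'" "\<And>x. x > 0 \<Longrightarrow> E 0 x = \<phi> x"
      by (rule Cc_smoothE[OF \<phi>], rule that)
    note E2 = tower_deriv2[OF E]
    have "(\<integral>x. f x * deriv2 \<phi> x \<partial>Rplus) = (\<integral>x. f x * E 2 x \<partial>Rplus)"
      by (intro Bochner_Integration.integral_cong) (auto simp: E2)
    also have "\<dots> = (\<integral>x. prim (prim h) x * E 2 x \<partial>Rplus)"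
      using fh f by (intro integral_cong_AE borel_measurable_times L2_measurable measurable_continuous_Ioi towerD(4)[OF E(1)] measurable_prim loc_prim lh)
        (auto elim: eventually_mono)
    also have "\<dots> = (\<integral>x. prim (prim h) x * deriv2 \<phi> x \<partial>Rplus)"
      by (intro Bochner_Integration.integral_cong) (auto simp: E2)
    also have "\<dots> = (\<integral>x. h x * \<phi> x \<partial>Rplus)" by (rule integral_prim_prim_deriv2[OF X h \<phi>])
    finally show "(\<integral>x. f x * deriv2 \<phi> x \<partial>Rplus) = (\<integral>x. h x * \<phi> x \<partial>Rplus)" .
  qed
  then have "f \<in> H2" using f h by (auto simp: H2_def)
  moreover have "(\<forall>x\<ge>0. (prim (prim h) has_vector_derivative prim h x) (at x within {0..}))"
    using prim_has_vector_derivative[OF continuous_on_prim[OF lh]] by blast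
  ultimately show "f \<in> H2_0"
    unfolding H2_0_def using fh continuous_on_prim[OF lh] prim_nonpos[of 0 h] prim_nonpos[of 0 "prim h"]
    by blast
qed

section \<open>The minimal operator\<close>

definition L_expr :: "complex \<Rightarrow> (nat \<Rightarrow> real \<Rightarrow> complex) \<Rightarrow> real \<Rightarrow> complex" where
  "L_expr \<alpha> D x = - D 2 x + (\<alpha> - 1/4) * (D 0 x / (of_real x)\<^sup>2)"

lemma L_expr_L2: "tower D a b \<Longrightarrow> L_expr \<alpha> D \<in> L2"
  unfolding L_expr_def[abs_def] by (intro L2_add L2_uminus L2_cmult tower_L2 tower_L2_div)

lemma dist_L_tower:
  assumes D: "tower D a b" and F: "\<And>x. x > 0 \<Longrightarrow> F x = D 0 x"
  shows "dist_L \<alpha> F (L_expr \<alpha> D)"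
  unfolding dist_L_def
proof
  fix \<phi> :: "real \<Rightarrow> complex" assume \<phi>: "\<phi> \<in> Cc_smooth {0<..}"
  obtain E a' b' where E: "tower E a' b'" "\<And>x. x > 0 \<Longrightarrow> E 0 x = \<phi> x"
    by (rule Cc_smoothE[OF \<phi>], rule that)
  have lin: "(\<integral>x. - f x + c * g x \<partial>Rplus) = - (\<integral>x. f x \<partial>Rplus) + c * (\<integral>x. g x \<partial>Rplus)"
    if "integrable Rplus f" "integrable Rplus g" for f g :: "real \<Rightarrow> complex" and c
    using that by simp
  have i: "integrable Rplus (\<lambda>x. D 0 x * E 2 x)" "integrable Rplus (\<lambda>x. D 2 x * E 0 x)"
    "integrable Rplus (\<lambda>x. D 0 x / (of_real x)\<^sup>2 * E 0 x)"
    by (intro L2_mult_integrable tower_L2[OF D] tower_L2[OF E(1)] tower_L2_div[OF D])+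
  have "(\<integral>x. F x * (- deriv2 \<phi> x + (\<alpha> - 1/4) * (1 / (of_real x)\<^sup>2) * \<phi> x) \<partial>Rplus) =
    (\<integral>x. - (D 0 x * E 2 x) + (\<alpha> - 1/4) * (D 0 x / (of_real x)\<^sup>2 * E 0 x) \<partial>Rplus)"
    by (intro Bochner_Integration.integral_cong) (auto simp: F E(2) tower_deriv2[OF E] algebra_simps)
  also have "\<dots> = - (\<integral>x. D 0 x * E 2 x \<partial>Rplus) + (\<alpha> - 1/4) * (\<integral>x. D 0 x / (of_real x)\<^sup>2 * E 0 x \<partial>Rplus)"
    by (rule lin[OF i(1,3)])
  also have "(\<integral>x. D 0 x * E 2 x \<partial>Rplus) = (\<integral>x. D 2 x * E 0 x \<partial>Rplus)"
    using towerD(2)[OF D, of 0] towerD(2)[OF D, of 1]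
    by (intro tower_by_parts2[OF E(1)]) (auto simp: numeral_2_eq_2 towerD(4)[OF D])
  also have "- (\<integral>x. D 2 x * E 0 x \<partial>Rplus) + (\<alpha> - 1/4) * (\<integral>x. D 0 x / (of_real x)\<^sup>2 * E 0 x \<partial>Rplus) =
     (\<integral>x. - (D 2 x * E 0 x) + (\<alpha> - 1/4) * (D 0 x / (of_real x)\<^sup>2 * E 0 x) \<partial>Rplus)"
    by (rule lin[OF i(2,3), symmetric])
  also have "\<dots> = (\<integral>x. L_expr \<alpha> D x * \<phi> x \<partial>Rplus)"
    by (intro Bochner_Integration.integral_cong) (auto simp: E(2) L_expr_def algebra_simps)
  finally show "(\<integral>x. F x * (- deriv2 \<phi> x + (\<alpha> - 1/4) * (1 / (of_real x)\<^sup>2) * \<phi> x) \<partial>Rplus) = (\<integral>x. L_expr \<alpha> D x * \<phi> x \<partial>Rplus)" .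
qed

text \<open>A pair in the graph carries an arbitrary representative of the image, known only through
  its pairings with test functions. The fundamental lemma identifies it with the pointwise
  expression, so that estimates for towers apply to it.\<close>

lemma L_max_tower_unique:
  assumes X: "cutoff_seq a b C X X' X''" and FG: "(F, G) \<in> L_max \<alpha>"
    and D: "tower D a' b'" "\<And>x. x > 0 \<Longrightarrow> F x = D 0 x"
  shows "AE x in Rplus. G x = L_expr \<alpha> D x"
proof -
  have G: "G \<in> L2" "dist_L \<alpha> F G" using FG by (auto simp: L_max_def)
  note LD = L_expr_L2[OF D(1), of \<alpha>]
  have dD: "dist_L \<alpha> F (L_expr \<alpha> D)" by (rule dist_L_tower[OF D(1)]) (rule D(2))
  have "AE x in Rplus. G x - L_expr \<alpha> D x = 0"
  proof (rule fundamental_lemma[OF X L2_diff[OF G(1) LD]])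
    fix \<phi> :: "real \<Rightarrow> complex" assume \<phi>: "\<phi> \<in> Cc_smooth {0<..}"
    obtain E a' b' where E: "tower E a' b'" "\<And>x. x > 0 \<Longrightarrow> E 0 x = \<phi> x"
      by (rule Cc_smoothE[OF \<phi>], rule that)
    have "(\<integral>x. G x * \<phi> x \<partial>Rplus) = (\<integral>x. L_expr \<alpha> D x * \<phi> x \<partial>Rplus)"
      using G(2)[unfolded dist_L_def, THEN bspec, OF \<phi>] dD[unfolded dist_L_def, THEN bspec, OF \<phi>]
      by (rule trans[OF sym])
    moreover have "integrable Rplus (\<lambda>x. f x * \<phi> x)" if "f \<in> L2" for f
      by (rule Bochner_Integration.integrable_cong[THEN iffD1, OF refl _ L2_mult_integrable[OF that tower_L2[OF E(1), of 0]]])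
         (simp add: E(2))
    note this[OF G(1)] this[OF LD]
    ultimately show "(\<integral>x. (G x - L_expr \<alpha> D x) * \<phi> x \<partial>Rplus) = 0"
      by (simp add: left_diff_distrib)
  qed
  then show ?thesis by eventually_elim simp
qed

lemma tower_diff:
  assumes "tower D a b" "tower E a' b'"
  shows "tower (\<lambda>n x. D n x - E n x) (min a a') (max b b')"
  unfolding tower_def
proof (intro conjI allI impI)
  show "0 < min a a'" using towerD(1)[OF assms(1)] towerD(1)[OF assms(2)] by simp
  show "((\<lambda>x. D n x - E n x) has_vector_derivative D (Suc n) x - E (Suc n) x) (at x)" for n x
    by (intro has_vector_derivative_diff towerD(2)[OF assms(1)] towerD(2)[OF assms(2)])
  show "D n x - E n x = 0" if "x \<notin> {min a a'..max b b'}" for n x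
  proof -
    have "x \<notin> {a..b}" "x \<notin> {a'..b'}" using that by (auto simp: min_le_iff_disj le_max_iff_disj)
    then show ?thesis using towerD(3)[OF assms(1)] towerD(3)[OF assms(2)] by simp
  qed
qed

text \<open>All \<open>D n\<close> vanish at 0, so that no constants of integration appear.\<close>

lemma tower_eq_prim:
  assumes D: "tower D a b" and "x \<ge> 0"
  shows "prim (prim (D 2)) x = D 0 x"
proof -
  have lD: "loc_integrable (D n)" for n by (intro loc_continuous towerD(4)[OF D])
  have D0: "D n 0 = 0" for n using towerD(1,3)[OF D] by auto
  have 1: "prim (D (Suc n)) x = D n x" if "x \<ge> 0" for n x
    by (rule prim_eqI[OF lD that]) (auto intro!: towerD(2,4)[OF D] D0)
  have "prim (prim (D 2)) x = prim (D 1) x"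
    using 1[of _ 1] by (intro prim_cong) (simp add: numeral_2_eq_2)
  then show ?thesis using 1[of x 0] assms(2) by simp
qed

lemma sq_diff_le:
  assumes [measurable]: "f \<in> borel_measurable Rplus" "g \<in> borel_measurable Rplus"
  shows "sq (\<lambda>x. f x - g x) \<le> 2 * sq f + 2 * sq g"
proof -
  have "sq (\<lambda>x. - g x) = sq g" by (simp add: sq_def)
  then show ?thesis using sq_add_le[of f "\<lambda>x. - g x"] by simp
qed

text \<open>Lower semicontinuity of \<open>sq\<close>. It lets an estimate for
  \<open>D j - D k\<close> pass to the limit in \<open>j\<close> when only almost everywhere
  convergence is at hand.\<close>

lemma sq_Fatou:
  assumes [measurable]: "\<And>k. F k \<in> borel_measurable Rplus" "f \<in> borel_measurable Rplus"
    and lim: "AE x in Rplus. (\<lambda>k. F k x) \<longlonglongrightarrow> f x" and le: "\<And>k. sq (F k) \<le> c k" and c: "c \<longlonglongrightarrow> c'"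
  shows "sq f \<le> c'"
proof -
  have "sq f = (\<integral>\<^sup>+x. liminf (\<lambda>k. ennreal ((cmod (F k x))\<^sup>2)) \<partial>Rplus)"
    unfolding sq_def
  proof (rule nn_integral_cong_AE)
    show "AE x in Rplus. ennreal ((cmod (f x))\<^sup>2) = liminf (\<lambda>k. ennreal ((cmod (F k x))\<^sup>2))"
      using lim
    proof eventually_elim
      case (elim x)
      then have "(\<lambda>k. ennreal ((cmod (F k x))\<^sup>2)) \<longlonglongrightarrow> ennreal ((cmod (f x))\<^sup>2)"
        by (intro tendsto_ennrealI tendsto_intros)
      then show ?case by (rule lim_imp_Liminf[OF trivial_limit_sequentially, symmetric])
    qed
  qed
  also have "\<dots> \<le> liminf (\<lambda>k. sq (F k))"
    unfolding sq_def by (rule nn_integral_liminf) measurable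
  also have "\<dots> \<le> liminf c" by (intro Liminf_mono) (simp add: le)
  also have "\<dots> = c'" using c by (rule lim_imp_Liminf[OF trivial_limit_sequentially])
  finally show ?thesis .
qed

text \<open>The second order inequality for differences of test functions makes
  \<open>D k 0 / x^2\<close> a Cauchy sequence, and Fatou's lemma along an almost everywhere
  convergent subsequence identifies its limit as \<open>u / x^2\<close>. Then \<open>D k 2\<close>
  converges as well, being a combination of \<open>D k 0 / x^2\<close> and \<open>L_expr\<close>.
  Since test functions are the double primitives of their second derivatives, Hardy's inequality
  carries this relation over to \<open>u\<close> and the limit \<open>h\<close>.\<close>

lemma Domain_L_min_subset_H2_0:
  assumes X: "cutoff_seq a b C X X' X''" and m: "Re m > 1" and u: "u \<in> Domain (L_min (m\<^sup>2))"
  shows "u \<in> H2_0"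
proof -
  obtain g F G where uL2: "u \<in> L2" and gL2: "g \<in> L2"
    and FG: "\<And>k. (F k, G k) \<in> op_restrict (L_max (m\<^sup>2)) (Cc_smooth {0<..})"
    and limF: "(\<lambda>n. L2_norm (\<lambda>x. F n x - u x)) \<longlonglongrightarrow> 0"
    and limG: "(\<lambda>n. L2_norm (\<lambda>x. G n x - g x)) \<longlonglongrightarrow> 0"
    using u unfolding L_min_def op_closure_def by fastforce
  have FG': "(F k, G k) \<in> L_max (m\<^sup>2)" "F k \<in> Cc_smooth {0<..}" for k
    using FG[of k] by (auto simp: op_restrict_def)
  then have FL2: "F k \<in> L2" and GL2: "G k \<in> L2" for k by (auto simp: L_max_def)
  note [measurable] = L2_measurable[OF uL2] L2_measurable[OF gL2] L2_measurable[OF FL2] L2_measurable[OF GL2]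
  have nF: "L2_null (\<lambda>k x. F k x - u x)" and nG: "L2_null (\<lambda>k x. G k x - g x)"
    using limF limG by (simp_all add: null_iff_L2_norm L2_diff FL2 GL2 uL2 gL2)
  have "\<exists>D a b. tower D a b \<and> (\<forall>x>0. D 0 x = F k x)" for k
  proof -
    obtain D a b where "tower D a b" "\<And>x. x > 0 \<Longrightarrow> D 0 x = F k x"
      by (rule Cc_smoothE[OF FG'(2)], rule that)
    then show ?thesis by blast
  qed
  then obtain D where D': "\<And>k. \<exists>a b. tower (D k) a b" and DF: "\<And>k x. x > 0 \<Longrightarrow> D k 0 x = F k x" by metis
  obtain a' b' where D: "\<And>k. tower (D k) (a' k) (b' k)" using D' by metis
  have DL2: "D k n \<in> L2" for k n by (rule tower_L2[OF D])
  note [measurable] = L2_measurable[OF DL2] L2_measurable[OF L_expr_L2[OF D]]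
  have GD: "AE x in Rplus. G k x = L_expr (m\<^sup>2) (D k) x" for k
    by (rule L_max_tower_unique[OF X FG'(1) D]) (simp add: DF)
  have nL: "L2_null (\<lambda>k x. L_expr (m\<^sup>2) (D k) x - g x)"
  proof (rule null_cong_AE[OF nG])
    show "AE x in Rplus. L_expr (m\<^sup>2) (D k) x - g x = G k x - g x" for k
      using GD[of k] by eventually_elim simp
  qed measurable
  have nD: "L2_null (\<lambda>k x. D k 0 x - u x)"
    by (rule null_cong_AE[OF nF]) (auto intro!: AE_I2 simp: DF)
  define K where "K = 1 / ((Re m + 1) * (Re m - 1))\<^sup>2"
  \<comment> \<open>Inserting \<open>g\<close> separates the bound into a term in \<open>j\<close>
    and a term in \<open>k\<close>, each of which tends to 0.\<close>
  have est: "sq (\<lambda>x. (D j 0 x - D k 0 x) / (of_real x)\<^sup>2) \<le>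
      ennreal K * (2 * sq (\<lambda>x. L_expr (m\<^sup>2) (D j) x - g x) + 2 * sq (\<lambda>x. L_expr (m\<^sup>2) (D k) x - g x))" for j k
  proof -
    have "sq (\<lambda>x. (D j 0 x - D k 0 x) / (of_real x)\<^sup>2) \<le>
       ennreal K * sq (\<lambda>x. - (D j 2 x - D k 2 x) + (m\<^sup>2 - 1/4) * (D j 0 x - D k 0 x) / (of_real x)\<^sup>2)"
      unfolding K_def by (rule second_order_Hardy[OF m tower_diff[OF D D]])
    also have "(\<lambda>x. - (D j 2 x - D k 2 x) + (m\<^sup>2 - 1/4) * (D j 0 x - D k 0 x) / (of_real x)\<^sup>2) =
        (\<lambda>x. (L_expr (m\<^sup>2) (D j) x - g x) - (L_expr (m\<^sup>2) (D k) x - g x))"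
    proof -
      have "- (p2 - q2) + c * (p - q) / z = (- p2 + c * (p / z) - g) - (- q2 + c * (q / z) - g)" for c p q p2 q2 g z :: complex
        by (simp add: right_diff_distrib diff_divide_distrib)
      then show ?thesis unfolding L_expr_def fun_eq_iff by blast
    qed
    also have "sq \<dots> \<le> 2 * sq (\<lambda>x. L_expr (m\<^sup>2) (D j) x - g x) + 2 * sq (\<lambda>x. L_expr (m\<^sup>2) (D k) x - g x)"
      by (rule sq_diff_le) measurable
    finally show ?thesis by (simp add: mult_left_mono)
  qed
  obtain r :: "nat \<Rightarrow> nat" where r: "strict_mono r" "AE x in Rplus. (\<lambda>k. D (r k) 0 x - u x) \<longlonglongrightarrow> 0"
    using null_AE_subseq[OF nD] by blast
  have fatou: "sq (\<lambda>x. (u x - D k 0 x) / (of_real x)\<^sup>2) \<le>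
      ennreal K * (2 * 0 + 2 * sq (\<lambda>x. L_expr (m\<^sup>2) (D k) x - g x))" for k
  proof (rule sq_Fatou[where F = "\<lambda>j x. (D (r j) 0 x - D k 0 x) / (of_real x)\<^sup>2"])
    show "AE x in Rplus. (\<lambda>j. (D (r j) 0 x - D k 0 x) / (of_real x)\<^sup>2) \<longlonglongrightarrow> (u x - D k 0 x) / (of_real x)\<^sup>2"
      using r(2) AE_space
    proof eventually_elim
      case (elim x)
      then have "(\<lambda>j. D (r j) 0 x) \<longlonglongrightarrow> u x" by (simp add: LIM_zero_iff)
      with elim(2) show ?case by (intro tendsto_intros) auto
    qed
    show "sq (\<lambda>x. (D (r j) 0 x - D k 0 x) / (of_real x)\<^sup>2) \<le>
       ennreal K * (2 * sq (\<lambda>x. L_expr (m\<^sup>2) (D (r j)) x - g x) + 2 * sq (\<lambda>x. L_expr (m\<^sup>2) (D k) x - g x))" for j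
      by (rule est)
    have "(\<lambda>j. sq (\<lambda>x. L_expr (m\<^sup>2) (D (r j)) x - g x)) \<longlonglongrightarrow> 0"
      using LIMSEQ_subseq_LIMSEQ[OF nullD(2)[OF nL] r(1)] by (simp add: o_def)
    then show "(\<lambda>j. ennreal K * (2 * sq (\<lambda>x. L_expr (m\<^sup>2) (D (r j)) x - g x) + 2 * sq (\<lambda>x. L_expr (m\<^sup>2) (D k) x - g x)))
       \<longlonglongrightarrow> ennreal K * (2 * 0 + 2 * sq (\<lambda>x. L_expr (m\<^sup>2) (D k) x - g x))"
      by (intro ennreal_tendsto_cmult tendsto_add tendsto_const) auto
  qed measurable
  have "(\<lambda>k. ennreal K * (2 * 0 + 2 * sq (\<lambda>x. L_expr (m\<^sup>2) (D k) x - g x))) \<longlonglongrightarrow> ennreal K * (2 * 0 + 2 * 0)"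
    using nullD(2)[OF nL] by (intro ennreal_tendsto_cmult tendsto_add tendsto_const) auto
  then have "(\<lambda>k. sq (\<lambda>x. (u x - D k 0 x) / (of_real x)\<^sup>2)) \<longlonglongrightarrow> 0"
    by (intro ennreal_squeeze_0[OF _ fatou]) simp
  then have "L2_null (\<lambda>k x. (u x - D k 0 x) / (of_real x)\<^sup>2)" unfolding L2_null_def by simp
  from null_cmult[OF this, of "-1"]
  have nu: "L2_null (\<lambda>k x. D k 0 x / (of_real x)\<^sup>2 - u x / (of_real x)\<^sup>2)"
    by (simp add: diff_divide_distrib)
  \<comment> \<open>The equation \<open>- u'' + (m^2 - 1/4) u / x^2 = g\<close> solved for
    \<open>u''\<close>.\<close>
  define h where "h x = (m\<^sup>2 - 1/4) * (u x / (of_real x)\<^sup>2) - g x" for x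
  have [measurable]: "h \<in> borel_measurable Rplus" unfolding h_def[abs_def] by measurable
  have "L2_null (\<lambda>k x. (m\<^sup>2 - 1/4) * (D k 0 x / (of_real x)\<^sup>2 - u x / (of_real x)\<^sup>2) - (L_expr (m\<^sup>2) (D k) x - g x))"
    by (intro null_diff null_cmult nu nL)
  also have "(\<lambda>k x. (m\<^sup>2 - 1/4) * (D k 0 x / (of_real x)\<^sup>2 - u x / (of_real x)\<^sup>2) - (L_expr (m\<^sup>2) (D k) x - g x)) = (\<lambda>k x. D k 2 x - h x)"
    by (simp add: fun_eq_iff L_expr_def h_def algebra_simps)
  finally have nh: "L2_null (\<lambda>k x. D k 2 x - h x)" .
  have hL2: "h \<in> L2" by (rule null_L2[OF nh DL2]) simp
  \<comment> \<open>This yields a second limit of \<open>D k 0 / x^2\<close>, namely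
    \<open>prim (prim h) / x^2\<close>; uniqueness of limits equates it with
    \<open>u / x^2\<close>.\<close>
  have "L2_null (\<lambda>k x. prim (prim (\<lambda>x. D k 2 x - h x)) x / (of_real x)\<^sup>2)"
    by (rule null_Hardy2[OF nh L2_diff[OF DL2 hL2]])
  note [measurable] = measurable_prim[OF loc_prim[OF loc_L2[OF hL2]]]
  have pp: "prim (prim (\<lambda>x. D k 2 x - h x)) x = D k 0 x - prim (prim h) x" if "x > 0" for k x
  proof -
    have "prim (\<lambda>x. D k 2 x - h x) = (\<lambda>x. prim (D k 2) x - prim h x)"
      by (rule ext) (intro prim_diff loc_L2 DL2 hL2)
    then show ?thesis
      using prim_diff[OF loc_prim[OF loc_L2[OF DL2]] loc_prim[OF loc_L2[OF hL2]], of k 2 x] tower_eq_prim[OF D, of x k] that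
      by simp
  qed
  have "L2_null (\<lambda>k x. D k 0 x / (of_real x)\<^sup>2 - prim (prim h) x / (of_real x)\<^sup>2)"
    by (rule null_cong_AE[OF \<open>L2_null (\<lambda>k x. prim (prim (\<lambda>x. D k 2 x - h x)) x / (of_real x)\<^sup>2)\<close>])
       (auto intro!: AE_I2 simp: pp diff_divide_distrib)
  then have "AE x in Rplus. u x / (of_real x)\<^sup>2 = prim (prim h) x / (of_real x)\<^sup>2"
    by (rule null_unique[OF nu]) measurable
  then have "AE x in Rplus. u x = prim (prim h) x"
    using AE_space by eventually_elim auto
  then show ?thesis using H2_0_iff[OF X] uL2 hL2 by blast
qed

text \<open>\<open>D k 2\<close> and \<open>D k 0 / x^2\<close> converge separately, hence so does
  \<open>L_expr\<close> for any coefficient \<open>\<alpha> - 1/4\<close>. Square integrability of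
  \<open>f\<close> passes to the double primitive and thereby gives the convergence of
  \<open>D k 0\<close> itself.\<close>

lemma H2_0_subset_Domain_L_min:
  assumes X: "cutoff_seq a b C X X' X''" and f: "f \<in> H2_0"
  shows "f \<in> Domain (L_min \<alpha>)"
proof -
  obtain h where fL2: "f \<in> L2" and h: "h \<in> L2" and fh: "AE x in Rplus. f x = prim (prim h) x"
    using f H2_0_iff[OF X] by blast
  note [measurable] = L2_measurable[OF fL2] L2_measurable[OF h]
  have JL2: "prim (prim h) \<in> L2"
    by (rule L2_cong_AE[OF fL2 measurable_prim[OF loc_prim[OF loc_L2[OF h]]]]) (use fh in eventually_elim, simp)
  obtain D :: "nat \<Rightarrow> nat \<Rightarrow> real \<Rightarrow> complex" where D': "\<And>k. \<exists>a b. tower (D k) a b"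
    and n2: "L2_null (\<lambda>k x. D k 2 x - h x)"
    and n1: "L2_null (\<lambda>k x. D k 0 x / (of_real x)\<^sup>2 - prim (prim h) x / (of_real x)\<^sup>2)"
    and n0: "L2_null (\<lambda>k x. D k 0 x - prim (prim h) x)"
    by (rule test_function_approximation[OF X h], rule that) (use JL2 in auto)
  obtain a' b' where D: "\<And>k. tower (D k) (a' k) (b' k)" using D' by metis
  note [measurable] = L2_measurable[OF tower_L2[OF D]]
  define g where "g x = - h x + (\<alpha> - 1/4) * (prim (prim h) x / (of_real x)\<^sup>2)" for x
  have gL2: "g \<in> L2" unfolding g_def[abs_def] by (intro L2_add L2_uminus L2_cmult h L2_Hardy2)
  have "L2_null (\<lambda>k x. (\<alpha> - 1/4) * (D k 0 x / (of_real x)\<^sup>2 - prim (prim h) x / (of_real x)\<^sup>2) - (D k 2 x - h x))"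
    by (intro null_diff null_cmult n1 n2)
  also have "(\<lambda>k x. (\<alpha> - 1/4) * (D k 0 x / (of_real x)\<^sup>2 - prim (prim h) x / (of_real x)\<^sup>2) - (D k 2 x - h x)) =
      (\<lambda>k x. L_expr \<alpha> (D k) x - g x)"
    by (simp add: fun_eq_iff L_expr_def g_def algebra_simps)
  finally have ng: "L2_null (\<lambda>k x. L_expr \<alpha> (D k) x - g x)" .
  have nf: "L2_null (\<lambda>k x. D k 0 x - f x)"
  proof (rule null_cong_AE[OF n0])
    show "AE x in Rplus. D k 0 x - f x = D k 0 x - prim (prim h) x" for k
      using fh by eventually_elim simp
  qed measurable
  have "(D k 0, L_expr \<alpha> (D k)) \<in> op_restrict (L_max \<alpha>) (Cc_smooth {0<..})" for k
    by (simp add: op_restrict_def L_max_def tower_L2[OF D] L_expr_L2[OF D] dist_L_tower[OF D refl] tower_Cc_smooth[OF D])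
  moreover have "(\<lambda>n. L2_norm (\<lambda>x. D n 0 x - f x)) \<longlonglongrightarrow> 0" "(\<lambda>n. L2_norm (\<lambda>x. L_expr \<alpha> (D n) x - g x)) \<longlonglongrightarrow> 0"
    using nf ng by (simp_all add: null_iff_L2_norm L2_diff tower_L2[OF D] L_expr_L2[OF D] fL2 gL2)
  ultimately have "\<exists>F G. (\<forall>n::nat. (F n, G n) \<in> op_restrict (L_max \<alpha>) (Cc_smooth {0<..})) \<and>
      (\<lambda>n. L2_norm (\<lambda>x. F n x - f x)) \<longlonglongrightarrow> 0 \<and> (\<lambda>n. L2_norm (\<lambda>x. G n x - g x)) \<longlonglongrightarrow> 0"
    by (intro exI[of _ "\<lambda>k. D k 0"] exI[of _ "\<lambda>k. L_expr \<alpha> (D k)"]) blast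
  then have "(f, g) \<in> L_min \<alpha>"
    unfolding L_min_def op_closure_def using fL2 gL2 by blast
  then show ?thesis by blast
qed

section \<open>The function \<open>x\<^bsup>1/2+m\<^esup> \<xi>\<close>\<close>

lemma has_vector_derivative_powr:
  "x > 0 \<Longrightarrow> ((\<lambda>x. complex_of_real x powr s) has_vector_derivative s * of_real x powr (s - 1)) (at x)"
  using has_vector_derivative_real_field[OF has_field_derivative_powr[of "of_real x" s], of UNIV]
  by (simp add: complex_nonpos_Reals_iff)

lemma norm_of_real_powr: "x > 0 \<Longrightarrow> cmod (complex_of_real x powr s) = x powr Re s"
  by (simp add: norm_powr_real_powr)

lemma continuous_on_Ici_powr_bound:
  fixes f :: "real \<Rightarrow> complex"
  assumes f: "continuous_on {0<..} f" and b: "\<And>x. x > 0 \<Longrightarrow> cmod (f x) \<le> C * x powr r" and "r > 0" "f 0 = 0"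
  shows "continuous_on {0..} f"
proof -
  have "continuous (at x within {0..}) f" if "x \<ge> 0" for x
  proof (cases "x = 0")
    case True
    have "((\<lambda>x. C * x powr r) \<longlongrightarrow> C * 0) (at_right 0)"
      using assms(3)
      by (intro tendsto_mult tendsto_const tendsto_zero_powrI[of _ _ _ r] tendsto_ident_at
          eventually_mono[OF eventually_at_right_less[of 0]]) auto
    then have "(f \<longlongrightarrow> 0) (at_right 0)"
      by (intro Lim_null_comparison[OF eventually_mono[OF eventually_at_right_less[of 0] b]]) auto
    then show ?thesis using True assms(4) by (simp add: continuous_within at_within_Ici_at_right)
  next
    case False
    then have "x > 0" using that by simp
    then show ?thesis using f
      by (simp add: at_within_Ici continuous_on_eq_continuous_at)
  qed
  then show ?thesis by (simp add: continuous_on_eq_continuous_within)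
qed

text \<open>The square of the bound is of order \<open>x^(2 r)\<close> with \<open>2 r > -1\<close>,
  hence integrable at 0.\<close>

lemma L2_powr_bound:
  assumes f: "f \<in> borel_measurable Rplus" and b: "\<And>x. 0 < x \<Longrightarrow> x \<le> N \<Longrightarrow> cmod (f x) \<le> C * x powr r"
    and 0: "\<And>x. x > N \<Longrightarrow> f x = 0" and r: "r > -1/2" and N: "N \<ge> 0"
  shows "f \<in> L2"
proof -
  have "((\<lambda>x. if x \<in> {0..N} then x powr (2 * r) else 0) has_integral (N powr (2 * r + 1) / (2 * r + 1))) UNIV"
    unfolding has_integral_restrict_UNIV using r N by (intro has_integral_powr_from_0) auto
  then have hi: "((\<lambda>x. C\<^sup>2 * (if x \<in> {0..N} then x powr (2 * r) else 0)) has_integral (C\<^sup>2 * (N powr (2 * r + 1) / (2 * r + 1)))) UNIV"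
    by (rule has_integral_mult_right)
  have "sq f = (\<integral>\<^sup>+x. ennreal ((cmod (f x))\<^sup>2) * indicator {0<..} x \<partial>lborel)"
    unfolding sq_def by (simp add: nn_integral_restrict_space nn_integral_completion)
  also have "\<dots> \<le> (\<integral>\<^sup>+x. ennreal (C\<^sup>2 * (if x \<in> {0..N} then x powr (2 * r) else 0)) \<partial>lborel)"
  proof (intro nn_integral_mono)
    fix x
    have "(cmod (f x))\<^sup>2 \<le> C\<^sup>2 * x powr (2 * r)" if "0 < x" "x \<le> N"
    proof -
      have "(cmod (f x))\<^sup>2 \<le> (C * x powr r)\<^sup>2" using b[OF that] by (intro power_mono) auto
      also have "\<dots> = C\<^sup>2 * x powr (2 * r)"
        by (simp add: power2_eq_square mult_ac flip: powr_add)
      finally show ?thesis .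
    qed
    then show "ennreal ((cmod (f x))\<^sup>2) * indicator {0<..} x \<le> ennreal (C\<^sup>2 * (if x \<in> {0..N} then x powr (2 * r) else 0))"
      using 0[of x] by (auto simp: indicator_def intro!: ennreal_leI)
  qed
  also have "\<dots> = ennreal (C\<^sup>2 * (N powr (2 * r + 1) / (2 * r + 1)))"
    by (intro nn_integral_has_integral_lborel hi) auto
  also have "\<dots> < \<infinity>" by simp
  finally show ?thesis using f by (simp add: L2_iff)
qed

text \<open>The witness \<open>h\<close> is the pointwise second derivative, of size at most
  \<open>x^(Re m - 3/2)\<close> up to a constant, which is square integrable near 0 because
  \<open>Re m > 1\<close>. The function and its first derivative are bounded by positive powers of
  \<open>x\<close>, so both extend by 0 to the origin and integrating \<open>h\<close> twice from 0
  returns the function.\<close>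

lemma powr_cutoff_eq_prim:
  assumes \<xi>: "cutoff \<xi>" and m: "Re m > 1"
  obtains h where "h \<in> L2" "(\<lambda>x. of_real x powr (1/2 + m) * \<xi> x) \<in> L2"
    "\<And>x. x > 0 \<Longrightarrow> of_real x powr (1/2 + m) * \<xi> x = prim (prim h) x"
proof -
  obtain D :: "nat \<Rightarrow> real \<Rightarrow> complex" and a b M where ab: "0 < a" "1 \<le> b" "a \<le> b" "1 \<le> M"
    and D\<xi>: "\<And>x. 0 \<le> x \<Longrightarrow> D 0 x = \<xi> x"
    and der: "\<And>n x. 0 < x \<Longrightarrow> (D n has_vector_derivative D (Suc n) x) (at x)"
    and Da: "\<And>x. 0 < x \<Longrightarrow> x \<le> a \<Longrightarrow> D 0 x = 1" "\<And>n x. 0 < x \<Longrightarrow> x \<le> a \<Longrightarrow> D (Suc n) x = 0"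
    and Db: "\<And>n x. b \<le> x \<Longrightarrow> D n x = 0" and M: "\<And>n x. 0 < x \<Longrightarrow> n \<le> 2 \<Longrightarrow> x ^ n * cmod (D n x) \<le> M"
    and M0: "\<And>n x. 0 < x \<Longrightarrow> n \<le> 2 \<Longrightarrow> cmod (D n x) \<le> M"
    by (rule cutoffE[OF \<xi>], rule that)
  define s where "s = 1/2 + m"
  define Z where "Z r x = complex_of_real x powr r" for r x
  have dZ: "(Z r has_vector_derivative r * Z (r - 1) x) (at x)" if "x > 0" for r x
    unfolding Z_def[abs_def] by (rule has_vector_derivative_powr[OF that])
  have cZ: "continuous_on {0<..} (Z r)" for r
    using dZ by (auto intro!: continuous_at_imp_continuous_on has_vector_derivative_continuous)
  have cD: "continuous_on {0<..} (D n)" for n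
    using der by (auto intro!: continuous_at_imp_continuous_on has_vector_derivative_continuous)
  \<comment> \<open>Each derivative costs one power of \<open>x\<close>, whether it falls on the
    power (\<open>j\<close> times) or on the cutoff (\<open>n\<close> times); for the cutoff this is
    the bound on \<open>x^n |D n x|\<close>.\<close>
  have ZD: "cmod (Z (s - of_nat j) x * D n x) \<le> M * x powr (Re s - (j + n))" if "x > 0" "n \<le> 2" for x n j
  proof -
    have "cmod (Z (s - of_nat j) x * D n x) = x powr (Re s - j) * cmod (D n x)"
      by (simp add: Z_def norm_mult norm_of_real_powr that)
    also have "x powr (Re s - j) = x powr (Re s - (j + n)) * x ^ n"
      using that by (simp add: powr_realpow[symmetric] flip: powr_add)
    also have "x powr (Re s - (j + n)) * x ^ n * cmod (D n x) = x powr (Re s - (j + n)) * (x ^ n * cmod (D n x))"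
      by (simp add: mult.assoc)
    also have "\<dots> \<le> x powr (Re s - (j + n)) * M" using M[OF that] by (rule mult_left_mono) simp
    finally show ?thesis by (simp add: mult.commute)
  qed
  \<comment> \<open>The case distinction fixes the value 0 at the origin, where continuity and the
    initial values are needed; the formulas themselves serve only for \<open>x > 0\<close>.\<close>
  define p0 where "p0 x = (if x > 0 then Z s x * D 0 x else 0)" for x
  define p1 where "p1 x = (if x > 0 then s * (Z (s - 1) x * D 0 x) + Z s x * D 1 x else 0)" for x
  define p2 where "p2 x = s * (s - 1) * (Z (s - 2) x * D 0 x) + 2 * s * (Z (s - 1) x * D 1 x) + Z s x * D 2 x" for x
  have d0: "(p0 has_vector_derivative p1 x) (at x)" if "x > 0" for x
  proof -
    have "((\<lambda>x. Z s x * D 0 x) has_vector_derivative p1 x) (at x)"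
      using has_vector_derivative_mult[OF dZ[OF that, of s] der[OF that, of 0]] that by (simp add: p1_def algebra_simps)
    then show ?thesis
      by (rule has_vector_derivative_transform_within_open[of _ _ _ "{0<..}"]) (auto simp: p0_def that)
  qed
  have d1: "(p1 has_vector_derivative p2 x) (at x)" if "x > 0" for x
  proof -
    have "((\<lambda>x. s * (Z (s - 1) x * D 0 x) + Z s x * D 1 x) has_vector_derivative
       s * (Z (s - 1) x * D (Suc 0) x + (s - 1) * Z (s - 1 - 1) x * D 0 x) + (Z s x * D (Suc 1) x + s * Z (s - 1) x * D 1 x)) (at x)"
      by (intro has_vector_derivative_add has_vector_derivative_mult_right has_vector_derivative_mult dZ der that)
    moreover have "s * (Z (s - 1) x * D (Suc 0) x + (s - 1) * Z (s - 1 - 1) x * D 0 x) + (Z s x * D (Suc 1) x + s * Z (s - 1) x * D 1 x) = p2 x"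
      by (simp add: p2_def numeral_2_eq_2 algebra_simps)
    ultimately have "((\<lambda>x. s * (Z (s - 1) x * D 0 x) + Z s x * D 1 x) has_vector_derivative p2 x) (at x)" by simp
    then show ?thesis
      by (rule has_vector_derivative_transform_within_open[of _ _ _ "{0<..}"]) (auto simp: p1_def that)
  qed
  have cp2: "continuous_on {0<..} p2" unfolding p2_def[abs_def] by (intro continuous_intros cZ cD)
  have cp01: "continuous_on {0<..} p0" "continuous_on {0<..} p1"
    using d0 d1 by (auto intro!: continuous_at_imp_continuous_on has_vector_derivative_continuous)
  have b0: "cmod (p0 x) \<le> M * x powr (Re s)" if "x > 0" for x
    using ZD[OF that, of 0 0] that by (simp add: p0_def)
  have b1: "cmod (p1 x) \<le> ((cmod s + 1) * M) * x powr (Re s - 1)" if "x > 0" for x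
  proof -
    have "cmod (p1 x) \<le> cmod s * cmod (Z (s - 1) x * D 0 x) + cmod (Z s x * D 1 x)"
      using norm_triangle_ineq[of "s * (Z (s - 1) x * D 0 x)" "Z s x * D 1 x"] that by (simp add: p1_def norm_mult)
    also have "\<dots> \<le> cmod s * (M * x powr (Re s - 1)) + M * x powr (Re s - 1)"
      using ZD[OF that, of 0 1] ZD[OF that, of 1 0] by (intro add_mono mult_left_mono) auto
    finally show ?thesis by (simp add: algebra_simps)
  qed
  define C where "C = (cmod (s * (s - 1)) + cmod (2 * s) + 1) * M"
  have b2: "cmod (p2 x) \<le> C * x powr (Re s - 2)" if "x > 0" for x
  proof -
    have "cmod (p2 x) \<le> cmod (s * (s - 1) * (Z (s - 2) x * D 0 x)) + cmod (2 * s * (Z (s - 1) x * D 1 x)) + cmod (Z s x * D 2 x)"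
      unfolding p2_def by (intro order_trans[OF norm_triangle_ineq add_right_mono[OF norm_triangle_ineq]])
    also have "\<dots> = cmod (s * (s - 1)) * cmod (Z (s - 2) x * D 0 x) + cmod (2 * s) * cmod (Z (s - 1) x * D 1 x) + cmod (Z s x * D 2 x)"
      by (simp only: norm_mult)
    also have "\<dots> \<le> cmod (s * (s - 1)) * (M * x powr (Re s - 2)) + cmod (2 * s) * (M * x powr (Re s - 2)) + M * x powr (Re s - 2)"
      using ZD[OF that, of 0 2] ZD[OF that, of 1 1] ZD[OF that, of 2 0] by (intro add_mono mult_left_mono) auto
    also have "\<dots> = C * x powr (Re s - 2)" by (simp add: C_def algebra_simps)
    finally show ?thesis .
  qed
  have Re_s: "Re s > 3/2" using m by (simp add: s_def)
  have p2L2: "p2 \<in> L2"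
    by (rule L2_powr_bound[where N = b and r = "Re s - 2" and C = C])
       (use b2 Re_s ab Db cp2 in \<open>auto simp: p2_def intro: measurable_continuous_Ioi\<close>)
  have p0L2: "p0 \<in> L2"
    by (rule L2_powr_bound[where N = b and r = "Re s" and C = M])
       (use b0 Re_s ab Db cp01 in \<open>auto simp: p0_def intro: measurable_continuous_Ioi\<close>)
  have c0: "continuous_on {0..} p0"
    by (rule continuous_on_Ici_powr_bound[OF cp01(1) b0]) (use Re_s in \<open>auto simp: p0_def\<close>)
  have c1: "continuous_on {0..} p1"
    by (rule continuous_on_Ici_powr_bound[OF cp01(2) b1]) (use Re_s in \<open>auto simp: p1_def\<close>)
  have p00: "p0 0 = 0" and p10: "p1 0 = 0" by (simp_all add: p0_def p1_def)
  have e1: "prim p2 x = p1 x" if "x \<ge> 0" for x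
    by (rule prim_eqI[OF loc_L2[OF p2L2] that]) (auto intro!: d1 continuous_on_subset[OF c1] simp: p10)
  have e0: "prim p1 x = p0 x" if "x \<ge> 0" for x
    by (rule prim_eqI[OF loc_continuous[OF c1] that]) (auto intro!: d0 continuous_on_subset[OF c0] simp: p00)
  have e: "of_real x powr (1/2 + m) * \<xi> x = p0 x" if "x > 0" for x
    using that D\<xi> by (simp add: p0_def Z_def s_def)
  show ?thesis
  proof (rule that[OF p2L2])
    show "of_real x powr (1/2 + m) * \<xi> x = prim (prim p2) x" if "x > 0" for x
    proof -
      have "prim (prim p2) x = prim p1 x" by (rule prim_cong) (simp add: e1)
      then show ?thesis using e0[of x] e[OF that] that by simp
    qed
    have "(\<lambda>x. of_real x powr (1/2 + m) * \<xi> x) \<in> borel_measurable Rplus"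
      using measurable_cong[of Rplus p0 "\<lambda>x. of_real x powr (1/2 + m) * \<xi> x" borel] L2_measurable[OF p0L2] e by simp
    then show "(\<lambda>x. of_real x powr (1/2 + m) * \<xi> x) \<in> L2"
      by (rule L2_cong_AE[OF p0L2]) (auto intro!: AE_I2 simp: e)
  qed
qed

lemma prim_add_cmult:
  assumes "loc_integrable f" "loc_integrable g"
  shows "prim (\<lambda>x. f x + c * g x) x = prim f x + c * prim g x"
  using assms unfolding prim_def loc_integrable_def by (subst set_integral_add) auto

text \<open>The minimal domain already consists of the square integrable double primitives. Adding
  multiples of \<open>x^(1/2+m) \<xi>\<close> stays within this class, as that function is of the
  same kind and the class is a linear space.\<close>

theorem theorem6p1:
  fixes m :: complex and \<xi> :: "real \<Rightarrow> complex"
  assumes "Re m > 1" and "cutoff \<xi>"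
  shows "H_dom m \<xi> = H2_0"
proof -
  obtain a b C X X' X'' where X: "cutoff_seq a b C X X' X''"
    by (rule cutoff_seq_exists[OF assms(2)], rule that)
  let ?p = "\<lambda>x. of_real x powr (1/2 + m) * \<xi> x"
  obtain k where k: "k \<in> L2" "?p \<in> L2" "\<And>x. x > 0 \<Longrightarrow> ?p x = prim (prim k) x"
    by (rule powr_cutoff_eq_prim[OF assms(2,1)], rule that)
  show ?thesis
  proof (intro set_eqI iffI)
    fix f assume "f \<in> H_dom m \<xi>"
    then obtain u c where f: "f \<in> borel_measurable Rplus" and u: "u \<in> Domain (L_min (m\<^sup>2))"
      and fu: "AE x in Rplus. f x = u x + c * ?p x"
      unfolding H_dom_def by blast
    obtain h where uL2: "u \<in> L2" and h: "h \<in> L2" and uh: "AE x in Rplus. u x = prim (prim h) x"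
      using Domain_L_min_subset_H2_0[OF X assms(1) u] H2_0_iff[OF X] by blast
    have fL2: "f \<in> L2"
      by (rule L2_cong_AE[OF L2_add[OF uL2 L2_cmult[OF k(2)]] f fu])
    have pp: "prim (prim (\<lambda>x. h x + c * k x)) x = prim (prim h) x + c * prim (prim k) x" for x
    proof -
      have "prim (\<lambda>x. h x + c * k x) = (\<lambda>x. prim h x + c * prim k x)"
        by (rule ext) (intro prim_add_cmult loc_L2 h k)
      then show ?thesis by (simp add: prim_add_cmult loc_prim loc_L2 h k)
    qed
    have "AE x in Rplus. f x = prim (prim (\<lambda>x. h x + c * k x)) x"
      using fu uh AE_space by eventually_elim (simp add: k(3) pp)
    then show "f \<in> H2_0"
      using H2_0_iff[OF X] fL2 L2_add[OF h L2_cmult[OF k(1)]] by blast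
  next
    fix f assume f: "f \<in> H2_0"
    then have "f \<in> L2" by (simp add: H2_0_def H2_def)
    then show "f \<in> H_dom m \<xi>"
      using H2_0_subset_Domain_L_min[OF X f, of "m\<^sup>2"]
      unfolding H_dom_def by (auto intro!: bexI[of _ f] exI[of _ 0] L2_measurable)
  qed
qed

end
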